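(* Let $d\ge1$, $\alpha\in(0,1)$, $\psi_0=\mathbb I_{[-1,1]^d}$, $T\equiv T(Y,\psi_0)$ the multiscale statistic with kernel $\psi_0$, and $\kappa_\alpha=\inf\{c\in\mathbb R:\mathbb P(T(W,\psi_0)>c)\le\alpha\}$. Consider testing $H_0:f=0$ versus $H_1:f=\mu_n\mathbb I_{B_n}$, where $\mu_n\in\mathbb R\setminus\{0\}$ and the axis-aligned hyperrectangle $B_n\subseteq[0,1]^d$ are unknown, and write $f_n=\mu_n\mathbb I_{B_n}$. Let $|B_n|$ denote the Lebesgue measure of $B_n$. (a) Suppose that $\liminf_{n\to\infty}|B_n|>0$. Let $\phi_n$ be any tests of level $\alpha$. Then for any $f_n=\mu_n\mathbb I_{B_n}$ such that $\limsup_n|\mu_n|\sqrt{n|B_n|}<\infty$, $$\limsup_{n\to\infty}\mathbb E_{f_n}[\phi_n(Y)]<1.$$ Moreover, for every sequence $f_n=\mu_n\mathbb I_{B_n}$ (with $\liminf_n|B_n|>0$) such that $\lim_n|\mu_n|\sqrt{n|B_n|}=\infty$, $$\lim_{n\to\infty}\mathbb P_{f_n}(T>\kappa_\alpha)=1.$$ (b) Let $h_n=(h_{1,n},\dots,h_{d,n})\in(0,1/2]^d$ be any sequence with $\lim_{n\to\infty}\prod_{i=1}^dh_{i,n}=0$, so that $|B_n|=2^d\prod_{i=1}^dh_{i,n}\to0$ for $B_n\in\mathscr B_{h_n}$, and let $\epsilon_n>0$ satisfy $\epsilon_n\to0$ and $\epsilon_n\sqrt{2\log(1/|B_n|)}\to\infty$.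 Let $$\mathcal G_n^-=\Big\{f_n=\mu_n\mathbb I_{B_n}:\ |\mu_n|\sqrt{n|B_n|}=(1-\epsilon_n)\sqrt{2\log(1/|B_n|)},\ B_n\in\mathscr B_{h_n}\Big\}.$$ If $\phi_n$ are any tests of level $\alpha$, then $$\limsup_{n\to\infty}\ \inf_{f_n\in\mathcal G_n^-}\mathbb E_{f_n}[\phi_n(Y)]\le\alpha.$$ Moreover, let $$\mathcal G_n^+=\Big\{f_n=\mu_n\mathbb I_{B_n}:\ |\mu_n|\sqrt{n|B_n|}\ge(1+\epsilon_n)\sqrt{2\log(1/|B_n|)},\ B_n\in\mathscr B_{h_n}\Big\}.$$ Then $$\lim_{n\to\infty}\ \inf_{f_n\in\mathcal G_n^+}\mathbb P_{f_n}(T>\kappa_\alpha)=1.$$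
   Context: Model: for each $n$ one observes $Y=\{Y(t):t\in[0,1]^d\}$ with $Y(t_1,\dots,t_d)=\sqrt n\int_0^{t_1}\cdots\int_0^{t_d}f(s_1,\dots,s_d)\,ds_d\cdots ds_1+W(t_1,\dots,t_d)$, where $f\in L_1([0,1]^d)$ is unknown and $W$ is the standard Brownian sheet (mean-zero Gaussian, $\mathrm{Cov}(W(t),W(s))=\prod_i\min(t_i,s_i)$). $\mathbb P_g,\mathbb E_g$ denote probability and expectation when $f=g$. A test $\phi_n$ is a measurable $[0,1]$-valued function of $Y$; it has level $\alpha$ if $\mathbb E_0[\phi_n(Y)]\le\alpha$. For bounded measurable $\varphi$ and $f$ integrable, $\int\varphi\,dY=\sqrt n\int\varphi f\,dx+\int\varphi\,dW$ (Wiener integral). Multiscale statistic: for $\psi\in L_2(\mathbb R^d)$ vanishing outside $[-1,1]^d$, $h\in(0,1/2]^d$, $t\in A_h=\{t\in\mathbb{R}^d:h_i\le t_i\le1-h_i\ \forall i\}$, let $\psi_{t,h}(x)=\psi\big(\frac{x_1-t_1}{h_1},\dots,\frac{x_d-t_d}{h_d}\big)$ for $x\in[0,1]^d$, and $\hat\Psi(t,h)=(\prod_ih_i)^{-1/2}\|\psi\|^{-1}\int_{[0,1]^d}\psi_{t,h}\,dY$ (with $Y$ replaced by $W$ for $T(W,\psi)$), where $\|\psi\|^2=\int_{\mathbb R^d}\psi^2$. Then $$T(Y,\psi)=\sup_{h\in(0,1/2]^d}\sup_{t\in A_h}\frac{|\hat\Psi(t,h)|-\Gamma(2^dh_1\cdots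 h_d)}{D(2^dh_1\cdots h_d)},$$ with $\Gamma(r)=(2\log(1/r))^{1/2}$, $D(r)=(\log(e/r))^{-1/2}\log\log(e^e/r)$, $r\in(0,1]$. The process $(t,h)\mapsto\int\psi_{t,h}\,dW$ is taken in a version with continuous sample paths. Hyperrectangles: an axis-aligned hyperrectangle in $[0,1]^d$ is a set $\prod_{i=1}^d[t_i-h_i,t_i+h_i]$ (or its interior; the difference is a null set) with $h\in(0,1/2]^d$, $t\in A_h$. For $h\in(0,1/2]^d$, $\mathscr B_h=\{B\subseteq[0,1]^d:\ B=\prod_{i=1}^d[t_i-h_i,t_i+h_i]\text{ for some }t\in A_h\}$. *)

theory Defs
  imports "HOL-Probability.Probability"
begin

section \<open>Gaussian white noise on the unit cube\<close>

definition unit_cube :: "(real ^ 'd) set" where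
  "unit_cube = cbox 0 1"

text \<open>Point masses count as (degenerate) Gaussian laws; a Brownian sheet needs them, since it
  vanishes where some coordinate is 0.\<close>

definition gaussian_rv :: "'w measure \<Rightarrow> ('w \<Rightarrow> real) \<Rightarrow> bool" where
  "gaussian_rv M Z \<longleftrightarrow>
     (\<exists>m \<sigma>. 0 < \<sigma> \<and> distributed M lborel Z (normal_density m \<sigma>)) \<or>
     (Z \<in> borel_measurable M \<and> (\<exists>m. AE \<omega> in M. Z \<omega> = m))"

definition gaussian_process :: "'w measure \<Rightarrow> 'i set \<Rightarrow> ('i \<Rightarrow> 'w \<Rightarrow> real) \<Rightarrow> bool" where
  "gaussian_process M I Z \<longleftrightarrow>
     (\<forall>S a. finite S \<and> S \<subseteq> I \<longrightarrow> gaussian_rv M (\<lambda>\<omega>. \<Sum>i\<in>S. a i * Z i \<omega>))"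

text \<open>The sheet is specified by its finite-dimensional distributions. Path continuity is not
  imposed, so sheets with continuous paths are a special case.\<close>

definition brownian_sheet :: "'w measure \<Rightarrow> (real ^ 'd \<Rightarrow> 'w \<Rightarrow> real) \<Rightarrow> bool" where
  "brownian_sheet M W \<longleftrightarrow>
     prob_space M \<and>
     gaussian_process M unit_cube W \<and>
     (\<forall>t\<in>unit_cube. (\<integral>\<omega>. W t \<omega> \<partial>M) = 0) \<and>
     (\<forall>s\<in>unit_cube. \<forall>t\<in>unit_cube.
        (\<integral>\<omega>. W s \<omega> * W t \<omega> \<partial>M) = (\<Prod>i\<in>UNIV. min (s $ i) (t $ i)))"

text \<open>\<open>Z\<close> is (a version of) the Wiener integral of \<open>g\<close> over the unit cube: the \<open>L\<^sup>2\<close>-limit of the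
  integrals of step functions \<open>\<Sum>u\<in>S. a u * indicator (cbox 0 u)\<close>, whose integral is
  \<open>\<Sum>u\<in>S. a u * W u\<close>, along step functions converging to \<open>g\<close> in \<open>L\<^sup>2\<close> of the cube.
  It is determined by \<open>g\<close> up to null sets.\<close>

definition has_wiener_integral ::
  "'w measure \<Rightarrow> (real ^ 'd \<Rightarrow> 'w \<Rightarrow> real) \<Rightarrow> (real ^ 'd \<Rightarrow> real) \<Rightarrow> ('w \<Rightarrow> real) \<Rightarrow> bool" where
  "has_wiener_integral M W g Z \<longleftrightarrow>
     set_borel_measurable lborel unit_cube g \<and>
     Z \<in> borel_measurable M \<and>
     (\<exists>S a. (\<forall>k::nat. finite (S k) \<and> S k \<subseteq> unit_cube) \<and>
        (\<lambda>k. \<integral>\<^sup>+x\<in>unit_cube.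
            ennreal ((g x - (\<Sum>u\<in>S k. a k u * indicator (cbox 0 u) x))\<^sup>2) \<partial>lborel) \<longlonglongrightarrow> 0 \<and>
        (\<lambda>k. \<integral>\<^sup>+\<omega>. ennreal ((Z \<omega> - (\<Sum>u\<in>S k. a k u * W u \<omega>))\<^sup>2) \<partial>M) \<longlonglongrightarrow> 0)"

definition observation ::
  "(real ^ 'd \<Rightarrow> 'w \<Rightarrow> real) \<Rightarrow> nat \<Rightarrow> (real ^ 'd \<Rightarrow> real) \<Rightarrow> real ^ 'd \<Rightarrow> 'w \<Rightarrow> real" where
  "observation W n f t \<omega> = sqrt (real n) * (LINT s:cbox 0 t|lborel. f s) + W t \<omega>"

text \<open>A test acts on sample paths over the cube, with the \<open>\<sigma>\<close>-algebra generated by the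
  coordinates. On continuous paths its trace is the Borel \<open>\<sigma>\<close>-algebra of the uniform norm.\<close>

definition is_test :: "((real ^ 'd \<Rightarrow> real) \<Rightarrow> real) \<Rightarrow> bool" where
  "is_test \<phi> \<longleftrightarrow>
     \<phi> \<in> borel_measurable (Pi\<^sub>M unit_cube (\<lambda>_. borel)) \<and>
     (\<forall>y\<in>space (Pi\<^sub>M unit_cube (\<lambda>_. borel :: real measure)). 0 \<le> \<phi> y \<and> \<phi> y \<le> 1)"

definition test_expectation ::
  "'w measure \<Rightarrow> (real ^ 'd \<Rightarrow> 'w \<Rightarrow> real) \<Rightarrow> nat \<Rightarrow> (real ^ 'd \<Rightarrow> real) \<Rightarrow>
     ((real ^ 'd \<Rightarrow> real) \<Rightarrow> real) \<Rightarrow> real" where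
  "test_expectation M W n f \<phi> = (\<integral>\<omega>. \<phi> (\<lambda>t\<in>unit_cube. observation W n f t \<omega>) \<partial>M)"

definition level_test ::
  "'w measure \<Rightarrow> (real ^ 'd \<Rightarrow> 'w \<Rightarrow> real) \<Rightarrow> real \<Rightarrow> nat \<Rightarrow> ((real ^ 'd \<Rightarrow> real) \<Rightarrow> real) \<Rightarrow> bool"
where
  "level_test M W \<alpha> n \<phi> \<longleftrightarrow> is_test \<phi> \<and> test_expectation M W n (\<lambda>_. 0) \<phi> \<le> \<alpha>"


section \<open>The multiscale statistic\<close>

definition bandwidths :: "(real ^ 'd) set" where
  "bandwidths = {h. \<forall>i. 0 < h $ i \<and> h $ i \<le> 1 / 2}"

definition centers :: "real ^ 'd \<Rightarrow> (real ^ 'd) set" where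
  "centers h = {t. \<forall>i. h $ i \<le> t $ i \<and> t $ i \<le> 1 - h $ i}"

text \<open>Pairs \<open>(t, h)\<close>.\<close>

definition scale_space :: "((real ^ 'd) \<times> (real ^ 'd)) set" where
  "scale_space = {(t, h). h \<in> bandwidths \<and> t \<in> centers h}"

definition rect_volume :: "real ^ 'd \<Rightarrow> real" where
  "rect_volume h = 2 ^ CARD('d) * (\<Prod>i\<in>UNIV. h $ i)"

definition scaled_kernel ::
  "(real ^ 'd \<Rightarrow> real) \<Rightarrow> real ^ 'd \<Rightarrow> real ^ 'd \<Rightarrow> real ^ 'd \<Rightarrow> real" where
  "scaled_kernel \<psi> t h x = \<psi> (\<chi> i. (x $ i - t $ i) / h $ i)"

definition kernel_norm :: "(real ^ 'd \<Rightarrow> real) \<Rightarrow> real" where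
  "kernel_norm \<psi> = sqrt (LINT x|lborel. (\<psi> x)\<^sup>2)"

definition cube_kernel :: "real ^ 'd \<Rightarrow> real" where
  "cube_kernel = indicator (cbox (- 1) 1)"

text \<open>\<open>X t h\<close> is the integral of \<open>scaled_kernel \<psi> t h\<close> against the sheet, in a version
  that is continuous in \<open>(t, h)\<close>. Any two such versions are indistinguishable.\<close>

definition continuous_wiener_version ::
  "'w measure \<Rightarrow> (real ^ 'd \<Rightarrow> 'w \<Rightarrow> real) \<Rightarrow> (real ^ 'd \<Rightarrow> real) \<Rightarrow>
     (real ^ 'd \<Rightarrow> real ^ 'd \<Rightarrow> 'w \<Rightarrow> real) \<Rightarrow> bool" where
  "continuous_wiener_version M W \<psi> X \<longleftrightarrow>
     (\<forall>(t, h)\<in>scale_space. has_wiener_integral M W (scaled_kernel \<psi> t h) (X t h)) \<and>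
     (\<forall>\<omega>\<in>space M. continuous_on scale_space (\<lambda>(t, h). X t h \<omega>))"

text \<open>The integral of \<open>scaled_kernel \<psi> t h\<close> against the observation with signal \<open>f\<close>.\<close>

definition kernel_integral_Y ::
  "(real ^ 'd \<Rightarrow> real) \<Rightarrow> (real ^ 'd \<Rightarrow> real ^ 'd \<Rightarrow> 'w \<Rightarrow> real) \<Rightarrow> nat \<Rightarrow>
     (real ^ 'd \<Rightarrow> real) \<Rightarrow> real ^ 'd \<Rightarrow> real ^ 'd \<Rightarrow> 'w \<Rightarrow> real" where
  "kernel_integral_Y \<psi> X n f t h \<omega> =
     sqrt (real n) * (LINT x:unit_cube|lborel. scaled_kernel \<psi> t h x * f x) + X t h \<omega>"

definition scale_Gamma :: "real \<Rightarrow> real" where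
  "scale_Gamma r = sqrt (2 * ln (1 / r))"

definition scale_D :: "real \<Rightarrow> real" where
  "scale_D r = ln (ln (exp (exp 1) / r)) / sqrt (ln (exp 1 / r))"

definition local_stat ::
  "(real ^ 'd \<Rightarrow> real) \<Rightarrow> (real ^ 'd \<Rightarrow> real ^ 'd \<Rightarrow> 'w \<Rightarrow> real) \<Rightarrow>
     real ^ 'd \<Rightarrow> real ^ 'd \<Rightarrow> 'w \<Rightarrow> real" where
  "local_stat \<psi> Z t h \<omega> = Z t h \<omega> / (sqrt (\<Prod>i\<in>UNIV. h $ i) * kernel_norm \<psi>)"

text \<open>Here \<open>Z t h\<close> stands for the integral of \<open>scaled_kernel \<psi> t h\<close> against the driving process:
  \<open>kernel_integral_Y \<psi> X n f\<close> for the data, and \<open>X\<close> for the noise.\<close>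

definition multiscale_stat ::
  "(real ^ 'd \<Rightarrow> real) \<Rightarrow> (real ^ 'd \<Rightarrow> real ^ 'd \<Rightarrow> 'w \<Rightarrow> real) \<Rightarrow> 'w \<Rightarrow> ereal" where
  "multiscale_stat \<psi> Z \<omega> =
     (SUP h\<in>bandwidths. SUP t\<in>centers h.
        ereal ((\<bar>local_stat \<psi> Z t h \<omega>\<bar> - scale_Gamma (rect_volume h)) / scale_D (rect_volume h)))"

text \<open>The set below is bounded below, as the statistic is nonnegative (at \<open>h $ i = t $ i = 1 / 2\<close>
  the penalty vanishes), and nonempty, as the statistic is almost surely finite under the noise; so
  the real \<open>Inf\<close> is the genuine infimum.\<close>

definition critical_value ::
  "'w measure \<Rightarrow> (real ^ 'd \<Rightarrow> real) \<Rightarrow> (real ^ 'd \<Rightarrow> real ^ 'd \<Rightarrow> 'w \<Rightarrow> real) \<Rightarrow> real \<Rightarrow> real"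
where
  "critical_value M \<psi> X \<alpha> =
     Inf {c. measure M {\<omega> \<in> space M. ereal c < multiscale_stat \<psi> X \<omega>} \<le> \<alpha>}"

definition rejection_prob ::
  "'w measure \<Rightarrow> (real ^ 'd \<Rightarrow> real) \<Rightarrow> (real ^ 'd \<Rightarrow> real ^ 'd \<Rightarrow> 'w \<Rightarrow> real) \<Rightarrow> real \<Rightarrow> nat \<Rightarrow>
     (real ^ 'd \<Rightarrow> real) \<Rightarrow> real" where
  "rejection_prob M \<psi> X \<alpha> n f =
     measure M {\<omega> \<in> space M.
       ereal (critical_value M \<psi> X \<alpha>) < multiscale_stat \<psi> (kernel_integral_Y \<psi> X n f) \<omega>}"


section \<open>Hyperrectangle alternatives\<close>

definition closed_rects :: "real ^ 'd \<Rightarrow> (real ^ 'd) set set" where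
  "closed_rects h = {cbox (t - h) (t + h) | t. t \<in> centers h}"

definition hyperrectangles :: "(real ^ 'd) set set" where
  "hyperrectangles =
     {B. \<exists>h\<in>bandwidths. \<exists>t\<in>centers h. B = cbox (t - h) (t + h) \<or> B = box (t - h) (t + h)}"

definition rect_signal :: "real \<Rightarrow> (real ^ 'd) set \<Rightarrow> real ^ 'd \<Rightarrow> real" where
  "rect_signal \<mu> B x = \<mu> * indicator B x"

definition signal_strength :: "nat \<Rightarrow> real \<Rightarrow> (real ^ 'd) set \<Rightarrow> real" where
  "signal_strength n \<mu> B = \<bar>\<mu>\<bar> * sqrt (real n * measure lborel B)"

definition G_minus :: "nat \<Rightarrow> real ^ 'd \<Rightarrow> real \<Rightarrow> (real ^ 'd \<Rightarrow> real) set" where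
  "G_minus n h \<epsilon> = {rect_signal \<mu> B | \<mu> B. \<mu> \<noteq> 0 \<and> B \<in> closed_rects h \<and>
     signal_strength n \<mu> B = (1 - \<epsilon>) * sqrt (2 * ln (1 / measure lborel B))}"

definition G_plus :: "nat \<Rightarrow> real ^ 'd \<Rightarrow> real \<Rightarrow> (real ^ 'd \<Rightarrow> real) set" where
  "G_plus n h \<epsilon> = {rect_signal \<mu> B | \<mu> B. \<mu> \<noteq> 0 \<and> B \<in> closed_rects h \<and>
     signal_strength n \<mu> B \<ge> (1 + \<epsilon>) * sqrt (2 * ln (1 / measure lborel B))}"

lemma closed_rects_subset_unit_cube:
  assumes "B \<in> closed_rects h"
  shows "B \<subseteq> unit_cube"
proof
  fix x assume x: "x \<in> B"
  obtain t where t: "t \<in> centers h" and B: "B = cbox (t - h) (t + h)"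
    using assms by (auto simp: closed_rects_def)
  have "0 \<le> x $ i \<and> x $ i \<le> 1" for i
  proof -
    have "t $ i - h $ i \<le> x $ i" "x $ i \<le> t $ i + h $ i"
      using x by (simp_all add: B mem_box_cart)
    moreover have "h $ i \<le> t $ i" "t $ i \<le> 1 - h $ i"
      using t by (simp_all add: centers_def)
    ultimately show ?thesis by linarith
  qed
  then show "x \<in> unit_cube"
    by (simp add: unit_cube_def mem_box_cart)
qed

lemma measure_closed_rects:
  fixes h :: "real ^ 'd"
  assumes "h \<in> bandwidths" "B \<in> closed_rects h"
  shows "measure lborel B = rect_volume h"
proof -
  obtain t where B: "B = cbox (t - h) (t + h)"
    using assms(2) by (auto simp: closed_rects_def)
  have h0: "0 \<le> h $ i" for i
    using assms(1) by (simp add: bandwidths_def less_imp_le)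
  have "cbox (t - h) (t + h) \<noteq> {}"
    using h0 by (simp add: interval_ne_empty_cart)
  then have "measure lborel B = (\<Prod>i\<in>UNIV. (t + h) $ i - (t - h) $ i)"
    unfolding B by (rule content_cbox_cart)
  also have "\<dots> = (\<Prod>i\<in>UNIV. 2 * h $ i)"
    by (intro prod.cong) auto
  finally show ?thesis
    by (simp add: rect_volume_def prod.distrib)
qed

end

theory Submission
  imports Defs "HOL-Real_Asymp.Real_Asymp"
begin

text \<open>By the Cameron-Martin formula, observing \<open>\<mu> \<cdot> indicator B\<close> amounts to reweighting pure noise by
  \<open>exp (c \<xi> - c\<^sup>2 / 2)\<close>, where \<open>\<xi>\<close> is the normalised noise integral over \<open>B\<close>, a standard normal
  variable, and \<open>\<bar>c\<bar>\<close> is the signal strength. For bounded \<open>c\<close> these weights are bounded below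
  off an event of small probability, so no level \<open>\<alpha>\<close> test has power tending to 1. For small
  rectangles the alternatives are mixed over a packing of disjoint translates: the average of the
  truncated weights has vanishing variance, so the mixture cannot be told apart from noise.

  The critical value is a fixed real number, so consistency of the multiscale test only requires the
  statistic to tend to infinity in probability; it is bounded below by its value at the true
  rectangle, which Chebyshev's inequality controls.\<close>

section \<open>Characteristic functions and moments\<close>

text \<open>A sheet is given only by its finite-dimensional laws, and a test sees the product
  sigma-algebra over uncountably many coordinates. Path laws are therefore compared through
  characteristic functions of finite linear combinations. Gaussianity and independence of Wiener
  integrals are read off characteristic functions too, since these pass to L2 limits. Uniqueness in
  several coordinates is derived from Levy's theorem on the line.

  Constants for small rectangles: let \<open>r\<close> be the volume and
  \<open>\<Gamma> = sqrt (2 * ln (1 / r))\<close>. Of order \<open>1 / r\<close> essentially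
  disjoint translates fit into the cube, whereas an untruncated likelihood ratio has second moment
  \<open>exp (c^2)\<close>, that is \<open>r\<close> to the power
  \<open>- 2 * (1 - \<epsilon>)^2\<close>, which an average over \<open>1 / r\<close> terms cannot
  absorb for small \<epsilon>. Under the alternative \<open>\<xi>\<close> is centred at
  \<open>c = (1 - \<epsilon>) * \<Gamma>\<close>, so a cut at \<open>\<Gamma>\<close> leaves the gap
  \<open>x = \<epsilon> * \<Gamma>\<close>. The same \<open>x\<close> bounds the lost mass by
  \<open>1 / x^2\<close> and the variance of the average by \<open>2^d * exp (- x^2)\<close>; hence
  the hypothesis that it tends to infinity.\<close>

lemma iexp_add: "iexp (y + z) = iexp y * iexp z"
  by (simp add: exp_add distrib_left)

lemma one_minus_inverse_square_tendsto:
  assumes "filterlim s at_top F"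
  shows "((\<lambda>n. 1 - 1 / (s n)\<^sup>2) \<longlongrightarrow> (1 :: real)) F"
proof -
  have "((\<lambda>x::real. 1 - 1 / x\<^sup>2) \<longlongrightarrow> 1) at_top" by real_asymp
  from filterlim_compose[OF this assms] show ?thesis .
qed

section \<open>Uniqueness of finite measures with given characteristic functions\<close>

text \<open>The weights define finite measures whose images under \<open>X1\<close> and
  \<open>X2\<close> live on the line. Dividing by their common total mass turns these images into
  probability laws, to which Levy's theorem applies.\<close>

lemma weighted_char_unique:
  fixes X1 :: "'a \<Rightarrow> real" and X2 :: "'b \<Rightarrow> real" and G1 :: "'a \<Rightarrow> real" and G2 :: "'b \<Rightarrow> real"
  assumes X: "X1 \<in> borel_measurable M1" "X2 \<in> borel_measurable M2"
    and int: "integrable M1 G1" "integrable M2 G2"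
    and nonneg: "\<And>x. 0 \<le> G1 x" "\<And>x. 0 \<le> G2 x"
    and eq: "\<And>u. (LINT x|M1. iexp (u * X1 x) * G1 x) = (LINT x|M2. iexp (u * X2 x) * G2 x)"
    and A: "A \<in> sets borel"
  shows "(LINT x|M1. indicator A (X1 x) * G1 x) = (LINT x|M2. indicator A (X2 x) * G2 x)"
proof -
  define c where "c = (LINT x|M1. G1 x)"
  \<comment> \<open>The value at \<open>u = 0\<close> shows that both weights have the same total
    mass.\<close>
  have "complex_of_real c = complex_of_real (LINT x|M2. G2 x)"
    using eq[of 0] unfolding c_def by simp
  then have c2: "c = (LINT x|M2. G2 x)" by simp
  have c0: "0 \<le> c" unfolding c_def using nonneg by (intro Bochner_Integration.integral_nonneg) auto
  show ?thesis
  proof (cases "c = 0")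
    case True
    \<comment> \<open>Mass zero cannot be normalised, but then both weights vanish almost everywhere
      and both sides are 0.\<close>
    have "AE x in M1. G1 x = 0"
      using True int nonneg unfolding c_def by (subst (asm) integral_nonneg_eq_0_iff_AE) auto
    then have 1: "(LINT x|M1. indicator A (X1 x) * G1 x) = (LINT x|M1. 0)"
      using X A int by (intro integral_cong_AE) auto
    have "AE x in M2. G2 x = 0"
      using True int nonneg unfolding c2 by (subst (asm) integral_nonneg_eq_0_iff_AE) auto
    then have 2: "(LINT x|M2. indicator A (X2 x) * G2 x) = (LINT x|M2. 0)"
      using X A int by (intro integral_cong_AE) auto
    show ?thesis unfolding 1 2 by simp
  next
    case False
    with c0 have cpos: "0 < c" by simp
    have key: "real_distribution (distr (density M (\<lambda>x. ennreal (G x / c))) borel X) \<and>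
       (\<forall>u. char (distr (density M (\<lambda>x. ennreal (G x / c))) borel X) u = (LINT x|M. iexp (u * X x) * G x) / c) \<and>
       measure (distr (density M (\<lambda>x. ennreal (G x / c))) borel X) A = (LINT x|M. indicator A (X x) * G x) / c"
      if "X \<in> borel_measurable M" "integrable M G" "\<And>x. 0 \<le> G x" "c = (LINT x|M. G x)"
      for M :: "'z measure" and X :: "'z \<Rightarrow> real" and G :: "'z \<Rightarrow> real"
    proof (intro conjI allI)
      note [measurable] = that(1)
      have [measurable]: "G \<in> borel_measurable M" using that(2) by auto
      have "(\<integral>\<^sup>+x. ennreal (G x / c) \<partial>M) = ennreal (LINT x|M. G x / c)"
        using that cpos by (intro nn_integral_eq_integral) auto
      also have "\<dots> = 1" using that(4) cpos by simp
      finally have *: "(\<integral>\<^sup>+x. ennreal (G x / c) \<partial>M) = 1" .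
      have ps: "prob_space (density M (\<lambda>x. ennreal (G x / c)))"
        by (rule prob_spaceI) (simp add: emeasure_density * cong: nn_integral_cong)
      show rd: "real_distribution (distr (density M (\<lambda>x. ennreal (G x / c))) borel X)"
        by (rule prob_space.real_distribution_distr[OF ps]) simp
      show "char (distr (density M (\<lambda>x. ennreal (G x / c))) borel X) u = (LINT x|M. iexp (u * X x) * G x) / c" for u
      proof -
        have "char (distr (density M (\<lambda>x. ennreal (G x / c))) borel X) u
          = (LINT x|density M (\<lambda>x. ennreal (G x / c)). iexp (u * X x))"
          unfolding char_def by (subst integral_distr) auto
        also have "\<dots> = (LINT x|M. (G x / c) *\<^sub>R iexp (u * X x))"
          using that cpos by (subst integral_density) auto
        also have "\<dots> = (LINT x|M. (iexp (u * X x) * G x) / c)"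
          by (intro Bochner_Integration.integral_cong) (auto simp: scaleR_conv_of_real)
        finally show ?thesis by simp
      qed
      interpret real_distribution "distr (density M (\<lambda>x. ennreal (G x / c))) borel X" by (fact rd)
      have "measure (distr (density M (\<lambda>x. ennreal (G x / c))) borel X) A
        = (LINT x|distr (density M (\<lambda>x. ennreal (G x / c))) borel X. indicator A x)"
        using A by simp
      also have "\<dots> = (LINT x|density M (\<lambda>x. ennreal (G x / c)). indicator A (X x))"
        using A by (subst integral_distr) auto
      also have "\<dots> = (LINT x|M. (G x / c) *\<^sub>R indicator A (X x))"
        using that cpos A by (subst integral_density) auto
      also have "\<dots> = (LINT x|M. (indicator A (X x) * G x) / c)"
        by (intro Bochner_Integration.integral_cong) auto
      finally show "measure (distr (density M (\<lambda>x. ennreal (G x / c))) borel X) A = (LINT x|M. indicator A (X x) * G x) / c"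
        by simp
    qed
    note k1 = key[OF X(1) int(1) nonneg(1) c_def]
    note k2 = key[OF X(2) int(2) nonneg(2) c2]
    have "distr (density M1 (\<lambda>x. ennreal (G1 x / c))) borel X1 = distr (density M2 (\<lambda>x. ennreal (G2 x / c))) borel X2"
      using k1 k2 eq by (intro Levy_uniqueness) (auto simp: fun_eq_iff)
    with k1 k2 have "(LINT x|M1. indicator A (X1 x) * G1 x) / c = (LINT x|M2. indicator A (X2 x) * G2 x) / c"
      by metis
    with cpos show ?thesis by simp
  qed
qed

text \<open>The weights \<open>1 + cos (l x + \<theta>)\<close> are nonnegative and span the characters \<open>iexp (l x)\<close>, so
  the one-dimensional uniqueness theorem for positive measures allows one to replace a character
  by an indicator, one coordinate at a time.\<close>

lemma char_determines_rectangles: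
  fixes N1 N2 :: "'a measure" and L :: "('a \<Rightarrow> real) set"
  assumes fin: "finite_measure N1" "finite_measure N2"
    and meas: "\<And>l. l \<in> L \<Longrightarrow> l \<in> borel_measurable N1" "\<And>l. l \<in> L \<Longrightarrow> l \<in> borel_measurable N2"
    and zero: "(\<lambda>_. 0) \<in> L"
    and lin: "\<And>l l' a b. l \<in> L \<Longrightarrow> l' \<in> L \<Longrightarrow> (\<lambda>x. a * l x + b * l' x) \<in> L"
    and eq: "\<And>l. l \<in> L \<Longrightarrow> (LINT x|N1. iexp (l x)) = (LINT x|N2. iexp (l x))"
    and J: "finite J" "\<And>j. j \<in> J \<Longrightarrow> f j \<in> L" "\<And>j. j \<in> J \<Longrightarrow> A j \<in> sets borel"
  shows "(LINT x|N1. (\<Prod>j\<in>J. indicator (A j) (f j x) :: real)) = (LINT x|N2. (\<Prod>j\<in>J. indicator (A j) (f j x)))"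
proof -
  \<comment> \<open>The claim is strengthened by a remaining character \<open>iexp (l x)\<close>
    with arbitrary \<open>l\<close>: peeling off one coordinate shifts \<open>l\<close> by multiples
    of \<open>f j\<close>, and the induction hypothesis must cover these shifts.\<close>
  have "(LINT x|N1. complex_of_real (\<Prod>j\<in>J. indicator (A j) (f j x)) * iexp (l x))
      = (LINT x|N2. complex_of_real (\<Prod>j\<in>J. indicator (A j) (f j x)) * iexp (l x))" if "l \<in> L" for l
    using J that
  proof (induction J arbitrary: l rule: finite_induct)
    case empty
    then show ?case using eq by simp
  next
    case (insert j J)
    define F :: "'a \<Rightarrow> real" where "F x = (\<Prod>j\<in>J. indicator (A j) (f j x))" for x
    have F01: "0 \<le> F x" "F x \<le> 1" for x
      unfolding F_def by (auto intro!: prod_nonneg prod_le_1)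
    have fj: "f j \<in> L" and Aj: "A j \<in> sets borel" using insert.prems by auto
    have IH: "(LINT x|N1. complex_of_real (F x) * iexp (l x)) = (LINT x|N2. complex_of_real (F x) * iexp (l x))"
      if "l \<in> L" for l
      unfolding F_def using insert.prems that by (intro insert.IH) auto
    have Fm: "F \<in> borel_measurable N1" "F \<in> borel_measurable N2"
      unfolding F_def using insert.prems meas
      by (auto intro!: borel_measurable_prod borel_measurable_indicator' measurable_compose[OF _ borel_measurable_indicator])
    \<comment> \<open>Writing the cosine as a half sum of exponentials leaves three characters, with
      exponents \<open>u * f j\<close>, \<open>u * f j + l\<close> and \<open>u * f j - l\<close>.
      The coefficients 0, 1 and -1 are kept explicit so that each exponent is literally an instance
      of \<open>lin\<close>.\<close>
    have expand: "integrable N (\<lambda>x. F x * (1 + cos (l x + \<theta>)))"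
      "(LINT x|N. iexp (u * f j x) * complex_of_real (F x * (1 + cos (l x + \<theta>)))) =
        (LINT x|N. F x * iexp (u * f j x + 0 * f j x)) + iexp \<theta> / 2 * (LINT x|N. F x * iexp (u * f j x + 1 * l x))
         + iexp (- \<theta>) / 2 * (LINT x|N. F x * iexp (u * f j x + (-1) * l x))"
      if N: "finite_measure N" and lm: "l \<in> borel_measurable N" "f j \<in> borel_measurable N" "F \<in> borel_measurable N"
      for N l \<theta> u
    proof -
      interpret finite_measure N by (fact N)
      note [measurable] = lm
      show "integrable N (\<lambda>x. F x * (1 + cos (l x + \<theta>)))"
      proof (rule integrable_const_bound[where B=2])
        have "\<bar>1 + cos y\<bar> \<le> 2" for y :: real
          using cos_le_one[of y] cos_ge_minus_one[of y] by linarith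
        then have "\<bar>F x * (1 + cos (l x + \<theta>))\<bar> \<le> 1 * 2" for x
          unfolding abs_mult using F01[of x] by (intro mult_mono) auto
        then show "AE x in N. norm (F x * (1 + cos (l x + \<theta>))) \<le> 2" by simp
      qed simp
      have i: "integrable N (\<lambda>x. F x * iexp (g x))" if [measurable]: "g \<in> borel_measurable N" for g
        by (rule integrable_const_bound[where B=1]) (use F01 in \<open>auto simp: norm_mult\<close>)
      have gen: "(LINT x|N. a x + p * b x + q * c x) = (LINT x|N. a x) + p * (LINT x|N. b x) + q * (LINT x|N. c x)"
        if "integrable N a" "integrable N b" "integrable N c" for a b c :: "'a \<Rightarrow> complex" and p q
        using that by simp
      have eqn: "iexp (u * f j x) * complex_of_real (F x * (1 + cos (l x + \<theta>))) =
         F x * iexp (u * f j x + 0 * f j x) + iexp \<theta> / 2 * (F x * iexp (u * f j x + 1 * l x))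
         + iexp (- \<theta>) / 2 * (F x * iexp (u * f j x + (-1) * l x))" for x
      proof -
        have "complex_of_real (cos (l x + \<theta>)) = (iexp (l x + \<theta>) + iexp (- l x + - \<theta>)) / 2"
          by (simp add: cos_exp_eq algebra_simps flip: cos_of_real)
        also have "\<dots> = (iexp (l x) * iexp \<theta> + iexp (- l x) * iexp (- \<theta>)) / 2"
          unfolding iexp_add ..
        finally have c: "complex_of_real (cos (l x + \<theta>)) = (iexp (l x) * iexp \<theta> + iexp (- l x) * iexp (- \<theta>)) / 2" .
        have m: "iexp (u * f j x + (-1) * l x) = iexp (u * f j x) * iexp (- l x)"
          using iexp_add[of "u * f j x" "- l x"] by simp
        have p: "iexp (u * f j x + 1 * l x) = iexp (u * f j x) * iexp (l x)"
          using iexp_add[of "u * f j x" "l x"] by simp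
        show ?thesis unfolding m p of_real_mult[of "F x"] of_real_add[of 1] c by (simp add: algebra_simps add_divide_distrib)
      qed
      show "(LINT x|N. iexp (u * f j x) * complex_of_real (F x * (1 + cos (l x + \<theta>)))) =
        (LINT x|N. F x * iexp (u * f j x + 0 * f j x)) + iexp \<theta> / 2 * (LINT x|N. F x * iexp (u * f j x + 1 * l x))
         + iexp (- \<theta>) / 2 * (LINT x|N. F x * iexp (u * f j x + (-1) * l x))"
        unfolding eqn by (rule gen) (intro i; measurable)+
    qed
    have cosine: "(LINT x|N1. indicator (A j) (f j x) * (F x * (1 + cos (l x + \<theta>))))
       = (LINT x|N2. indicator (A j) (f j x) * (F x * (1 + cos (l x + \<theta>))))" if l: "l \<in> L" for l \<theta>
    proof (rule weighted_char_unique)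
      fix u
      show "(LINT x|N1. iexp (u * f j x) * complex_of_real (F x * (1 + cos (l x + \<theta>)))) =
         (LINT x|N2. iexp (u * f j x) * complex_of_real (F x * (1 + cos (l x + \<theta>))))"
        unfolding expand(2)[OF fin(1) meas(1)[OF l] meas(1)[OF fj] Fm(1)]
          expand(2)[OF fin(2) meas(2)[OF l] meas(2)[OF fj] Fm(2)]
        using IH[OF lin[OF fj fj, of u 0]] IH[OF lin[OF fj l, of u 1]] IH[OF lin[OF fj l, of u "-1"]] by simp
    qed (use expand(1)[OF fin(1) meas(1)[OF l] meas(1)[OF fj] Fm(1)]
          expand(1)[OF fin(2) meas(2)[OF l] meas(2)[OF fj] Fm(2)] F01 meas fj Aj in \<open>auto intro!: mult_nonneg_nonneg\<close>,
         use cos_ge_minus_one in \<open>smt (verit)\<close>, use cos_ge_minus_one in \<open>smt (verit)\<close>)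
    define E :: "'a \<Rightarrow> real" where "E x = indicator (A j) (f j x) * F x" for x
    have E01: "0 \<le> E x" "E x \<le> 1" for x
      unfolding E_def using F01[of x] by (auto simp: indicator_def)
    have Em: "E \<in> borel_measurable N1" "E \<in> borel_measurable N2"
      unfolding E_def using Fm meas fj Aj
      by (auto intro!: borel_measurable_times measurable_compose[OF _ borel_measurable_indicator])
    \<comment> \<open>The way back from cosine weights to the character: the phases 0 and
      \<open>- pi / 2\<close> give its real and imaginary parts. The surplus mass of
      \<open>E\<close> is half of the integral for \<open>l = 0\<close>, where the weight equals
      2.\<close>
    have split: "(LINT x|N. complex_of_real (E x) * iexp (l x)) =
        complex_of_real ((LINT x|N. E x * (1 + cos (l x + 0))) - (LINT x|N. E x * (1 + cos (0 + 0))) / 2)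
       + \<i> * complex_of_real ((LINT x|N. E x * (1 + cos (l x + (- pi / 2)))) - (LINT x|N. E x * (1 + cos (0 + 0))) / 2)"
      if N: "finite_measure N" and lm: "l \<in> borel_measurable N" "E \<in> borel_measurable N" for N
    proof -
      interpret finite_measure N by (fact N)
      note [measurable] = lm
      have i: "integrable N (\<lambda>x. E x * g x)" if [measurable]: "g \<in> borel_measurable N" and "\<And>x. \<bar>g x\<bar> \<le> 1" for g
        by (rule integrable_const_bound[where B=1])
           (use E01 that in \<open>auto simp: abs_mult intro!: mult_le_one\<close>)
      have i1: "integrable N E" using i[of "\<lambda>_. 1"] by simp
      have ic: "integrable N (\<lambda>x. E x * cos (l x))" and isn: "integrable N (\<lambda>x. E x * sin (l x))"
        by (intro i; simp)+
      have cs: "cos (y + (- pi / 2)) = sin y" for y :: real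
        by (simp add: cos_diff flip: diff_conv_add_uminus)
      have "(LINT x|N. complex_of_real (E x) * iexp (l x)) =
          (LINT x|N. complex_of_real (E x * cos (l x)) + \<i> * complex_of_real (E x * sin (l x)))"
        by (intro Bochner_Integration.integral_cong) (auto simp: exp_Euler algebra_simps cos_of_real sin_of_real)
      also have "\<dots> = complex_of_real (LINT x|N. E x * cos (l x)) + \<i> * complex_of_real (LINT x|N. E x * sin (l x))"
        using integrable_of_real[OF ic, where ?'a=complex] integrable_of_real[OF isn, where ?'a=complex]
        by (simp del: of_real_mult)
      finally show ?thesis
        unfolding cs using i1 ic isn by (simp add: distrib_left)
    qed
    have e: "(LINT x|N1. E x * (1 + cos (l x + \<theta>))) = (LINT x|N2. E x * (1 + cos (l x + \<theta>)))" if "l \<in> L" for l \<theta>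
      using cosine[OF that] by (simp add: E_def mult.assoc)
    have "(LINT x|N1. complex_of_real (E x) * iexp (l x)) = (LINT x|N2. complex_of_real (E x) * iexp (l x))"
      unfolding split[OF fin(1) meas(1)[OF insert.prems(3)] Em(1)] split[OF fin(2) meas(2)[OF insert.prems(3)] Em(2)]
        e[OF insert.prems(3)] e[OF zero] ..
    then show ?case
      using insert.hyps by (simp add: E_def F_def)
  qed
  from this[OF zero] show ?thesis
    by (simp del: of_real_prod)
qed

text \<open>A Cramer-Wold principle for an arbitrary, possibly uncountable, index set: cylinders
  over finitely many coordinates determine a finite measure on the product, and their indicators are
  products of coordinate indicators, so \<open>char_determines_rectangles\<close> applies with the
  finite linear functionals as \<open>L\<close>.\<close>

lemma PiM_eqI_char:
  fixes N1 N2 :: "('i \<Rightarrow> real) measure"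
  assumes sets: "sets N1 = sets (Pi\<^sub>M I (\<lambda>_. borel))" "sets N2 = sets (Pi\<^sub>M I (\<lambda>_. borel))"
    and fin: "finite_measure N1" "finite_measure N2"
    and eq: "\<And>K b. finite K \<Longrightarrow> K \<subseteq> I \<Longrightarrow>
      (LINT x|N1. iexp (\<Sum>k\<in>K. b k * x k)) = (LINT x|N2. iexp (\<Sum>k\<in>K. b k * x k))"
  shows "N1 = N2"
proof (rule measure_eqI_PiM_infinite[OF sets _ fin(1)])
  fix A J assume J: "finite J" "J \<subseteq> I" "\<And>i. i \<in> J \<Longrightarrow> A i \<in> sets (borel :: real measure)"
  interpret N1: finite_measure N1 by (fact fin)
  interpret N2: finite_measure N2 by (fact fin)
  have sp: "space N1 = Pi\<^sub>E I (\<lambda>_. UNIV)" "space N2 = Pi\<^sub>E I (\<lambda>_. UNIV)"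
    using sets[THEN sets_eq_imp_space_eq] by (auto simp: space_PiM)
  define L where "L = {l. \<exists>K b. finite K \<and> K \<subseteq> I \<and> l = (\<lambda>x::'i \<Rightarrow> real. \<Sum>k\<in>K. b k * x k)}"
  let ?P = "prod_emb I (\<lambda>_. borel :: real measure) J (Pi\<^sub>E J A)"
  have ind: "(\<Prod>j\<in>J. indicator (A j) (x j)) = (indicator ?P x :: real)" if "x \<in> Pi\<^sub>E I (\<lambda>_. UNIV)" for x
  proof (cases "\<forall>j\<in>J. x j \<in> A j")
    case True
    with that J show ?thesis by (auto simp: prod_emb_def indicator_def)
  next
    case False
    then have "(\<Prod>j\<in>J. indicator (A j) (x j)) = (0 :: real)"
      using J(1) by (intro prod_zero) (auto simp: indicator_def)
    moreover have "x \<notin> ?P" using False by (auto simp: prod_emb_def PiE_iff)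
    ultimately show ?thesis by simp
  qed
  have "(LINT x|N1. (\<Prod>j\<in>J. indicator (A j) (x j) :: real)) = (LINT x|N2. (\<Prod>j\<in>J. indicator (A j) (x j)))"
  proof (rule char_determines_rectangles[OF fin, where L = L])
    have m: "l \<in> borel_measurable (Pi\<^sub>M I (\<lambda>_. borel :: real measure))" if "l \<in> L" for l
      using that unfolding L_def by (auto intro!: borel_measurable_sum borel_measurable_times)
    show "l \<in> L \<Longrightarrow> l \<in> borel_measurable N1" "l \<in> L \<Longrightarrow> l \<in> borel_measurable N2" for l
      using m by (simp_all add: measurable_cong_sets[OF sets(1) refl] measurable_cong_sets[OF sets(2) refl])
    show "(\<lambda>_. 0) \<in> L" unfolding L_def by (auto intro!: exI[of _ "{}"])
    show "(\<lambda>x. a * l x + b * l' x) \<in> L" if l: "l \<in> L" and l': "l' \<in> L" for l l' a b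
    proof -
      obtain K c where K: "finite K" "K \<subseteq> I" "l = (\<lambda>x. \<Sum>k\<in>K. c k * x k)" using l unfolding L_def by auto
      obtain K' c' where K': "finite K'" "K' \<subseteq> I" "l' = (\<lambda>x. \<Sum>k\<in>K'. c' k * x k)" using l' unfolding L_def by auto
      \<comment> \<open>Both functionals are rewritten over the union of their supports, with
        coefficients extended by 0.\<close>
      have "(\<Sum>k\<in>K. c k * x k) = (\<Sum>k\<in>K \<union> K'. (if k \<in> K then c k else 0) * x k)" for x :: "'i \<Rightarrow> real"
        using K K' by (intro sum.mono_neutral_cong_left) auto
      moreover have "(\<Sum>k\<in>K'. c' k * x k) = (\<Sum>k\<in>K \<union> K'. (if k \<in> K' then c' k else 0) * x k)" for x :: "'i \<Rightarrow> real"
        using K K' by (intro sum.mono_neutral_cong_left) auto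
      ultimately have "(\<lambda>x. a * l x + b * l' x) =
          (\<lambda>x. \<Sum>k\<in>K \<union> K'. (a * (if k \<in> K then c k else 0) + b * (if k \<in> K' then c' k else 0)) * x k)"
        unfolding K(3) K'(3) by (simp add: sum_distrib_left sum.distrib[symmetric] algebra_simps)
      then show ?thesis using K K' unfolding L_def
        by (auto intro!: exI[of _ "K \<union> K'"] exI[of _ "\<lambda>k. (a * (if k \<in> K then c k else 0) + b * (if k \<in> K' then c' k else 0))"])
    qed
    show "(LINT x|N1. iexp (l x)) = (LINT x|N2. iexp (l x))" if "l \<in> L" for l
      using that eq unfolding L_def by blast
    show "(\<lambda>x. x j) \<in> L" if "j \<in> J" for j
      using that J unfolding L_def by (auto intro!: exI[of _ "{j}"] exI[of _ "\<lambda>_. 1"])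
  qed (use J in auto)
  moreover have "(LINT x|N. (\<Prod>j\<in>J. indicator (A j) (x j) :: real)) = measure N ?P"
    if "space N = Pi\<^sub>E I (\<lambda>_. UNIV)" "?P \<in> sets N" "finite_measure N" for N
  proof -
    interpret finite_measure N by (fact that)
    have "(LINT x|N. (\<Prod>j\<in>J. indicator (A j) (x j) :: real)) = (LINT x|N. indicator ?P x)"
      using ind that by (intro Bochner_Integration.integral_cong) auto
    then show ?thesis using sets.sets_into_space[OF that(2)] by (simp add: Int_absorb2)
  qed
  moreover have "?P \<in> sets (Pi\<^sub>M I (\<lambda>_. borel))"
    using J by (intro sets_PiM_I) auto
  ultimately show "emeasure N1 ?P = emeasure N2 ?P"
    using fin sets sp by (simp add: N1.emeasure_eq_measure N2.emeasure_eq_measure)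
qed

section \<open>Square-integrable limits and Gaussian moments\<close>

text \<open>Stated for a general measure because it is applied twice, to integrands on the cube and
  to random variables. Convergence of the norms rests on the weighted Young inequality
  \<open>2 * |a * b| <= r * a^2 + b^2 / r\<close>, with a weight \<open>r\<close> that itself tends
  to 0.\<close>

lemma L2_limit:
  fixes f :: "'a \<Rightarrow> real" and s :: "nat \<Rightarrow> 'a \<Rightarrow> real"
  assumes meas: "f \<in> borel_measurable N" "\<And>k. s k \<in> borel_measurable N"
    and sq: "\<And>k. integrable N (\<lambda>x. (s k x)\<^sup>2)"
    and lim: "(\<lambda>k. \<integral>\<^sup>+x. ennreal ((f x - s k x)\<^sup>2) \<partial>N) \<longlonglongrightarrow> 0"
  shows "integrable N (\<lambda>x. (f x)\<^sup>2)"
    and "integrable N (\<lambda>x. (f x - s k x)\<^sup>2)"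
    and "(\<lambda>k. LINT x|N. (f x - s k x)\<^sup>2) \<longlonglongrightarrow> 0"
    and "(\<lambda>k. LINT x|N. (s k x)\<^sup>2) \<longlonglongrightarrow> (LINT x|N. (f x)\<^sup>2)"
proof -
  note [measurable] = meas
  \<comment> \<open>A single index at finite distance already forces \<open>f\<close> to be square
    integrable.\<close>
  have "eventually (\<lambda>k. (\<integral>\<^sup>+x. ennreal ((f x - s k x)\<^sup>2) \<partial>N) < 1) sequentially"
    using lim by (rule order_tendstoD) simp
  then obtain k0 where "(\<integral>\<^sup>+x. ennreal ((f x - s k0 x)\<^sup>2) \<partial>N) < 1"
    by (auto simp: eventually_sequentially)
  then have "(\<integral>\<^sup>+x. ennreal ((f x - s k0 x)\<^sup>2) \<partial>N) < \<infinity>"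
    by (metis ennreal_one_less_top infinity_ennreal_def order_less_trans)
  then have d0: "integrable N (\<lambda>x. (f x - s k0 x)\<^sup>2)"
    by (intro integrableI_bounded) auto
  have sq_sum: "(a + b)\<^sup>2 \<le> 2 * a\<^sup>2 + 2 * b\<^sup>2" for a b :: real
    using sum_squares_bound[of a b] by (simp add: power2_eq_square algebra_simps)
  show f2: "integrable N (\<lambda>x. (f x)\<^sup>2)"
    by (rule Bochner_Integration.integrable_bound[where f="\<lambda>x. 2 * (f x - s k0 x)\<^sup>2 + 2 * (s k0 x)\<^sup>2"])
       (use d0 sq sq_sum[of "f x - s k0 x" "s k0 x" for x] in auto)
  have dk: "integrable N (\<lambda>x. (f x - s k x)\<^sup>2)" for k
    by (rule Bochner_Integration.integrable_bound[where f="\<lambda>x. 2 * (f x)\<^sup>2 + 2 * (s k x)\<^sup>2"])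
       (use f2 sq sq_sum[of "f x" "- s k x" for x] in auto)
  show "integrable N (\<lambda>x. (f x - s k x)\<^sup>2)" by (fact dk)
  define d where "d k = (LINT x|N. (f x - s k x)\<^sup>2)" for k
  have d0: "0 \<le> d k" for k unfolding d_def by simp
  have "(\<lambda>k. ennreal (d k)) \<longlonglongrightarrow> 0"
    using lim by (simp add: d_def nn_integral_eq_integral[OF dk])
  then have dlim: "d \<longlonglongrightarrow> 0"
    using d0 by (simp add: ennreal_tendsto_0_iff)
  then show "(\<lambda>k. LINT x|N. (f x - s k x)\<^sup>2) \<longlonglongrightarrow> 0" unfolding d_def .
  \<comment> \<open>The weight must satisfy \<open>d k <= (r k)^2\<close>, so that
    \<open>d k / r k\<close> still tends to 0. The extra \<open>1 / (k + 1)\<close> keeps it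
    positive even where \<open>d k = 0\<close>.\<close>
  define r where "r k = sqrt (d k) + 1 / real (Suc k)" for k
  have rpos: "0 < r k" for k unfolding r_def using d0 by (simp add: add_nonneg_pos)
  have rd: "d k / r k \<le> r k" for k
  proof -
    have "d k = (sqrt (d k))\<^sup>2" using d0 by simp
    also have "\<dots> \<le> (r k)\<^sup>2" unfolding r_def using d0 by (intro power_mono) auto
    finally show ?thesis using rpos[of k] by (simp add: field_simps power2_eq_square)
  qed
  have rlim: "r \<longlonglongrightarrow> 0"
  proof -
    have "(\<lambda>k. sqrt (d k) + 1 / real (Suc k)) \<longlonglongrightarrow> sqrt 0 + 0"
      by (intro tendsto_intros dlim LIMSEQ_Suc[OF lim_1_over_n])
    then show ?thesis by (simp add: r_def[abs_def])
  qed
  have bound: "\<bar>(LINT x|N. (s k x)\<^sup>2) - (LINT x|N. (f x)\<^sup>2)\<bar> \<le> d k + r k * (LINT x|N. (f x)\<^sup>2) + r k" for k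
  proof -
    have pt: "\<bar>(s k x)\<^sup>2 - (f x)\<^sup>2\<bar> \<le> (f x - s k x)\<^sup>2 + r k * (f x)\<^sup>2 + (f x - s k x)\<^sup>2 / r k" for x
    proof -
      have "2 * \<bar>f x * (f x - s k x)\<bar> \<le> r k * (f x)\<^sup>2 + (f x - s k x)\<^sup>2 / r k"
      proof -
        have "0 \<le> (r k * \<bar>f x\<bar> - \<bar>f x - s k x\<bar>)\<^sup>2 / r k" using rpos[of k] by simp
        then show ?thesis using rpos[of k]
          by (simp add: power2_diff add_divide_distrib diff_divide_distrib power_mult_distrib abs_mult power2_eq_square[of "r k"])
      qed
      moreover have "(s k x)\<^sup>2 - (f x)\<^sup>2 = (f x - s k x)\<^sup>2 - 2 * (f x * (f x - s k x))"
        by (simp add: power2_eq_square algebra_simps)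
      ultimately show ?thesis by (smt (verit) zero_le_power2)
    qed
    have "\<bar>(LINT x|N. (s k x)\<^sup>2) - (LINT x|N. (f x)\<^sup>2)\<bar> = \<bar>LINT x|N. (s k x)\<^sup>2 - (f x)\<^sup>2\<bar>"
      using sq f2 by simp
    also have "\<dots> \<le> (LINT x|N. \<bar>(s k x)\<^sup>2 - (f x)\<^sup>2\<bar>)" by (rule integral_abs_bound)
    also have "\<dots> \<le> (LINT x|N. (f x - s k x)\<^sup>2 + r k * (f x)\<^sup>2 + (f x - s k x)\<^sup>2 / r k)"
      using sq f2 dk pt by (intro integral_mono) auto
    also have "\<dots> = d k + r k * (LINT x|N. (f x)\<^sup>2) + d k / r k"
      using sq f2 dk by (simp add: d_def)
    finally show ?thesis using rd[of k] by linarith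
  qed
  have "(\<lambda>k. (LINT x|N. (s k x)\<^sup>2) - (LINT x|N. (f x)\<^sup>2)) \<longlonglongrightarrow> 0"
  proof (rule Lim_null_comparison)
    show "eventually (\<lambda>k. norm ((LINT x|N. (s k x)\<^sup>2) - (LINT x|N. (f x)\<^sup>2)) \<le> d k + r k * (LINT x|N. (f x)\<^sup>2) + r k) sequentially"
      using bound by simp
    have "(\<lambda>k. d k + r k * (LINT x|N. (f x)\<^sup>2) + r k) \<longlonglongrightarrow> 0 + 0 * (LINT x|N. (f x)\<^sup>2) + 0"
      by (intro tendsto_intros dlim rlim)
    then show "(\<lambda>k. d k + r k * (LINT x|N. (f x)\<^sup>2) + r k) \<longlonglongrightarrow> 0" by simp
  qed
  then show "(\<lambda>k. LINT x|N. (s k x)\<^sup>2) \<longlonglongrightarrow> (LINT x|N. (f x)\<^sup>2)"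
    by (simp add: Lim_null[of _ "LINT x|N. (f x)\<^sup>2"])
qed

lemma integrable_mult_of_square_integrable:
  fixes f g :: "'a \<Rightarrow> real"
  assumes "f \<in> borel_measurable N" "g \<in> borel_measurable N"
    and "integrable N (\<lambda>x. (f x)\<^sup>2)" "integrable N (\<lambda>x. (g x)\<^sup>2)"
  shows "integrable N (\<lambda>x. f x * g x)"
proof (rule Bochner_Integration.integrable_bound)
  show "integrable N (\<lambda>x. (f x)\<^sup>2 + (g x)\<^sup>2)" using assms by simp
  have "\<bar>a * b\<bar> \<le> a\<^sup>2 + b\<^sup>2" for a b :: real
    using sum_squares_bound[of "\<bar>a\<bar>" "\<bar>b\<bar>"] abs_ge_zero[of "a * b"] unfolding abs_mult power2_abs by linarith
  then show "AE x in N. norm (f x * g x) \<le> norm ((f x)\<^sup>2 + (g x)\<^sup>2)" by simp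
qed (use assms in auto)

text \<open>The bound is the nonnegativity of the variance of \<open>|Y|\<close>.\<close>

lemma (in prob_space) expectation_abs_le_sqrt:
  fixes Y :: "'a \<Rightarrow> real"
  assumes "Y \<in> borel_measurable M" and sq: "integrable M (\<lambda>\<omega>. (Y \<omega>)\<^sup>2)"
  shows "integrable M (\<lambda>\<omega>. \<bar>Y \<omega>\<bar>)" "(LINT \<omega>|M. \<bar>Y \<omega>\<bar>) \<le> sqrt (LINT \<omega>|M. (Y \<omega>)\<^sup>2)"
proof -
  have "integrable M Y" by (rule square_integrable_imp_integrable[OF assms])
  then show i1: "integrable M (\<lambda>\<omega>. \<bar>Y \<omega>\<bar>)" by simp
  show "(LINT \<omega>|M. \<bar>Y \<omega>\<bar>) \<le> sqrt (LINT \<omega>|M. (Y \<omega>)\<^sup>2)"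
  proof (rule real_le_rsqrt)
    show "(LINT \<omega>|M. \<bar>Y \<omega>\<bar>)\<^sup>2 \<le> (LINT \<omega>|M. (Y \<omega>)\<^sup>2)"
      using variance_positive[of "\<lambda>x. \<bar>Y x\<bar>"] variance_eq[OF i1] sq by simp
  qed
qed

text \<open>The map \<open>iexp\<close> is 1-Lipschitz, so the two integrals differ by at most the
  L1 distance, hence by at most the L2 distance.\<close>

lemma (in prob_space) integral_iexp_L2_tendsto:
  fixes f :: "'a \<Rightarrow> real" and s :: "nat \<Rightarrow> 'a \<Rightarrow> real"
  assumes meas: "f \<in> borel_measurable M" "\<And>k. s k \<in> borel_measurable M"
    and int: "\<And>k. integrable M (\<lambda>x. (f x - s k x)\<^sup>2)"
    and lim: "(\<lambda>k. LINT x|M. (f x - s k x)\<^sup>2) \<longlonglongrightarrow> 0"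
  shows "(\<lambda>k. LINT x|M. iexp (s k x)) \<longlonglongrightarrow> (LINT x|M. iexp (f x))"
proof -
  note [measurable] = meas
  define d where "d k = (LINT x|M. (f x - s k x)\<^sup>2)" for k
  have bound: "norm ((LINT x|M. iexp (s k x)) - (LINT x|M. iexp (f x))) \<le> sqrt (d k)" for k
  proof -
    have "(\<lambda>x. f x - s k x) \<in> borel_measurable M" by simp
    note i1 = expectation_abs_le_sqrt(1)[OF this int] and le = expectation_abs_le_sqrt(2)[OF this int]
    have lip: "norm (iexp a - iexp b) \<le> \<bar>a - b\<bar>" for a b
    proof -
      have "iexp a - iexp b = iexp b * (iexp (a - b) - 1)"
        by (simp add: algebra_simps mult_exp_exp)
      then have "norm (iexp a - iexp b) = norm (iexp (a - b) - 1)" by (simp add: norm_mult)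
      also have "\<dots> \<le> \<bar>a - b\<bar>" using iexp_approx1[of "a - b" 0] by simp
      finally show ?thesis .
    qed
    have "norm ((LINT x|M. iexp (s k x)) - (LINT x|M. iexp (f x))) = norm (LINT x|M. iexp (s k x) - iexp (f x))"
      by (subst Bochner_Integration.integral_diff) (auto intro!: integrable_iexp)
    also have "\<dots> \<le> (LINT x|M. norm (iexp (s k x) - iexp (f x)))" by (rule integral_norm_bound)
    also have "\<dots> \<le> (LINT x|M. \<bar>f x - s k x\<bar>)"
      using lip[of "s k x" "f x" for x] i1
      by (intro integral_mono) (auto simp: abs_minus_commute intro!: integrable_norm Bochner_Integration.integrable_diff integrable_iexp)
    also have "\<dots> \<le> sqrt (d k)" unfolding d_def by (rule le)
    finally show ?thesis .
  qed
  have "(\<lambda>k. (LINT x|M. iexp (s k x)) - (LINT x|M. iexp (f x))) \<longlonglongrightarrow> 0"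
  proof (rule Lim_null_comparison)
    show "(\<lambda>k. sqrt (d k)) \<longlonglongrightarrow> 0"
      using tendsto_real_sqrt[OF lim] by (simp add: d_def)
  qed (use bound in auto)
  then show ?thesis by (simp add: Lim_null[of _ "LINT x|M. iexp (f x)"])
qed

text \<open>Degenerate laws obey the same formula: mean 0 forces the constant to be 0, and both
  sides equal 1. In the nondegenerate case the variable is standardised first.\<close>

lemma (in prob_space) gaussian_rv_moments:
  assumes "gaussian_rv M Z"
  shows "Z \<in> borel_measurable M" "integrable M Z" "integrable M (\<lambda>\<omega>. (Z \<omega>)\<^sup>2)"
    and "(LINT \<omega>|M. Z \<omega>) = 0 \<Longrightarrow> (LINT \<omega>|M. iexp (Z \<omega>)) = exp (- (LINT \<omega>|M. (Z \<omega>)\<^sup>2) / 2)"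
proof -
  from assms consider m \<sigma> where "0 < \<sigma>" "distributed M lborel Z (normal_density m \<sigma>)"
    | m where "Z \<in> borel_measurable M" "AE \<omega> in M. Z \<omega> = m"
    unfolding gaussian_rv_def by blast
  then have "Z \<in> borel_measurable M \<and> integrable M (\<lambda>\<omega>. (Z \<omega>)\<^sup>2) \<and>
    ((LINT \<omega>|M. Z \<omega>) = 0 \<longrightarrow> (LINT \<omega>|M. iexp (Z \<omega>)) = exp (- (LINT \<omega>|M. (Z \<omega>)\<^sup>2) / 2))"
  proof cases
    case 1
    note D = 1(2)
    have Zm [measurable]: "Z \<in> borel_measurable M" using distributed_measurable[OF D] by simp
    have "distributed M lborel (\<lambda>\<omega>. - m / \<sigma> + (1 / \<sigma>) * Z \<omega>) (normal_density (- m / \<sigma> + (1 / \<sigma>) * m) (\<bar>1 / \<sigma>\<bar> * \<sigma>))"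
      using 1 by (intro normal_density_affine) auto
    then have "distributed M lborel (\<lambda>\<omega>. - m / \<sigma> + (1 / \<sigma>) * Z \<omega>) std_normal_density"
      using 1 by simp
    then have S: "distr M lborel (\<lambda>\<omega>. - m / \<sigma> + (1 / \<sigma>) * Z \<omega>) = std_normal_distribution"
      by (rule distributed_distr_eq_density)
    define Y where "Y \<omega> = - m / \<sigma> + (1 / \<sigma>) * Z \<omega>" for \<omega>
    have [measurable]: "Y \<in> borel_measurable M" unfolding Y_def by measurable
    have ZY: "Z \<omega> = m + \<sigma> * Y \<omega>" for \<omega> unfolding Y_def using 1 by (simp add: field_simps)
    have S: "distr M lborel Y = std_normal_distribution" using S by (simp add: Y_def[abs_def])
    have "integrable (distr M lborel Y) (\<lambda>x. x ^ k)" for k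
      unfolding S by (rule integrable_std_normal_distribution_moment)
    then have Yk: "integrable M (\<lambda>\<omega>. Y \<omega> ^ k)" for k
      by (subst (asm) integrable_distr_eq) auto
    have Z2: "integrable M (\<lambda>\<omega>. (Z \<omega>)\<^sup>2)"
      unfolding ZY using Yk[of 1] Yk[of 2] by (simp add: power2_sum power_mult_distrib)
    have "(LINT \<omega>|M. iexp (Z \<omega>)) = exp (- (LINT \<omega>|M. (Z \<omega>)\<^sup>2) / 2)" if "(LINT \<omega>|M. Z \<omega>) = 0"
    proof -
      have m: "m = 0" using that normal_distributed_expectation[OF 1(1) D] by simp
      have v: "(LINT \<omega>|M. (Z \<omega>)\<^sup>2) = \<sigma>\<^sup>2" using normal_distributed_variance[OF 1(1) D] that by simp
      have "(LINT \<omega>|M. iexp (Z \<omega>)) = (LINT x|distr M lborel Y. iexp (\<sigma> * x))"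
        using ZY m by (subst integral_distr) auto
      also have "\<dots> = char std_normal_distribution \<sigma>" unfolding S char_def ..
      finally show ?thesis by (simp add: char_std_normal_distribution v exp_of_real)
    qed
    with Zm Z2 show ?thesis by blast
  next
    case 2
    note [measurable] = 2(1)
    have "(LINT \<omega>|M. Z \<omega>) = (LINT \<omega>|M. m)" using 2 by (intro integral_cong_AE) auto
    then have e: "(LINT \<omega>|M. Z \<omega>) = m" by (simp add: prob_space)
    have "(LINT \<omega>|M. iexp (Z \<omega>)) = (LINT \<omega>|M. iexp m)" using 2 by (intro integral_cong_AE) auto
    then have c: "(LINT \<omega>|M. iexp (Z \<omega>)) = iexp m" by (simp add: prob_space)
    have "(LINT \<omega>|M. (Z \<omega>)\<^sup>2) = (LINT \<omega>|M. m\<^sup>2)" using 2 by (intro integral_cong_AE) auto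
    then have v: "(LINT \<omega>|M. (Z \<omega>)\<^sup>2) = m\<^sup>2" by (simp add: prob_space)
    have "integrable M (\<lambda>\<omega>. (Z \<omega>)\<^sup>2)"
      by (rule integrable_cong_AE_imp[where g="\<lambda>_. m\<^sup>2"]) (use 2 in auto)
    then show ?thesis using 2 e c v by auto
  qed
  then show "Z \<in> borel_measurable M" "integrable M (\<lambda>\<omega>. (Z \<omega>)\<^sup>2)"
    "(LINT \<omega>|M. Z \<omega>) = 0 \<Longrightarrow> (LINT \<omega>|M. iexp (Z \<omega>)) = exp (- (LINT \<omega>|M. (Z \<omega>)\<^sup>2) / 2)"
    by auto
  with square_integrable_imp_integrable[of Z] show "integrable M Z" by blast
qed

text \<open>After expanding the square, the off-diagonal covariances cancel and only
  \<open>card I\<close> diagonal terms survive; the subtracted \<open>a\<^sup>2\<close> in each of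
  them is dropped.\<close>

lemma (in prob_space) uncorrelated_sum_second_moment:
  fixes T :: "'i \<Rightarrow> 'a \<Rightarrow> real"
  assumes I: "finite I"
    and int: "\<And>i. i \<in> I \<Longrightarrow> integrable M (T i)" "\<And>i j. i \<in> I \<Longrightarrow> j \<in> I \<Longrightarrow> integrable M (\<lambda>\<omega>. T i \<omega> * T j \<omega>)"
    and mean: "\<And>i. i \<in> I \<Longrightarrow> (LINT \<omega>|M. T i \<omega>) = a"
    and cross: "\<And>i j. i \<in> I \<Longrightarrow> j \<in> I \<Longrightarrow> i \<noteq> j \<Longrightarrow> (LINT \<omega>|M. T i \<omega> * T j \<omega>) = a\<^sup>2"
    and sq: "\<And>i. i \<in> I \<Longrightarrow> (LINT \<omega>|M. T i \<omega> * T i \<omega>) \<le> q"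
  shows "integrable M (\<lambda>\<omega>. (\<Sum>i\<in>I. T i \<omega> - a)\<^sup>2)"
    and "(LINT \<omega>|M. (\<Sum>i\<in>I. T i \<omega> - a)\<^sup>2) \<le> real (card I) * q"
proof -
  have expand: "(\<Sum>i\<in>I. T i \<omega> - a)\<^sup>2 = (\<Sum>i\<in>I. \<Sum>j\<in>I. T i \<omega> * T j \<omega> - a * T i \<omega> - a * T j \<omega> + a\<^sup>2)" for \<omega>
    by (simp add: power2_eq_square sum_product algebra_simps)
  have i: "integrable M (\<lambda>\<omega>. T i \<omega> * T j \<omega> - a * T i \<omega> - a * T j \<omega> + a\<^sup>2)" if "i \<in> I" "j \<in> I" for i j
    using int that by simp
  show "integrable M (\<lambda>\<omega>. (\<Sum>i\<in>I. T i \<omega> - a)\<^sup>2)"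
    unfolding expand by (intro Bochner_Integration.integrable_sum i)
  have e: "(LINT \<omega>|M. T i \<omega> * T j \<omega> - a * T i \<omega> - a * T j \<omega> + a\<^sup>2) = (LINT \<omega>|M. T i \<omega> * T j \<omega>) - a\<^sup>2"
    if "i \<in> I" "j \<in> I" for i j
    using int that mean by (simp add: prob_space power2_eq_square)
  have "(LINT \<omega>|M. (\<Sum>i\<in>I. T i \<omega> - a)\<^sup>2) = (\<Sum>i\<in>I. \<Sum>j\<in>I. (LINT \<omega>|M. T i \<omega> * T j \<omega>) - a\<^sup>2)"
    unfolding expand using i e by (simp add: Bochner_Integration.integral_sum Bochner_Integration.integrable_sum)
  also have "\<dots> = (\<Sum>i\<in>I. \<Sum>j\<in>I. if i = j then (LINT \<omega>|M. T i \<omega> * T i \<omega>) - a\<^sup>2 else 0)"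
    using cross by (intro sum.cong) auto
  also have "\<dots> = (\<Sum>i\<in>I. (LINT \<omega>|M. T i \<omega> * T i \<omega>) - a\<^sup>2)"
    using I by simp
  also have "\<dots> \<le> (\<Sum>i\<in>I. q)"
    using sq by (intro sum_mono) (smt (verit) zero_le_power2)
  finally show "(LINT \<omega>|M. (\<Sum>i\<in>I. T i \<omega> - a)\<^sup>2) \<le> real (card I) * q" by simp
qed

lemma (in prob_space) prob_abs_ge_le_second_moment:
  fixes Z :: "'a \<Rightarrow> real"
  assumes [measurable]: "Z \<in> borel_measurable M" and "integrable M (\<lambda>\<omega>. (Z \<omega>)\<^sup>2)" "0 < K"
  shows "prob {\<omega>\<in>space M. K \<le> \<bar>Z \<omega>\<bar>} \<le> (LINT \<omega>|M. (Z \<omega>)\<^sup>2) / K\<^sup>2"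
proof -
  have "K\<^sup>2 * prob {\<omega>\<in>space M. K \<le> \<bar>Z \<omega>\<bar>} = (LINT \<omega>|M. K\<^sup>2 * indicator {\<omega>\<in>space M. K \<le> \<bar>Z \<omega>\<bar>} \<omega>)"
    by simp
  also have "\<dots> \<le> (LINT \<omega>|M. (Z \<omega>)\<^sup>2)"
  proof (rule integral_mono)
    show "K\<^sup>2 * indicator {\<omega>\<in>space M. K \<le> \<bar>Z \<omega>\<bar>} \<omega> \<le> (Z \<omega>)\<^sup>2" for \<omega>
      using power_mono[of K "\<bar>Z \<omega>\<bar>" 2] \<open>0 < K\<close> by (auto simp: indicator_def)
    show "integrable M (\<lambda>\<omega>. K\<^sup>2 * indicator {\<omega>\<in>space M. K \<le> \<bar>Z \<omega>\<bar>} \<omega>)"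
      by (intro integrable_mult_right integrable_real_indicator) (auto simp: less_top[symmetric])
  qed (use assms in auto)
  finally show ?thesis using \<open>0 < K\<close> by (simp add: pos_le_divide_eq mult.commute)
qed

section \<open>Exponential tilting of the standard normal law\<close>

text \<open>Completing the square turns the weighted normal density into the density translated by
  \<open>c\<close>. Banach-valued \<open>f\<close> is allowed because both real indicators and
  complex characters are inserted later.\<close>

lemma integral_exp_tilt_std_normal:
  fixes f :: "real \<Rightarrow> 'b :: {banach, second_countable_topology}"
  assumes [measurable]: "f \<in> borel_measurable borel"
  shows "(LINT x|std_normal_distribution. exp (c * x - c\<^sup>2 / 2) *\<^sub>R f x) = (LINT x|std_normal_distribution. f (x + c))"
proof -
  have dens: "std_normal_density x * exp (c * x - c\<^sup>2 / 2) = std_normal_density (x - c)" for x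
  proof -
    have "- x\<^sup>2 / 2 + (c * x - c\<^sup>2 / 2) = - (x - c)\<^sup>2 / 2"
      by (simp add: power2_eq_square field_simps)
    then show ?thesis
      unfolding std_normal_density_def by (simp add: exp_add[symmetric])
  qed
  have "(LINT x|std_normal_distribution. exp (c * x - c\<^sup>2 / 2) *\<^sub>R f x)
      = (LINT x|lborel. std_normal_density x *\<^sub>R exp (c * x - c\<^sup>2 / 2) *\<^sub>R f x)"
    by (subst integral_density) auto
  also have "\<dots> = (LINT x|lborel. std_normal_density (x - c) *\<^sub>R f x)"
    by (simp add: dens)
  also have "\<dots> = (LINT x|lborel. std_normal_density x *\<^sub>R f (x + c))"
    by (subst lborel_integral_real_affine[where c=1 and t=c]) (auto simp: add.commute)
  also have "\<dots> = (LINT x|std_normal_distribution. f (x + c))"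
    by (subst integral_density) auto
  finally show ?thesis .
qed

text \<open>If the weight were not integrable, its Bochner integral would be 0 by convention, while
  the shift formula for the constant 1 gives the value 1.\<close>

lemma integrable_exp_tilt_std_normal: "integrable std_normal_distribution (\<lambda>x. exp (c * x - c\<^sup>2 / 2))"
proof (rule ccontr)
  assume "\<not> ?thesis"
  then have "(LINT x|std_normal_distribution. exp (c * x - c\<^sup>2 / 2) *\<^sub>R (1 :: real)) = 0"
    by (simp add: not_integrable_integral_eq)
  moreover have "(LINT x|std_normal_distribution. (1 :: real)) = 1"
    using prob_space.prob_space[OF real_distribution.axioms(1)[OF real_dist_normal_dist]] by simp
  ultimately show False
    using integral_exp_tilt_std_normal[of "\<lambda>_. 1 :: real" c] by simp
qed

section \<open>Wiener integrals\<close>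

definition cube_measure :: "(real ^ 'd) measure" where
  "cube_measure = restrict_space lborel unit_cube"

lemma unit_cube_sets [measurable]: "unit_cube \<in> sets lborel" "unit_cube \<in> sets borel"
  by (simp_all add: unit_cube_def)

text \<open>The clipping at 0 covers empty intersections, giving one formula for three purposes: the
  covariance of the sheet, the vanishing overlap of packed translates, and continuity of the overlap
  in the centre and the bandwidth.\<close>

lemma measure_cbox_Int_cbox:
  fixes a b c d :: "real ^ 'd"
  shows "measure lborel (cbox a b \<inter> cbox c d) = (\<Prod>i\<in>UNIV. max 0 (min (b $ i) (d $ i) - max (a $ i) (c $ i)))"
proof -
  let ?l = "(\<chi> i. max (a $ i) (c $ i)) :: real ^ 'd" and ?u = "(\<chi> i. min (b $ i) (d $ i)) :: real ^ 'd"
  have eq: "cbox a b \<inter> cbox c d = cbox ?l ?u"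
    by (auto simp: mem_box_cart)
  show ?thesis
  proof (cases "cbox ?l ?u = {}")
    case True
    then obtain i where "?u $ i < ?l $ i" by (auto simp: interval_eq_empty_cart)
    then have "(\<Prod>i\<in>UNIV. max 0 (min (b $ i) (d $ i) - max (a $ i) (c $ i))) = 0"
      by (intro prod_zero bexI[of _ i]) (auto simp: max_def)
    with True eq show ?thesis by simp
  next
    case False
    then have "?l $ i \<le> ?u $ i" for i by (simp add: interval_ne_empty_cart)
    moreover have "measure lborel (cbox ?l ?u) = (\<Prod>i\<in>UNIV. ?u $ i - ?l $ i)"
      by (rule content_cbox_cart[OF False])
    ultimately show ?thesis unfolding eq
      by (auto intro!: prod.cong simp: max_def)
  qed
qed

lemma measure_unit_cube: "measure lborel (unit_cube :: (real ^ 'd) set) = 1"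
  using measure_cbox_Int_cbox[of "0 :: real ^ 'd" 1 0 1] by (simp add: unit_cube_def)

lemma prob_space_cube_measure: "prob_space (cube_measure :: (real ^ 'd) measure)"
proof (rule prob_spaceI)
  have "emeasure lborel (unit_cube :: (real ^ 'd) set) \<noteq> \<infinity>"
    unfolding unit_cube_def using emeasure_lborel_cbox_finite[of 0 1] by (metis infinity_ennreal_def less_irrefl)
  then have "emeasure lborel (unit_cube :: (real ^ 'd) set) = 1"
    using measure_unit_cube[where 'd='d] by (simp add: emeasure_eq_ennreal_measure)
  then show "emeasure cube_measure (space (cube_measure :: (real ^ 'd) measure)) = 1"
    by (simp add: cube_measure_def emeasure_restrict_space space_restrict_space)
qed

interpretation cube: prob_space "cube_measure :: (real ^ 'd) measure"
  by (rule prob_space_cube_measure)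

lemma measurable_cube_measure [measurable]:
  "g \<in> borel_measurable borel \<Longrightarrow> g \<in> borel_measurable cube_measure"
  unfolding cube_measure_def by (intro measurable_restrict_space1) simp

lemma integral_cube_measure: "(LINT x|cube_measure. g x) = (LINT x:unit_cube|lborel. g x)"
  for g :: "real ^ 'd \<Rightarrow> real"
  unfolding cube_measure_def by (subst integral_restrict_space) (auto simp: set_lebesgue_integral_def)

lemma integral_cube_measure_indicator:
  assumes "A \<in> sets borel" "A \<subseteq> unit_cube"
  shows "(LINT x|cube_measure. indicator A x) = measure lborel A"
proof -
  have "(LINT x|cube_measure. indicator A x :: real) = (LINT x|lborel. indicator unit_cube x * indicator A x)"
    unfolding integral_cube_measure set_lebesgue_integral_def by simp
  also have "\<dots> = (LINT x|lborel. indicator A x)"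
    using assms by (intro Bochner_Integration.integral_cong) (auto simp: indicator_def)
  finally show ?thesis using assms by simp
qed

lemma cbox_0_subset_unit_cube: "u \<in> unit_cube \<Longrightarrow> cbox 0 u \<subseteq> unit_cube"
proof
  fix x assume u: "u \<in> unit_cube" and x: "x \<in> cbox 0 u"
  have "x $ i \<le> 1" for i
    using u x order_trans[of "x $ i" "u $ i" 1] by (simp add: unit_cube_def mem_box_cart)
  with x show "x \<in> unit_cube" by (simp add: unit_cube_def mem_box_cart)
qed

text \<open>Separates the approximating step functions from the measurability conditions, and
  replaces the set integral by \<open>cube_measure\<close> so that both error limits have the form
  required by \<open>L2_limit\<close>.\<close>

definition wiener_approx ::
  "'w measure \<Rightarrow> (real ^ 'd \<Rightarrow> 'w \<Rightarrow> real) \<Rightarrow> (real ^ 'd \<Rightarrow> real) \<Rightarrow> ('w \<Rightarrow> real) \<Rightarrow>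
    (nat \<Rightarrow> (real ^ 'd) set) \<Rightarrow> (nat \<Rightarrow> real ^ 'd \<Rightarrow> real) \<Rightarrow> bool" where
  "wiener_approx M W g Z S a \<longleftrightarrow>
     (\<forall>k. finite (S k) \<and> S k \<subseteq> unit_cube) \<and>
     (\<lambda>k. \<integral>\<^sup>+x. ennreal ((g x - (\<Sum>u\<in>S k. a k u * indicator (cbox 0 u) x))\<^sup>2) \<partial>cube_measure) \<longlonglongrightarrow> 0 \<and>
     (\<lambda>k. \<integral>\<^sup>+\<omega>. ennreal ((Z \<omega> - (\<Sum>u\<in>S k. a k u * W u \<omega>))\<^sup>2) \<partial>M) \<longlonglongrightarrow> 0"

lemma has_wiener_integral_iff:
  "has_wiener_integral M W g Z \<longleftrightarrow> g \<in> borel_measurable cube_measure \<and> Z \<in> borel_measurable M \<and>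
     (\<exists>S a. wiener_approx M W g Z S a)"
proof -
  have 1: "set_borel_measurable lborel unit_cube g \<longleftrightarrow> g \<in> borel_measurable cube_measure"
    unfolding cube_measure_def set_borel_measurable_def
    by (rule borel_measurable_restrict_space_iff[symmetric]) simp
  have 2: "(\<integral>\<^sup>+x\<in>unit_cube. f x \<partial>lborel) = (\<integral>\<^sup>+x. f x \<partial>cube_measure)" for f :: "real ^ 'd \<Rightarrow> ennreal"
    unfolding cube_measure_def by (rule nn_integral_restrict_space[symmetric]) simp
  show ?thesis unfolding has_wiener_integral_def wiener_approx_def 1 2 ..
qed

section \<open>Isometry, linearity and independence of Wiener integrals\<close>

locale sheet_space = prob_space M for M :: "'w measure" +
  fixes W :: "real ^ 'd \<Rightarrow> 'w \<Rightarrow> real"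
  assumes sheet: "brownian_sheet M W"
begin

lemma W_facts:
  assumes "u \<in> unit_cube"
  shows "W u \<in> borel_measurable M" "integrable M (W u)" "integrable M (\<lambda>\<omega>. (W u \<omega>)\<^sup>2)"
proof -
  have "gaussian_process M unit_cube W" using sheet by (simp add: brownian_sheet_def)
  then have "finite {u} \<and> {u} \<subseteq> unit_cube \<longrightarrow> gaussian_rv M (\<lambda>\<omega>. \<Sum>i\<in>{u}. 1 * W i \<omega>)"
    unfolding gaussian_process_def by (elim allE)
  with assms have "gaussian_rv M (W u)" by simp
  from gaussian_rv_moments[OF this] show "W u \<in> borel_measurable M" "integrable M (W u)" "integrable M (\<lambda>\<omega>. (W u \<omega>)\<^sup>2)"
    by auto
qed

lemmas W_measurable [measurable] = W_facts(1)

text \<open>The covariance of \<open>W u\<close> and \<open>W v\<close> is the volume of the common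
  part of \<open>cbox 0 u\<close> and \<open>cbox 0 v\<close>. Hence both second moments are the
  same quadratic form in the coefficients, and centred Gaussianity yields the characteristic
  function.\<close>

lemma step_facts:
  assumes S: "finite S" "S \<subseteq> unit_cube"
  shows "(\<lambda>\<omega>. \<Sum>u\<in>S. a u * W u \<omega>) \<in> borel_measurable M"
    and "integrable M (\<lambda>\<omega>. (\<Sum>u\<in>S. a u * W u \<omega>)\<^sup>2)"
    and "integrable cube_measure (\<lambda>x. (\<Sum>u\<in>S. a u * indicator (cbox 0 u) x)\<^sup>2)"
    and "(LINT \<omega>|M. (\<Sum>u\<in>S. a u * W u \<omega>)\<^sup>2) = (LINT x|cube_measure. (\<Sum>u\<in>S. a u * indicator (cbox 0 u) x)\<^sup>2)"
    and "(LINT \<omega>|M. iexp (\<Sum>u\<in>S. a u * W u \<omega>)) =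
      exp (- (LINT x|cube_measure. (\<Sum>u\<in>S. a u * indicator (cbox 0 u) x)\<^sup>2) / 2)"
proof -
  have gp: "gaussian_process M unit_cube W" and mean: "\<And>t. t \<in> unit_cube \<Longrightarrow> (LINT \<omega>|M. W t \<omega>) = 0"
    and cov: "\<And>s t. s \<in> unit_cube \<Longrightarrow> t \<in> unit_cube \<Longrightarrow> (LINT \<omega>|M. W s \<omega> * W t \<omega>) = (\<Prod>i\<in>UNIV. min (s $ i) (t $ i))"
    using sheet by (auto simp: brownian_sheet_def)
  have g: "gaussian_rv M (\<lambda>\<omega>. \<Sum>u\<in>S. a u * W u \<omega>)"
    using gp S unfolding gaussian_process_def by blast
  show "(\<lambda>\<omega>. \<Sum>u\<in>S. a u * W u \<omega>) \<in> borel_measurable M" "integrable M (\<lambda>\<omega>. (\<Sum>u\<in>S. a u * W u \<omega>)\<^sup>2)"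
    using gaussian_rv_moments[OF g] by auto
  have m0: "(LINT \<omega>|M. (\<Sum>u\<in>S. a u * W u \<omega>)) = 0"
    using S W_facts(2) mean by (subst Bochner_Integration.integral_sum) (auto intro!: sum.neutral)
  have bnd: "integrable cube_measure (\<lambda>x. indicator (cbox 0 u) x * indicator (cbox 0 v) x :: real)" for u v :: "real ^ 'd"
    by (rule cube.integrable_const_bound[where B=1]) (auto simp: indicator_def intro!: measurable_cube_measure)
  have expand: "(\<Sum>u\<in>S. a u * w u)\<^sup>2 = (\<Sum>u\<in>S. \<Sum>v\<in>S. (a u * a v) * (w u * w v))" for w :: "real ^ 'd \<Rightarrow> real"
    by (simp add: power2_eq_square sum_product mult_ac)
  show "integrable cube_measure (\<lambda>x. (\<Sum>u\<in>S. a u * indicator (cbox 0 u) x)\<^sup>2)"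
    unfolding expand
    by (intro Bochner_Integration.integrable_sum integrable_mult_right bnd)
  have WW: "integrable M (\<lambda>\<omega>. W u \<omega> * W v \<omega>)" if "u \<in> unit_cube" "v \<in> unit_cube" for u v
    using W_facts[OF that(1)] W_facts[OF that(2)] by (intro integrable_mult_of_square_integrable)
  have ii: "(LINT x|cube_measure. indicator (cbox 0 u) x * indicator (cbox 0 v) x) = (\<Prod>i\<in>UNIV. min (u $ i) (v $ i))"
    if "u \<in> unit_cube" "v \<in> unit_cube" for u v :: "real ^ 'd"
  proof -
    have "(LINT x|cube_measure. indicator (cbox 0 u) x * indicator (cbox 0 v) x :: real) = (LINT x|cube_measure. indicator (cbox 0 u \<inter> cbox 0 v) x)"
      by (simp only: indicator_inter_arith)
    also have "\<dots> = measure lborel (cbox 0 u \<inter> cbox 0 v)"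
      using cbox_0_subset_unit_cube[OF that(1)] by (intro integral_cube_measure_indicator) auto
    also have "\<dots> = (\<Prod>i\<in>UNIV. min (u $ i) (v $ i))"
      unfolding measure_cbox_Int_cbox using that by (auto intro!: prod.cong simp: unit_cube_def mem_box_cart)
    finally show ?thesis .
  qed
  show eq: "(LINT \<omega>|M. (\<Sum>u\<in>S. a u * W u \<omega>)\<^sup>2) = (LINT x|cube_measure. (\<Sum>u\<in>S. a u * indicator (cbox 0 u) x)\<^sup>2)"
  proof -
    have "(LINT \<omega>|M. (\<Sum>u\<in>S. a u * W u \<omega>)\<^sup>2) = (LINT \<omega>|M. (\<Sum>u\<in>S. \<Sum>v\<in>S. (a u * a v) * (W u \<omega> * W v \<omega>)))"
      unfolding expand ..
    also have "\<dots> = (\<Sum>u\<in>S. \<Sum>v\<in>S. (a u * a v) * (\<Prod>i\<in>UNIV. min (u $ i) (v $ i)))"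
      using S WW cov by (simp add: Bochner_Integration.integral_sum subset_iff)
    also have "\<dots> = (LINT x|cube_measure. (\<Sum>u\<in>S. \<Sum>v\<in>S. (a u * a v) * (indicator (cbox 0 u) x * indicator (cbox 0 v) x)))"
      using S bnd ii by (simp add: Bochner_Integration.integral_sum subset_iff)
    also have "\<dots> = (LINT x|cube_measure. (\<Sum>u\<in>S. a u * indicator (cbox 0 u) x)\<^sup>2)"
      unfolding expand ..
    finally show ?thesis .
  qed
  show "(LINT \<omega>|M. iexp (\<Sum>u\<in>S. a u * W u \<omega>)) =
      exp (- (LINT x|cube_measure. (\<Sum>u\<in>S. a u * indicator (cbox 0 u) x)\<^sup>2) / 2)"
    using gaussian_rv_moments(4)[OF g m0] unfolding eq by simp
qed

text \<open>The isometry and the characteristic function pass from step functions to the limit: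
  norms converge on both sides by \<open>L2_limit\<close>, and characteristic functions by L2
  continuity.\<close>

lemma wiener_integral_facts:
  assumes "has_wiener_integral M W g Z"
  shows "Z \<in> borel_measurable M" "g \<in> borel_measurable cube_measure"
    and "integrable M (\<lambda>\<omega>. (Z \<omega>)\<^sup>2)" "integrable cube_measure (\<lambda>x. (g x)\<^sup>2)"
    and "(LINT \<omega>|M. (Z \<omega>)\<^sup>2) = (LINT x|cube_measure. (g x)\<^sup>2)"
    and "(LINT \<omega>|M. iexp (Z \<omega>)) = exp (- (LINT x|cube_measure. (g x)\<^sup>2) / 2)"
proof -
  obtain S a where A: "wiener_approx M W g Z S a"
    using assms unfolding has_wiener_integral_iff by blast
  have g: "g \<in> borel_measurable cube_measure" and Z: "Z \<in> borel_measurable M"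
    using assms unfolding has_wiener_integral_iff by blast+
  note SS = A[unfolded wiener_approx_def, THEN conjunct1]
    and lg = A[unfolded wiener_approx_def, THEN conjunct2, THEN conjunct1]
    and lZ = A[unfolded wiener_approx_def, THEN conjunct2, THEN conjunct2]
  have S: "finite (S k)" "S k \<subseteq> unit_cube" for k using SS by auto
  have sm: "(\<lambda>x. \<Sum>u\<in>S k. a k u * indicator (cbox 0 u) x) \<in> borel_measurable cube_measure" for k
    by (intro measurable_cube_measure) simp
  note sf = step_facts[OF S]
  note L1 = L2_limit[OF g sm sf(3) lg]
  note L2 = L2_limit[OF Z sf(1) sf(2) lZ]
  show "Z \<in> borel_measurable M" "g \<in> borel_measurable cube_measure" by (fact Z g)+
  show "integrable M (\<lambda>\<omega>. (Z \<omega>)\<^sup>2)" "integrable cube_measure (\<lambda>x. (g x)\<^sup>2)" by (fact L1 L2)+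
  show "(LINT \<omega>|M. (Z \<omega>)\<^sup>2) = (LINT x|cube_measure. (g x)\<^sup>2)"
    using L2(4) L1(4) unfolding sf(4) by (rule LIMSEQ_unique)
  have "(\<lambda>k. LINT \<omega>|M. iexp (\<Sum>u\<in>S k. a k u * W u \<omega>)) \<longlonglongrightarrow> (LINT \<omega>|M. iexp (Z \<omega>))"
    by (rule integral_iexp_L2_tendsto[OF Z sf(1) L2(2) L2(3)])
  moreover have "(\<lambda>k. LINT \<omega>|M. iexp (\<Sum>u\<in>S k. a k u * W u \<omega>)) \<longlonglongrightarrow> complex_of_real (exp (- (LINT x|cube_measure. (g x)\<^sup>2) / 2))"
    unfolding sf(5) using L1(4) by (intro tendsto_intros) auto
  ultimately show "(LINT \<omega>|M. iexp (Z \<omega>)) = exp (- (LINT x|cube_measure. (g x)\<^sup>2) / 2)"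
    by (rule LIMSEQ_unique)
qed

lemma wiener_integral_step:
  assumes S: "finite S" "S \<subseteq> unit_cube"
  shows "has_wiener_integral M W (\<lambda>x. \<Sum>u\<in>S. b u * indicator (cbox 0 u) x) (\<lambda>\<omega>. \<Sum>u\<in>S. b u * W u \<omega>)"
proof -
  have "(\<lambda>x. \<Sum>u\<in>S. b u * indicator (cbox 0 u) x) \<in> borel_measurable cube_measure"
    by (rule measurable_cube_measure) simp
  moreover have "wiener_approx M W (\<lambda>x. \<Sum>u\<in>S. b u * indicator (cbox 0 u) x) (\<lambda>\<omega>. \<Sum>u\<in>S. b u * W u \<omega>) (\<lambda>_. S) (\<lambda>_. b)"
    unfolding wiener_approx_def
    by (simp only: S diff_self zero_power2 ennreal_0 nn_integral_const mult_zero_left tendsto_const simp_thms)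
  ultimately show ?thesis
    unfolding has_wiener_integral_iff using step_facts(1)[OF S] by blast
qed

text \<open>The two approximating sequences are combined over the unions of their node sets.\<close>

lemma wiener_integral_linear:
  assumes "has_wiener_integral M W g Z" "has_wiener_integral M W g' Z'"
  shows "has_wiener_integral M W (\<lambda>x. p * g x + q * g' x) (\<lambda>\<omega>. p * Z \<omega> + q * Z' \<omega>)"
proof -
  obtain S a where A: "wiener_approx M W g Z S a"
    using assms(1) unfolding has_wiener_integral_iff by blast
  have g: "g \<in> borel_measurable cube_measure" and Z: "Z \<in> borel_measurable M"
    using assms(1) unfolding has_wiener_integral_iff by blast+
  note SS = A[unfolded wiener_approx_def, THEN conjunct1]
    and lg = A[unfolded wiener_approx_def, THEN conjunct2, THEN conjunct1]
    and lZ = A[unfolded wiener_approx_def, THEN conjunct2, THEN conjunct2]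
  obtain S' a' where A': "wiener_approx M W g' Z' S' a'"
    using assms(2) unfolding has_wiener_integral_iff by blast
  have g': "g' \<in> borel_measurable cube_measure" and Z': "Z' \<in> borel_measurable M"
    using assms(2) unfolding has_wiener_integral_iff by blast+
  note SS' = A'[unfolded wiener_approx_def, THEN conjunct1]
    and lg' = A'[unfolded wiener_approx_def, THEN conjunct2, THEN conjunct1]
    and lZ' = A'[unfolded wiener_approx_def, THEN conjunct2, THEN conjunct2]
  have S: "finite (S k)" "S k \<subseteq> unit_cube" and S': "finite (S' k)" "S' k \<subseteq> unit_cube" for k
    using SS SS' by auto
  define c where "c k u = p * (if u \<in> S k then a k u else 0) + q * (if u \<in> S' k then a' k u else 0)" for k u
  have c: "(\<Sum>u\<in>S k \<union> S' k. c k u * w u) = p * (\<Sum>u\<in>S k. a k u * w u) + q * (\<Sum>u\<in>S' k. a' k u * w u)"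
    for k and w :: "real ^ 'd \<Rightarrow> real"
  proof -
    have "(\<Sum>u\<in>S k. a k u * w u) = (\<Sum>u\<in>S k \<union> S' k. (if u \<in> S k then a k u else 0) * w u)"
      using S S' by (intro sum.mono_neutral_cong_left) auto
    moreover have "(\<Sum>u\<in>S' k. a' k u * w u) = (\<Sum>u\<in>S k \<union> S' k. (if u \<in> S' k then a' k u else 0) * w u)"
      using S S' by (intro sum.mono_neutral_cong_left) auto
    ultimately show ?thesis
      unfolding c_def by (simp add: sum_distrib_left sum.distrib[symmetric] algebra_simps)
  qed
  \<comment> \<open>Used once on the cube and once on the probability space, so the measure is left
    general. The constants come from \<open>(A + B)^2 <= 2 * A^2 + 2 * B^2\<close>.\<close>
  have comb: "(\<lambda>k. \<integral>\<^sup>+x. ennreal (((p * f x + q * f' x) - (p * s k x + q * s' k x))\<^sup>2) \<partial>N) \<longlonglongrightarrow> 0"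
    if [measurable]: "f \<in> borel_measurable N" "f' \<in> borel_measurable N" "\<And>k. s k \<in> borel_measurable N" "\<And>k. s' k \<in> borel_measurable N"
    and l: "(\<lambda>k. \<integral>\<^sup>+x. ennreal ((f x - s k x)\<^sup>2) \<partial>N) \<longlonglongrightarrow> 0"
    and l': "(\<lambda>k. \<integral>\<^sup>+x. ennreal ((f' x - s' k x)\<^sup>2) \<partial>N) \<longlonglongrightarrow> 0"
    for N :: "'z measure" and f f' :: "'z \<Rightarrow> real" and s s' :: "nat \<Rightarrow> 'z \<Rightarrow> real"
  proof (rule tendsto_sandwich[OF _ _ tendsto_const])
    let ?b = "\<lambda>k. ennreal (2 * p\<^sup>2) * (\<integral>\<^sup>+x. ennreal ((f x - s k x)\<^sup>2) \<partial>N) + ennreal (2 * q\<^sup>2) * (\<integral>\<^sup>+x. ennreal ((f' x - s' k x)\<^sup>2) \<partial>N)"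
    have "?b \<longlonglongrightarrow> ennreal (2 * p\<^sup>2) * 0 + ennreal (2 * q\<^sup>2) * 0"
      by (intro tendsto_add ennreal_tendsto_cmult l l') auto
    then show "?b \<longlonglongrightarrow> 0" by simp
    have sq: "(A + B)\<^sup>2 \<le> 2 * A\<^sup>2 + 2 * B\<^sup>2" for A B :: real
      using sum_squares_bound[of A B] by (simp add: power2_eq_square algebra_simps)
    have "((p * f x + q * f' x) - (p * s k x + q * s' k x))\<^sup>2 \<le> 2 * p\<^sup>2 * (f x - s k x)\<^sup>2 + 2 * q\<^sup>2 * (f' x - s' k x)\<^sup>2" for x k
proof -
      have "(p * f x + q * f' x) - (p * s k x + q * s' k x) = p * (f x - s k x) + q * (f' x - s' k x)"
        by (simp add: algebra_simps)
      then show ?thesis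
        using sq[of "p * (f x - s k x)" "q * (f' x - s' k x)"] by (simp add: power_mult_distrib)
    qed
    then have "(\<integral>\<^sup>+x. ennreal (((p * f x + q * f' x) - (p * s k x + q * s' k x))\<^sup>2) \<partial>N)
        \<le> (\<integral>\<^sup>+x. ennreal (2 * p\<^sup>2) * ennreal ((f x - s k x)\<^sup>2) + ennreal (2 * q\<^sup>2) * ennreal ((f' x - s' k x)\<^sup>2) \<partial>N)" for k
      by (intro nn_integral_mono) (simp add: ennreal_mult[symmetric] ennreal_plus[symmetric] del: ennreal_plus)
    also have "\<dots> k = ?b k" for k
      by (simp add: nn_integral_add nn_integral_cmult)
    finally show "eventually (\<lambda>k. (\<integral>\<^sup>+x. ennreal (((p * f x + q * f' x) - (p * s k x + q * s' k x))\<^sup>2) \<partial>N) \<le> ?b k) sequentially"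
      by simp
  qed simp
  have meas: "(\<lambda>x. p * g x + q * g' x) \<in> borel_measurable cube_measure" "(\<lambda>\<omega>. p * Z \<omega> + q * Z' \<omega>) \<in> borel_measurable M"
    by (intro borel_measurable_add borel_measurable_times borel_measurable_const g g' Z Z')+
  have sm: "(\<lambda>x. \<Sum>u\<in>S. a u * indicator (cbox 0 u) x) \<in> borel_measurable cube_measure"
    for S :: "(real ^ 'd) set" and a :: "real ^ 'd \<Rightarrow> real"
    by (rule measurable_cube_measure) simp
  have "wiener_approx M W (\<lambda>x. p * g x + q * g' x) (\<lambda>\<omega>. p * Z \<omega> + q * Z' \<omega>) (\<lambda>k. S k \<union> S' k) c"
    unfolding wiener_approx_def
  proof (intro conjI allI)
    show "(\<lambda>k. \<integral>\<^sup>+x. ennreal ((p * g x + q * g' x - (\<Sum>u\<in>S k \<union> S' k. c k u * indicator (cbox 0 u) x))\<^sup>2) \<partial>cube_measure) \<longlonglongrightarrow> 0"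
      unfolding c by (rule comb[OF g g' sm sm lg lg'])
    show "(\<lambda>k. \<integral>\<^sup>+\<omega>. ennreal ((p * Z \<omega> + q * Z' \<omega> - (\<Sum>u\<in>S k \<union> S' k. c k u * W u \<omega>))\<^sup>2) \<partial>M) \<longlonglongrightarrow> 0"
      unfolding c by (rule comb[OF Z Z' step_facts(1)[OF S] step_facts(1)[OF S'] lZ lZ'])
    show "finite (S k \<union> S' k)" "S k \<union> S' k \<subseteq> unit_cube" for k
      using S[of k] S'[of k] by blast+
  qed
  with meas show ?thesis
    unfolding has_wiener_integral_iff by blast
qed

lemma wiener_integral_combination:
  assumes "has_wiener_integral M W g1 Z1" "has_wiener_integral M W g2 Z2"
  shows "integrable cube_measure (\<lambda>x. g1 x * g2 x)"
    and "(LINT x|cube_measure. (a * g1 x + b * g2 x)\<^sup>2) =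
      a\<^sup>2 * (LINT x|cube_measure. (g1 x)\<^sup>2) + 2 * a * b * (LINT x|cube_measure. g1 x * g2 x) + b\<^sup>2 * (LINT x|cube_measure. (g2 x)\<^sup>2)"
proof -
  note f1 = wiener_integral_facts[OF assms(1)] and f2 = wiener_integral_facts[OF assms(2)]
  show i: "integrable cube_measure (\<lambda>x. g1 x * g2 x)"
    by (rule integrable_mult_of_square_integrable[OF f1(2) f2(2) f1(4) f2(4)])
  have "(a * g1 x + b * g2 x)\<^sup>2 = a\<^sup>2 * (g1 x)\<^sup>2 + 2 * a * b * (g1 x * g2 x) + b\<^sup>2 * (g2 x)\<^sup>2" for x
    by (simp add: power2_eq_square algebra_simps)
  then show "(LINT x|cube_measure. (a * g1 x + b * g2 x)\<^sup>2) =
      a\<^sup>2 * (LINT x|cube_measure. (g1 x)\<^sup>2) + 2 * a * b * (LINT x|cube_measure. g1 x * g2 x) + b\<^sup>2 * (LINT x|cube_measure. (g2 x)\<^sup>2)"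
    using i f1(4) f2(4) by simp
qed

text \<open>The argument \<open>u\<close> is absorbed into the integrand: \<open>u * Z\<close> is
  the Wiener integral of \<open>u * g\<close>.\<close>

lemma wiener_integral_char:
  assumes "has_wiener_integral M W g Z"
  shows "(LINT \<omega>|M. iexp (u * Z \<omega>)) = exp (- u\<^sup>2 * (LINT x|cube_measure. (g x)\<^sup>2) / 2)"
  using wiener_integral_facts(6)[OF wiener_integral_linear[OF assms assms, of u 0]]
  by (simp add: power_mult_distrib)

lemma distr_wiener_integral_std_normal:
  assumes "has_wiener_integral M W g Z" "(LINT x|cube_measure. (g x)\<^sup>2) = 1"
  shows "distr M borel Z = std_normal_distribution"
proof (rule Levy_uniqueness)
  have [measurable]: "Z \<in> borel_measurable M" using wiener_integral_facts(1)[OF assms(1)] .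
  show "real_distribution (distr M borel Z)" by simp
  show "char (distr M borel Z) = char std_normal_distribution"
    unfolding char_std_normal_distribution
    using wiener_integral_char[OF assms(1)] assms(2)
    by (simp add: fun_eq_iff char_def integral_distr)
qed (rule real_dist_normal_dist)

text \<open>Orthogonality removes the cross term from the norm of \<open>a * g1 + b * g2\<close>, so
  the joint characteristic function factorises. \<open>char_determines_rectangles\<close> then
  identifies the joint law with the product law.\<close>

lemma orthogonal_wiener_integrals_indep:
  assumes Z1: "has_wiener_integral M W g1 Z1" and Z2: "has_wiener_integral M W g2 Z2"
    and orth: "(LINT x|cube_measure. g1 x * g2 x) = 0"
  shows "indep_var borel Z1 borel Z2"
proof -
  have [measurable]: "Z1 \<in> borel_measurable M" "Z2 \<in> borel_measurable M"
    using wiener_integral_facts(1) Z1 Z2 by auto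
  define D1 D2 where "D1 = distr M borel Z1" and "D2 = distr M borel Z2"
  interpret D1: prob_space D1 unfolding D1_def by (rule prob_space_distr) simp
  interpret D2: prob_space D2 unfolding D2_def by (rule prob_space_distr) simp
  interpret P: pair_prob_space D1 D2 ..
  have [measurable_cong]: "sets D1 = sets borel" "sets D2 = sets borel" by (simp_all add: D1_def D2_def)
  define N1 where "N1 = distr M (borel \<Otimes>\<^sub>M borel) (\<lambda>\<omega>. (Z1 \<omega>, Z2 \<omega>))"
  interpret N1: prob_space N1 unfolding N1_def by (rule prob_space_distr) simp
  have [measurable_cong]: "sets N1 = sets (borel \<Otimes>\<^sub>M borel)" by (simp add: N1_def)
  define L where "L = {l. \<exists>a b. l = (\<lambda>p::real \<times> real. a * fst p + b * snd p)}"
  have char1: "(LINT p|N1. iexp (a * fst p + b * snd p)) = (LINT \<omega>|M. iexp (a * Z1 \<omega>)) * (LINT \<omega>|M. iexp (b * Z2 \<omega>))" for a b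
  proof -
    have "(LINT p|N1. iexp (a * fst p + b * snd p)) = (LINT \<omega>|M. iexp (a * Z1 \<omega> + b * Z2 \<omega>))"
      unfolding N1_def by (subst integral_distr) auto
    also have "\<dots> = complex_of_real (exp (- (LINT x|cube_measure. (a * g1 x + b * g2 x)\<^sup>2) / 2))"
      by (rule wiener_integral_facts(6)[OF wiener_integral_linear[OF Z1 Z2]])
    also have "\<dots> = (LINT \<omega>|M. iexp (a * Z1 \<omega>)) * (LINT \<omega>|M. iexp (b * Z2 \<omega>))"
      unfolding wiener_integral_char[OF Z1] wiener_integral_char[OF Z2] wiener_integral_combination(2)[OF Z1 Z2] orth
      by (simp add: exp_add[symmetric] add_divide_distrib flip: of_real_mult)
    finally show ?thesis .
  qed
  have char2: "(LINT p|(D1 \<Otimes>\<^sub>M D2). iexp (a * fst p + b * snd p)) = (LINT \<omega>|M. iexp (a * Z1 \<omega>)) * (LINT \<omega>|M. iexp (b * Z2 \<omega>))" for a b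
  proof -
    have "(LINT p|(D1 \<Otimes>\<^sub>M D2). iexp (a * fst p + b * snd p)) = (LINT x|D1. (LINT y|D2. iexp (a * fst (x, y) + b * snd (x, y))))"
      by (rule P.integral_fst'[symmetric], rule P.integrable_iexp) simp_all
    also have "\<dots> = (LINT x|D1. (LINT y|D2. iexp (a * x) * iexp (b * y)))"
      by (simp add: exp_add distrib_left)
    also have "\<dots> = (LINT x|D1. iexp (a * x)) * (LINT y|D2. iexp (b * y))"
      by simp
    also have "\<dots> = (LINT \<omega>|M. iexp (a * Z1 \<omega>)) * (LINT \<omega>|M. iexp (b * Z2 \<omega>))"
      unfolding D1_def D2_def by (simp add: integral_distr)
    finally show ?thesis .
  qed
  have eq: "(LINT p|N1. indicator A (fst p) * indicator B (snd p)) = (LINT p|(D1 \<Otimes>\<^sub>M D2). indicator A (fst p) * indicator B (snd p) :: real)"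
    if "A \<in> sets borel" "B \<in> sets borel" for A B
  proof -
    \<comment> \<open>The two coordinates are indexed by the booleans, which turns a product of two
      indicators into a product over a finite index set.\<close>
    have "(LINT p|N1. (\<Prod>j\<in>UNIV. indicator (if j then A else B) ((if j then fst else snd) p) :: real))
      = (LINT p|(D1 \<Otimes>\<^sub>M D2). (\<Prod>j\<in>UNIV. indicator (if j then A else B) ((if j then fst else snd) p)))"
    proof (rule char_determines_rectangles[where L = L])
      show "l \<in> L \<Longrightarrow> l \<in> borel_measurable N1" "l \<in> L \<Longrightarrow> l \<in> borel_measurable (D1 \<Otimes>\<^sub>M D2)" for l
        unfolding L_def by auto
      show "(\<lambda>_. 0) \<in> L" unfolding L_def by (auto intro!: exI[of _ 0])
      show "(\<lambda>x. a * l x + b * l' x) \<in> L" if l: "l \<in> L" "l' \<in> L" for l l' a b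
      proof -
        obtain c d c' d' where "l = (\<lambda>p. c * fst p + d * snd p)" "l' = (\<lambda>p. c' * fst p + d' * snd p)"
          using l unfolding L_def by auto
        then have "(\<lambda>x. a * l x + b * l' x) = (\<lambda>p. (a * c + b * c') * fst p + (a * d + b * d') * snd p)"
          by (simp add: algebra_simps)
        then show ?thesis unfolding L_def by blast
      qed
      show "(LINT x|N1. iexp (l x)) = (LINT x|(D1 \<Otimes>\<^sub>M D2). iexp (l x))" if "l \<in> L" for l
        using that char1 char2 unfolding L_def by auto
      have "fst \<in> L" unfolding L_def
        by (rule CollectI, rule exI[of _ 1], rule exI[of _ 0]) simp
      moreover have "snd \<in> L" unfolding L_def
        by (rule CollectI, rule exI[of _ 0], rule exI[of _ 1]) simp
      ultimately show "(if j then fst else snd) \<in> L" for j by simp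
    qed (use that in \<open>auto intro: N1.finite_measure_axioms P.finite_measure_axioms\<close>)
    then show ?thesis by (simp add: UNIV_bool mult.commute)
  qed
  have "D1 \<Otimes>\<^sub>M D2 = N1"
  proof (rule pair_measure_eqI)
    show "sigma_finite_measure D1" "sigma_finite_measure D2" by unfold_locales
    show "sets (D1 \<Otimes>\<^sub>M D2) = sets N1" by (simp add: N1_def D1_def D2_def cong: sets_pair_measure_cong)
    fix A B assume AB: "A \<in> sets D1" "B \<in> sets D2"
    then have AB' [measurable]: "A \<in> sets borel" "B \<in> sets borel" by (simp_all add: D1_def D2_def)
    have ind: "indicator A (fst p) * indicator B (snd p) = (indicator (A \<times> B) p :: real)" for p
      by (cases p) (auto simp: indicator_def)
    have "measure N1 (A \<times> B) = measure (D1 \<Otimes>\<^sub>M D2) (A \<times> B)"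
      using eq[OF AB'] unfolding ind
      by (simp add: Int_absorb2 sets.sets_into_space[of "A \<times> B"] N1_def D1_def D2_def space_pair_measure)
    then have "emeasure N1 (A \<times> B) = emeasure (D1 \<Otimes>\<^sub>M D2) (A \<times> B)"
      by (simp add: N1.emeasure_eq_measure P.emeasure_eq_measure)
    also have "\<dots> = emeasure D1 A * emeasure D2 B"
      by (rule D2.emeasure_pair_measure_Times[OF AB])
    finally show "emeasure D1 A * emeasure D2 B = emeasure N1 (A \<times> B)" ..
  qed
  then show ?thesis
    unfolding indep_var_distribution_eq D1_def D2_def N1_def by simp
qed

section \<open>Cameron-Martin formula\<close>

lemma wiener_tilt:
  fixes f :: "real \<Rightarrow> 'b :: {banach, second_countable_topology}"
  assumes \<xi>: "has_wiener_integral M W g \<xi>" "(LINT x|cube_measure. (g x)\<^sup>2) = 1"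
    and [measurable]: "f \<in> borel_measurable borel"
  shows "(LINT \<omega>|M. exp (c * \<xi> \<omega> - c\<^sup>2 / 2) *\<^sub>R f (\<xi> \<omega>)) = (LINT \<omega>|M. f (\<xi> \<omega> + c))"
    and "integrable M (\<lambda>\<omega>. exp (c * \<xi> \<omega> - c\<^sup>2 / 2))"
    and "(LINT \<omega>|M. exp (c * \<xi> \<omega> - c\<^sup>2 / 2)) = 1"
proof -
  have [measurable]: "\<xi> \<in> borel_measurable M" using wiener_integral_facts(1)[OF \<xi>(1)] .
  note D = distr_wiener_integral_std_normal[OF \<xi>]
  \<comment> \<open>Proved with its own type variable, because it is needed both for
    \<open>f\<close> and for the real constant 1.\<close>
  have gen: "(LINT \<omega>|M. exp (c * \<xi> \<omega> - c\<^sup>2 / 2) *\<^sub>R h (\<xi> \<omega>)) = (LINT \<omega>|M. h (\<xi> \<omega> + c))"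
    if [measurable]: "h \<in> borel_measurable borel" for h :: "real \<Rightarrow> 'c :: {banach, second_countable_topology}"
  proof -
    have "(LINT \<omega>|M. exp (c * \<xi> \<omega> - c\<^sup>2 / 2) *\<^sub>R h (\<xi> \<omega>)) = (LINT x|distr M borel \<xi>. exp (c * x - c\<^sup>2 / 2) *\<^sub>R h x)"
      by (subst integral_distr) auto
    also have "\<dots> = (LINT x|distr M borel \<xi>. h (x + c))"
      unfolding D by (rule integral_exp_tilt_std_normal) simp
    also have "\<dots> = (LINT \<omega>|M. h (\<xi> \<omega> + c))"
      by (subst integral_distr) auto
    finally show ?thesis .
  qed
  show "(LINT \<omega>|M. exp (c * \<xi> \<omega> - c\<^sup>2 / 2) *\<^sub>R f (\<xi> \<omega>)) = (LINT \<omega>|M. f (\<xi> \<omega> + c))"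
    by (rule gen) simp
  have "integrable (distr M borel \<xi>) (\<lambda>x. exp (c * x - c\<^sup>2 / 2))"
    unfolding D by (rule integrable_exp_tilt_std_normal)
  then show "integrable M (\<lambda>\<omega>. exp (c * \<xi> \<omega> - c\<^sup>2 / 2))"
    by (subst (asm) integrable_distr_eq) auto
  show "(LINT \<omega>|M. exp (c * \<xi> \<omega> - c\<^sup>2 / 2)) = 1"
    using gen[of "\<lambda>_. 1 :: real"] by (simp add: prob_space)
qed

text \<open>Splitting \<open>W\<close> into its component along \<open>\<xi>\<close> and an independent remainder, the
  Cameron-Martin formula becomes the shift formula for a single normal variable.\<close>

lemma cameron_martin:
  assumes \<xi>: "has_wiener_integral M W g \<xi>" and g1: "(LINT x|cube_measure. (g x)\<^sup>2) = 1"
    and \<phi> [measurable]: "\<phi> \<in> borel_measurable (Pi\<^sub>M unit_cube (\<lambda>_. borel))"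
  shows "(LINT \<omega>|M. \<phi> (\<lambda>t\<in>unit_cube. W t \<omega> + c * (LINT x|cube_measure. indicator (cbox 0 t) x * g x))) =
    (LINT \<omega>|M. exp (c * \<xi> \<omega> - c\<^sup>2 / 2) * (\<phi> (\<lambda>t\<in>unit_cube. W t \<omega>) :: real))"
proof -
  \<comment> \<open>By the isometry this is the covariance of \<open>W t\<close> and
    \<open>\<xi>\<close>, the direction in which the weight moves the path.\<close>
  define b where "b t = (LINT x|cube_measure. indicator (cbox 0 t) x * g x)" for t
  define L where "L \<omega> = exp (c * \<xi> \<omega> - c\<^sup>2 / 2)" for \<omega>
  have \<xi>m [measurable]: "\<xi> \<in> borel_measurable M" using wiener_integral_facts(1)[OF \<xi>] .
  have Lm [measurable]: "L \<in> borel_measurable M" unfolding L_def by measurable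
  note tilt = wiener_tilt[OF \<xi> g1]
  have Lint: "integrable M L" unfolding L_def[abs_def] using tilt(2)[of "\<lambda>_. 0 :: real" c] by simp
  have m1 [measurable]: "(\<lambda>\<omega>. \<lambda>t\<in>unit_cube. W t \<omega> + c * b t) \<in> measurable M (Pi\<^sub>M unit_cube (\<lambda>_. borel))"
    by (rule measurable_restrict) simp
  have m2 [measurable]: "(\<lambda>\<omega>. \<lambda>t\<in>unit_cube. W t \<omega>) \<in> measurable M (Pi\<^sub>M unit_cube (\<lambda>_. borel))"
    by (rule measurable_restrict) simp
  \<comment> \<open>\<open>N1\<close> is the law of the shifted path, \<open>N2\<close> that of the
    noise path under the weight \<open>L\<close>. Their equality gives the formula for all \<phi> at
    once.\<close>
  define N1 where "N1 = distr M (Pi\<^sub>M unit_cube (\<lambda>_. borel)) (\<lambda>\<omega>. \<lambda>t\<in>unit_cube. W t \<omega> + c * b t)"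
  define N2 where "N2 = distr (density M L) (Pi\<^sub>M unit_cube (\<lambda>_. borel)) (\<lambda>\<omega>. \<lambda>t\<in>unit_cube. W t \<omega>)"
  have "N1 = N2"
  proof (rule PiM_eqI_char[where I = unit_cube])
    show "finite_measure N1" unfolding N1_def
      by (rule prob_space.finite_measure, rule prob_space_distr) simp
    have "(\<integral>\<^sup>+\<omega>. ennreal (L \<omega>) \<partial>M) = ennreal (LINT \<omega>|M. L \<omega>)"
      using Lint by (intro nn_integral_eq_integral) (auto simp: L_def[abs_def])
    then have "prob_space (density M L)"
      using tilt(3)[of "\<lambda>_. 0 :: real" c]
      by (intro prob_spaceI) (simp add: emeasure_density L_def[symmetric] cong: nn_integral_cong)
    then have "prob_space N2"
      unfolding N2_def by (rule prob_space.prob_space_distr) simp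
    then show "finite_measure N2" by (rule prob_space.finite_measure)
    fix K and a :: "real ^ 'd \<Rightarrow> real" assume K: "finite K" "K \<subseteq> (unit_cube :: (real ^ 'd) set)"
    have "(\<lambda>y. \<Sum>k\<in>K. a k * y k) \<in> borel_measurable (Pi\<^sub>M unit_cube (\<lambda>_. borel))"
      using K by (intro borel_measurable_sum borel_measurable_times borel_measurable_const measurable_component_singleton) auto
    then have iexpm: "(\<lambda>y. iexp (\<Sum>k\<in>K. a k * y k)) \<in> borel_measurable (Pi\<^sub>M unit_cube (\<lambda>_. borel))"
      by (rule measurable_compose) simp
    define U where "U \<omega> = (\<Sum>k\<in>K. a k * W k \<omega>)" for \<omega>
    define u :: "real ^ 'd \<Rightarrow> real" where "u x = (\<Sum>k\<in>K. a k * indicator (cbox 0 k) x)" for x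
    have U: "has_wiener_integral M W u U"
      unfolding U_def[abs_def] u_def[abs_def] by (rule wiener_integral_step[OF K])
    have Um [measurable]: "U \<in> borel_measurable M" using wiener_integral_facts(1)[OF U] .
    \<comment> \<open>The coefficient of the projection of \<open>u\<close> onto the unit vector
      \<open>g\<close>, so that \<open>U - \<beta> * \<xi>\<close> is the part independent of
      \<open>\<xi>\<close>.\<close>
    define \<beta> where "\<beta> = (LINT x|cube_measure. u x * g x)"
    note ug = wiener_integral_combination(1)[OF U \<xi>]
    have bi: "integrable cube_measure (\<lambda>x. indicator (cbox 0 k) x * g x)" if "k \<in> unit_cube" for k
    proof -
      have "has_wiener_integral M W (\<lambda>x. \<Sum>u\<in>{k}. 1 * indicator (cbox 0 u) x) (\<lambda>\<omega>. \<Sum>u\<in>{k}. 1 * W u \<omega>)"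
        using that by (intro wiener_integral_step) auto
      from wiener_integral_combination(1)[OF this \<xi>] show ?thesis by simp
    qed
    have \<beta>: "\<beta> = (\<Sum>k\<in>K. a k * b k)"
    proof -
      have "\<beta> = (LINT x|cube_measure. (\<Sum>k\<in>K. a k * (indicator (cbox 0 k) x * g x)))"
        unfolding \<beta>_def u_def by (simp add: sum_distrib_right mult.assoc)
      also have "\<dots> = (\<Sum>k\<in>K. LINT x|cube_measure. a k * (indicator (cbox 0 k) x * g x))"
        using bi K by (intro Bochner_Integration.integral_sum) auto
      finally show ?thesis by (simp add: b_def)
    qed
    have V: "has_wiener_integral M W (\<lambda>x. 1 * u x + (- \<beta>) * g x) (\<lambda>\<omega>. 1 * U \<omega> + (- \<beta>) * \<xi> \<omega>)"
      by (rule wiener_integral_linear[OF U \<xi>])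
    define V' where "V' \<omega> = 1 * U \<omega> + (- \<beta>) * \<xi> \<omega>" for \<omega>
    have [measurable]: "V' \<in> borel_measurable M" unfolding V'_def by measurable
    have "(LINT x|cube_measure. g x * (1 * u x + (- \<beta>) * g x)) = (LINT x|cube_measure. u x * g x - \<beta> * (g x)\<^sup>2)"
      by (simp add: algebra_simps power2_eq_square)
    also have "\<dots> = 0"
      using ug wiener_integral_facts(4)[OF \<xi>] g1 by (simp add: \<beta>_def)
    finally have "indep_var borel \<xi> borel V'"
      unfolding V'_def by (intro orthogonal_wiener_integrals_indep[OF \<xi> V])
    then have ind: "indep_var borel ((\<lambda>x. exp (c * x - c\<^sup>2 / 2) *\<^sub>R iexp (\<beta> * x)) \<circ> \<xi>) borel (iexp \<circ> V')"
      by (rule indep_var_compose) simp_all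
    have I1: "integrable M (\<lambda>\<omega>. exp (c * \<xi> \<omega> - c\<^sup>2 / 2) *\<^sub>R iexp (\<beta> * \<xi> \<omega>))"
      by (rule Bochner_Integration.integrable_bound[OF Lint]) (auto simp: L_def)
    have "(LINT y|N2. iexp (\<Sum>k\<in>K. a k * y k)) = (LINT \<omega>|M. L \<omega> *\<^sub>R iexp (U \<omega>))"
    proof -
      have "(LINT y|N2. iexp (\<Sum>k\<in>K. a k * y k)) = (LINT \<omega>|density M L. iexp (\<Sum>k\<in>K. a k * (\<lambda>t\<in>unit_cube. W t \<omega>) k))"
        unfolding N2_def by (rule integral_distr[OF _ iexpm]) (simp add: m2)
      also have "\<dots> = (LINT \<omega>|density M L. iexp (U \<omega>))"
        unfolding U_def using K
        by (intro Bochner_Integration.integral_cong refl arg_cong[where f=iexp] sum.cong) auto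
      also have "\<dots> = (LINT \<omega>|M. L \<omega> *\<^sub>R iexp (U \<omega>))"
        by (subst integral_density) (auto simp: L_def)
      finally show ?thesis .
    qed
    \<comment> \<open>Substituting \<open>U = \<beta> * \<xi> + V'\<close> splits the weighted
      character into a function of \<open>\<xi>\<close> times a function of \<open>V'\<close>, so
      independence lets the integral factor.\<close>
    also have "\<dots> = (LINT \<omega>|M. ((\<lambda>x. exp (c * x - c\<^sup>2 / 2) *\<^sub>R iexp (\<beta> * x)) \<circ> \<xi>) \<omega> * (iexp \<circ> V') \<omega>)"
      by (intro Bochner_Integration.integral_cong refl)
         (simp add: L_def V'_def scaleR_conv_of_real exp_add[symmetric] algebra_simps flip: exp_of_real)
    also have "\<dots> = (LINT \<omega>|M. ((\<lambda>x. exp (c * x - c\<^sup>2 / 2) *\<^sub>R iexp (\<beta> * x)) \<circ> \<xi>) \<omega>) * (LINT \<omega>|M. (iexp \<circ> V') \<omega>)"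
      using I1 by (intro indep_var_lebesgue_integral[OF ind]) (auto simp: comp_def intro!: integrable_iexp)
    also have "\<dots> = (LINT \<omega>|M. iexp (\<beta> * (\<xi> \<omega> + c))) * (LINT \<omega>|M. iexp (V' \<omega>))"
      using tilt(1)[of "\<lambda>x. iexp (\<beta> * x)" c] by (simp add: comp_def)
    also have "(LINT \<omega>|M. iexp (\<beta> * (\<xi> \<omega> + c))) = iexp (\<beta> * c) * (LINT \<omega>|M. iexp (\<beta> * \<xi> \<omega>))"
      unfolding distrib_left[of \<beta>] add.commute[of "\<beta> * \<xi> _"] iexp_add by (rule integral_mult_right_zero)
    also have "(LINT \<omega>|M. iexp (\<beta> * \<xi> \<omega>)) = exp (- \<beta>\<^sup>2 / 2)"
      using wiener_integral_char[OF \<xi>, of \<beta>] g1 by simp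
    also have "(LINT \<omega>|M. iexp (V' \<omega>)) = exp (- ((LINT x|cube_measure. (u x)\<^sup>2) - \<beta>\<^sup>2) / 2)"
    proof -
      have "(LINT x|cube_measure. (1 * u x + (- \<beta>) * g x)\<^sup>2) = (LINT x|cube_measure. (u x)\<^sup>2) - \<beta>\<^sup>2"
        unfolding wiener_integral_combination(2)[OF U \<xi>] g1 \<beta>_def[symmetric] by (simp add: power2_eq_square)
      then show ?thesis
        unfolding V'_def wiener_integral_facts(6)[OF V] by simp
    qed
    \<comment> \<open>The variance of \<open>U\<close> is recombined from its two orthogonal parts;
      the only trace of the weight is the phase \<open>c * \<beta>\<close>, the shift of the
      functional \<open>U\<close>.\<close>
    also have "iexp (\<beta> * c) * complex_of_real (exp (- \<beta>\<^sup>2 / 2)) * complex_of_real (exp (- ((LINT x|cube_measure. (u x)\<^sup>2) - \<beta>\<^sup>2) / 2))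
       = iexp (c * \<beta>) * complex_of_real (exp (- (LINT x|cube_measure. (u x)\<^sup>2) / 2))"
    proof -
      have "exp (- \<beta>\<^sup>2 / 2) * exp (- ((LINT x|cube_measure. (u x)\<^sup>2) - \<beta>\<^sup>2) / 2) = exp (- (LINT x|cube_measure. (u x)\<^sup>2) / 2)"
        unfolding exp_add[symmetric] by (simp add: field_simps)
      then show ?thesis unfolding mult.assoc of_real_mult[symmetric] by (simp add: mult.commute)
    qed
    also have "\<dots> = iexp (c * \<beta>) * (LINT \<omega>|M. iexp (U \<omega>))"
      using wiener_integral_facts(6)[OF U] by simp
    also have "\<dots> = (LINT \<omega>|M. iexp (c * \<beta> + U \<omega>))"
      unfolding iexp_add by (rule integral_mult_right_zero[symmetric])
    also have "\<dots> = (LINT y|N1. iexp (\<Sum>k\<in>K. a k * y k))"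
    proof -
      have "(LINT y|N1. iexp (\<Sum>k\<in>K. a k * y k)) = (LINT \<omega>|M. iexp (\<Sum>k\<in>K. a k * (\<lambda>t\<in>unit_cube. W t \<omega> + c * b t) k))"
        unfolding N1_def by (rule integral_distr[OF m1 iexpm])
      also have "\<dots> = (LINT \<omega>|M. iexp (c * \<beta> + U \<omega>))"
      proof (intro Bochner_Integration.integral_cong refl arg_cong[where f=iexp])
        fix \<omega>
        have "(\<Sum>k\<in>K. a k * (\<lambda>t\<in>unit_cube. W t \<omega> + c * b t) k) = (\<Sum>k\<in>K. a k * W k \<omega> + c * (a k * b k))"
          using K by (intro sum.cong) (auto simp: algebra_simps)
        then show "(\<Sum>k\<in>K. a k * (\<lambda>t\<in>unit_cube. W t \<omega> + c * b t) k) = c * \<beta> + U \<omega>"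
          by (simp add: U_def \<beta> sum.distrib sum_distrib_left)
      qed
      finally show ?thesis ..
    qed
    finally show "(LINT y|N1. iexp (\<Sum>k\<in>K. a k * y k)) = (LINT y|N2. iexp (\<Sum>k\<in>K. a k * y k))" ..
  qed (simp_all add: N1_def N2_def)
  have "(LINT \<omega>|M. \<phi> (\<lambda>t\<in>unit_cube. W t \<omega> + c * b t)) = (LINT y|N1. \<phi> y)"
    unfolding N1_def by (rule integral_distr[OF m1 \<phi>, symmetric])
  also have "\<dots> = (LINT \<omega>|density M L. \<phi> (\<lambda>t\<in>unit_cube. W t \<omega>))"
    unfolding \<open>N1 = N2\<close> N2_def by (rule integral_distr[OF _ \<phi>]) (simp add: m2)
  also have "\<dots> = (LINT \<omega>|M. L \<omega> *\<^sub>R \<phi> (\<lambda>t\<in>unit_cube. W t \<omega>))"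
    by (subst integral_density) (auto simp: L_def)
  finally show ?thesis by (simp add: b_def L_def)
qed

end

section \<open>Rectangle signals\<close>

lemma scaled_cube_kernel:
  fixes t h :: "real ^ 'd"
  assumes "h \<in> bandwidths"
  shows "scaled_kernel cube_kernel t h = indicator (cbox (t - h) (t + h))"
proof
  fix x
  have "(- 1 \<le> (x $ i - t $ i) / h $ i \<and> (x $ i - t $ i) / h $ i \<le> 1) \<longleftrightarrow> (t $ i - h $ i \<le> x $ i \<and> x $ i \<le> t $ i + h $ i)" for i
  proof -
    have "0 < h $ i" using assms by (simp add: bandwidths_def)
    then show ?thesis by (auto simp: field_simps)
  qed
  then show "scaled_kernel cube_kernel t h x = indicator (cbox (t - h) (t + h)) x"
    by (simp add: scaled_kernel_def cube_kernel_def indicator_def mem_box_cart)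
qed

lemma kernel_norm_cube_kernel: "kernel_norm (cube_kernel :: real ^ 'd \<Rightarrow> real) = sqrt (2 ^ CARD('d))"
proof -
  have sq: "(cube_kernel x)\<^sup>2 = indicator (cbox (- 1) 1) x" for x :: "real ^ 'd"
    by (simp add: cube_kernel_def indicator_def)
  have "(LINT x|lborel. (cube_kernel (x :: real ^ 'd))\<^sup>2) = (LINT x|lborel. indicator (cbox (- 1) (1 :: real ^ 'd)) x)"
    unfolding sq ..
  also have "\<dots> = measure lborel (cbox (- 1) (1 :: real ^ 'd))" by simp
  also have "\<dots> = 2 ^ CARD('d)"
    using measure_cbox_Int_cbox[of "- 1 :: real ^ 'd" 1 "- 1" 1] by simp
  finally show ?thesis by (simp add: kernel_norm_def)
qed

lemma rect_volume_bounds: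
  fixes h :: "real ^ 'd"
  assumes "h \<in> bandwidths"
  shows "0 < rect_volume h" "rect_volume h \<le> 1"
proof -
  have h: "0 < h $ i" "h $ i \<le> 1 / 2" for i using assms by (auto simp: bandwidths_def)
  show "0 < rect_volume h" unfolding rect_volume_def using h by (auto intro!: mult_pos_pos prod_pos)
  have "rect_volume h = (\<Prod>i\<in>UNIV. 2 * h $ i)" by (simp add: rect_volume_def prod.distrib)
  also have "\<dots> \<le> 1"
  proof (rule prod_le_1)
    show "0 \<le> 2 * h $ i \<and> 2 * h $ i \<le> 1" for i using h[of i] by simp
  qed
  finally show "rect_volume h \<le> 1" .
qed

lemma centers_rect:
  fixes t h :: "real ^ 'd"
  assumes "h \<in> bandwidths" "t \<in> centers h"
  shows "cbox (t - h) (t + h) \<subseteq> unit_cube" "measure lborel (cbox (t - h) (t + h)) = rect_volume h"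
proof -
  have "cbox (t - h) (t + h) \<in> closed_rects h" using assms by (auto simp: closed_rects_def)
  then show "cbox (t - h) (t + h) \<subseteq> unit_cube" "measure lborel (cbox (t - h) (t + h)) = rect_volume h"
    using closed_rects_subset_unit_cube measure_closed_rects assms by blast+
qed

text \<open>The faces form a null set, which reduces open hyperrectangles to closed ones
  throughout.\<close>

lemma measure_Int_box_eq_cbox:
  fixes a b :: "real ^ 'd"
  assumes "A \<in> sets borel"
  shows "measure lborel (A \<inter> box a b) = measure lborel (A \<inter> cbox a b)"
proof -
  have "cbox a b - box a b \<in> null_sets lborel"
  proof -
    have "emeasure lborel (cbox a b - box a b) = emeasure lborel (cbox a b) - emeasure lborel (box a b)"
      using emeasure_lborel_box_finite[of a b] by (intro emeasure_Diff) (auto simp: box_subset_cbox)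
    also have "\<dots> = 0" by (simp add: emeasure_lborel_box_eq emeasure_lborel_cbox_eq)
    finally show ?thesis by auto
  qed
  then have "A \<inter> (cbox a b - box a b) \<in> null_sets lborel"
    using assms by (intro null_set_Int1) auto
  moreover have "A \<inter> cbox a b = (A \<inter> box a b) \<union> A \<inter> (cbox a b - box a b)"
    using box_subset_cbox[of a b] by auto
  ultimately show ?thesis
    using assms by (simp add: measure_Un_null_set)
qed

lemma hyperrectangle_measures:
  fixes t h :: "real ^ 'd"
  assumes B: "B = cbox (t - h) (t + h) \<or> B = box (t - h) (t + h)" and A: "A \<in> sets borel"
  shows "measure lborel (A \<inter> B) = measure lborel (A \<inter> cbox (t - h) (t + h))"
  using B measure_Int_box_eq_cbox[OF A] by auto

text \<open>A bound uniform in \<open>r\<close> makes the critical value times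
  \<open>scale_D r\<close> a fixed finite threshold. With \<open>y = ln (1 / r)\<close>, the
  constant 4 comes from \<open>ln z <= 2 * sqrt z\<close> at \<open>z = exp 1 + y\<close> and from
  \<open>exp 1 + y <= 4 * (1 + y)\<close>.\<close>

lemma scale_D_bounds:
  assumes "0 < r" "r \<le> 1"
  shows "0 < scale_D r" "scale_D r \<le> 4"
proof -
  define y where "y = ln (1 / r)"
  have y: "0 \<le> y" unfolding y_def using assms by simp
  have e1: "ln (exp 1 / r) = 1 + y" and e2: "ln (exp (exp 1) / r) = exp 1 + y"
    unfolding y_def using assms by (simp_all add: ln_div)
  have ge: "1 < exp (1 :: real) + y" using y exp_gt_one[of "1 :: real"] by linarith
  show "0 < scale_D r" unfolding scale_D_def e1 e2 using y ge by (intro divide_pos_pos) auto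
  have "ln (exp 1 + y) = 2 * ln (sqrt (exp 1 + y))"
    using ge by (simp add: ln_sqrt)
  also have "\<dots> \<le> 2 * sqrt (exp 1 + y)"
    using ge ln_le_minus_one[of "sqrt (exp 1 + y)"] by simp
  also have "\<dots> \<le> 2 * sqrt (4 * (1 + y))"
    using exp_le y by (intro mult_left_mono real_sqrt_le_mono) auto
  also have "\<dots> = 4 * sqrt (1 + y)" by (simp only: real_sqrt_mult real_sqrt_four)
  finally show "scale_D r \<le> 4"
    unfolding scale_D_def e1 e2 using y by (simp add: pos_divide_le_eq)
qed

text \<open>A strict inequality at one parameter persists on a relative neighbourhood, which meets a
  countable dense subset; the uncountable union of events thus becomes a countable one.\<close>

lemma exists_greater_measurable:
  fixes F :: "'p :: {metric_space, second_countable_topology} \<Rightarrow> 'w \<Rightarrow> real"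
  assumes meas: "\<And>p. p \<in> S \<Longrightarrow> F p \<in> borel_measurable M"
    and cont: "\<And>\<omega>. \<omega> \<in> space M \<Longrightarrow> continuous_on S (\<lambda>p. F p \<omega>)"
  shows "{\<omega> \<in> space M. \<exists>p\<in>S. \<kappa> < F p \<omega>} \<in> sets M"
proof -
  obtain D where D: "countable D" "D \<subseteq> S" "S \<subseteq> closure D"
    by (rule separable)
  have "(\<exists>p\<in>S. \<kappa> < F p \<omega>) \<longleftrightarrow> (\<exists>p\<in>D. \<kappa> < F p \<omega>)" if "\<omega> \<in> space M" for \<omega>
  proof
    assume "\<exists>p\<in>S. \<kappa> < F p \<omega>"
    then obtain p where p: "p \<in> S" "\<kappa> < F p \<omega>" by blast
    have "openin (top_of_set S) (S \<inter> (\<lambda>p. F p \<omega>) -` {\<kappa><..})"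
      by (rule continuous_openin_preimage_gen[OF cont[OF that]]) simp
    then obtain T where T: "open T" "S \<inter> (\<lambda>p. F p \<omega>) -` {\<kappa><..} = S \<inter> T"
      by (auto simp: openin_open)
    have "p \<in> T \<inter> closure D" using p T(2) D(3) by auto
    then have "T \<inter> D \<noteq> {}" using open_Int_closure_eq_empty[OF T(1)] by blast
    then show "\<exists>p\<in>D. \<kappa> < F p \<omega>" using T(2) D(2) by blast
  qed (use D in blast)
  then have "{\<omega> \<in> space M. \<exists>p\<in>S. \<kappa> < F p \<omega>} = (\<Union>p\<in>D. {\<omega> \<in> space M. \<kappa> < F p \<omega>})"
    by blast
  also have "\<dots> \<in> sets M"
  proof (rule sets.countable_UN''[OF D(1)])
    show "{\<omega> \<in> space M. \<kappa> < F p \<omega>} \<in> sets M" if "p \<in> D" for p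
    proof -
      have [measurable]: "F p \<in> borel_measurable M" using meas that D(2) by blast
      show ?thesis by measurable
    qed
  qed
  finally show ?thesis .
qed

section \<open>Normalised noise over rectangles and the local statistic\<close>

locale multiscale_space = sheet_space M W for M :: "'w measure" and W :: "real ^ 'd \<Rightarrow> 'w \<Rightarrow> real" +
  fixes X :: "real ^ 'd \<Rightarrow> real ^ 'd \<Rightarrow> 'w \<Rightarrow> real"
  assumes version: "continuous_wiener_version M W cube_kernel X"
begin

lemma X_wiener:
  assumes "h \<in> bandwidths" "t \<in> centers h"
  shows "has_wiener_integral M W (indicator (cbox (t - h) (t + h))) (X t h)"
proof -
  have "(t, h) \<in> scale_space" using assms by (simp add: scale_space_def)
  then have "has_wiener_integral M W (scaled_kernel cube_kernel t h) (X t h)"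
    using version unfolding continuous_wiener_version_def by blast
  then show ?thesis by (simp add: scaled_cube_kernel[OF assms(1)])
qed

definition \<xi> :: "real ^ 'd \<Rightarrow> real ^ 'd \<Rightarrow> 'w \<Rightarrow> real" where
  "\<xi> t h \<omega> = X t h \<omega> / sqrt (rect_volume h)"

definition unit_rect :: "real ^ 'd \<Rightarrow> real ^ 'd \<Rightarrow> real ^ 'd \<Rightarrow> real" where
  "unit_rect t h x = indicator (cbox (t - h) (t + h)) x / sqrt (rect_volume h)"

lemma \<xi>_wiener:
  assumes "h \<in> bandwidths" "t \<in> centers h"
  shows "has_wiener_integral M W (unit_rect t h) (\<xi> t h)"
  using wiener_integral_linear[OF X_wiener[OF assms] X_wiener[OF assms], of "1 / sqrt (rect_volume h)" 0]
  by (simp add: unit_rect_def[abs_def] \<xi>_def[abs_def])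

text \<open>For \<open>A = cbox 0 s\<close> this is the drift of the Cameron-Martin shift; for
  another rectangle it gives the inner products that decide independence.\<close>

lemma integral_unit_rect_mult:
  assumes "h \<in> bandwidths" "t \<in> centers h" "A \<in> sets borel"
  shows "(LINT x|cube_measure. indicator A x * unit_rect t h x) =
    measure lborel (A \<inter> cbox (t - h) (t + h)) / sqrt (rect_volume h)"
proof -
  have "(LINT x|cube_measure. indicator A x * unit_rect t h x)
      = (LINT x|cube_measure. indicator (A \<inter> cbox (t - h) (t + h)) x / sqrt (rect_volume h))"
    by (simp add: unit_rect_def indicator_inter_arith)
  also have "\<dots> = (LINT x|cube_measure. indicator (A \<inter> cbox (t - h) (t + h)) x) / sqrt (rect_volume h)"
    by (rule integral_divide_zero)
  also have "(LINT x|cube_measure. indicator (A \<inter> cbox (t - h) (t + h)) x :: real) = measure lborel (A \<inter> cbox (t - h) (t + h))"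
    using centers_rect(1)[OF assms(1,2)] assms(3) by (intro integral_cube_measure_indicator) auto
  finally show ?thesis .
qed

lemma inner_unit_rect:
  assumes "h \<in> bandwidths" "t \<in> centers h" "s \<in> centers h"
  shows "(LINT x|cube_measure. unit_rect s h x * unit_rect t h x) =
    measure lborel (cbox (s - h) (s + h) \<inter> cbox (t - h) (t + h)) / rect_volume h"
proof -
  have "(LINT x|cube_measure. unit_rect s h x * unit_rect t h x)
      = (LINT x|cube_measure. indicator (cbox (s - h) (s + h)) x * unit_rect t h x / sqrt (rect_volume h))"
    by (simp add: unit_rect_def[of s])
  also have "\<dots> = measure lborel (cbox (s - h) (s + h) \<inter> cbox (t - h) (t + h)) / sqrt (rect_volume h) / sqrt (rect_volume h)"
    by (simp only: integral_divide_zero integral_unit_rect_mult[OF assms(1,2)] borel_closed closed_cbox)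
  finally show ?thesis using rect_volume_bounds(1)[OF assms(1)] by simp
qed

lemma norm_unit_rect:
  assumes "h \<in> bandwidths" "t \<in> centers h"
  shows "(LINT x|cube_measure. (unit_rect t h x)\<^sup>2) = 1"
  using inner_unit_rect[OF assms assms(2)] centers_rect(2)[OF assms] rect_volume_bounds(1)[OF assms(1)]
  by (simp add: power2_eq_square)

lemma \<xi>_measurable:
  assumes "h \<in> bandwidths" "t \<in> centers h"
  shows "\<xi> t h \<in> borel_measurable M"
  by (rule wiener_integral_facts(1)[OF \<xi>_wiener[OF assms]])

lemma prob_\<xi>_ge:
  assumes "h \<in> bandwidths" "t \<in> centers h" "0 < K"
  shows "prob {\<omega>\<in>space M. K \<le> \<bar>\<xi> t h \<omega>\<bar>} \<le> 1 / K\<^sup>2"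
  using prob_abs_ge_le_second_moment[OF wiener_integral_facts(1,3)[OF \<xi>_wiener[OF assms(1,2)]] assms(3)]
  by (simp add: wiener_integral_facts(5)[OF \<xi>_wiener[OF assms(1,2)]] norm_unit_rect[OF assms(1,2)])

lemma test_expectation_rect_signal:
  assumes ht: "h \<in> bandwidths" "t \<in> centers h"
    and B: "B = cbox (t - h) (t + h) \<or> B = box (t - h) (t + h)"
    and \<phi>: "is_test \<phi>" and c: "c = \<mu> * sqrt (real n * rect_volume h)"
  shows "test_expectation M W n (rect_signal \<mu> B) \<phi> =
    (LINT \<omega>|M. exp (c * \<xi> t h \<omega> - c\<^sup>2 / 2) * \<phi> (\<lambda>s\<in>unit_cube. W s \<omega>))"
proof -
  have Bb: "B \<in> sets borel" using B by auto
  \<comment> \<open>The drift \<open>sqrt n * \<mu> * |A|\<close> of the observation, with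
    \<open>A\<close> the overlap of \<open>cbox 0 s\<close> and the rectangle, equals
    \<open>c * |A| / sqrt r\<close>; hence the signed strength
    \<open>c = \<mu> * sqrt (n * r)\<close>.\<close>
  have shift: "observation W n (rect_signal \<mu> B) s \<omega> = W s \<omega> + c * (LINT x|cube_measure. indicator (cbox 0 s) x * unit_rect t h x)" for s \<omega>
  proof -
    have "(LINT x:cbox 0 s|lborel. rect_signal \<mu> B x) = (LINT x|lborel. \<mu> * indicator (cbox 0 s \<inter> B) x)"
      unfolding set_lebesgue_integral_def rect_signal_def
      by (intro Bochner_Integration.integral_cong) (auto simp: indicator_def)
    also have "\<dots> = \<mu> * measure lborel (cbox 0 s \<inter> B)" using Bb by simp
    also have "measure lborel (cbox 0 s \<inter> B) = measure lborel (cbox 0 s \<inter> cbox (t - h) (t + h))"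
      by (rule hyperrectangle_measures[OF B]) simp
    finally show ?thesis
      unfolding observation_def integral_unit_rect_mult[OF ht, of "cbox 0 s", simplified]
      using rect_volume_bounds(1)[OF ht(1)] by (simp add: c real_sqrt_mult)
  qed
  have \<phi>m: "\<phi> \<in> borel_measurable (Pi\<^sub>M unit_cube (\<lambda>_. borel))" using \<phi> by (simp add: is_test_def)
  show ?thesis
    unfolding test_expectation_def shift
    by (rule cameron_martin[OF \<xi>_wiener[OF ht] norm_unit_rect[OF ht] \<phi>m])
qed

text \<open>The squared norm \<open>2 ^ CARD('d)\<close> of the kernel and the product of the
  bandwidths combine to the volume of the window, so the noise part is \<open>\<xi>\<close>.\<close>

lemma local_stat_rect_signal:
  assumes "h' \<in> bandwidths" "t' \<in> centers h'"
    and B: "B = cbox (t - h) (t + h) \<or> B = box (t - h) (t + h)"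
  shows "local_stat cube_kernel (kernel_integral_Y cube_kernel X n (rect_signal \<mu> B)) t' h' \<omega> =
    (sqrt (real n) * \<mu> * measure lborel (cbox (t' - h') (t' + h') \<inter> cbox (t - h) (t + h)) + X t' h' \<omega>) / sqrt (rect_volume h')"
proof -
  have Bb: "B \<in> sets borel" using B by auto
  have "(LINT x:unit_cube|lborel. scaled_kernel cube_kernel t' h' x * rect_signal \<mu> B x) =
      (LINT x|lborel. \<mu> * indicator (cbox (t' - h') (t' + h') \<inter> B) x)"
    unfolding set_lebesgue_integral_def rect_signal_def scaled_cube_kernel[OF assms(1)]
    using centers_rect(1)[OF assms(1,2)]
    by (intro Bochner_Integration.integral_cong) (auto simp: indicator_def)
  also have "\<dots> = \<mu> * measure lborel (cbox (t' - h') (t' + h') \<inter> B)" using Bb by simp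
  also have "measure lborel (cbox (t' - h') (t' + h') \<inter> B) = measure lborel (cbox (t' - h') (t' + h') \<inter> cbox (t - h) (t + h))"
    by (rule hyperrectangle_measures[OF B]) simp
  finally show ?thesis
    unfolding local_stat_def kernel_integral_Y_def kernel_norm_cube_kernel
    by (simp add: rect_volume_def real_sqrt_mult mult.commute)
qed

text \<open>Bounding the rejection probability below by monotonicity requires the rejection set to
  be an event. The sample-path continuity of \<open>X\<close> supplies this.\<close>

lemma rejection_event_measurable:
  assumes B: "B = cbox (t - h) (t + h) \<or> B = box (t - h) (t + h)"
  shows "{\<omega> \<in> space M. ereal \<kappa> < multiscale_stat cube_kernel (kernel_integral_Y cube_kernel X n (rect_signal \<mu> B)) \<omega>} \<in> sets M"
proof -
  \<comment> \<open>The overlap is written as an explicit product, which makes continuity of the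
    signal part in the pair \<open>p\<close> of centre and bandwidth evident.\<close>
  define F where "F p \<omega> = (\<bar>(sqrt (real n) * \<mu> * (\<Prod>i\<in>UNIV. max 0 (min (fst p $ i + snd p $ i) (t $ i + h $ i) - max (fst p $ i - snd p $ i) (t $ i - h $ i)))
       + X (fst p) (snd p) \<omega>) / sqrt (rect_volume (snd p))\<bar>
       - scale_Gamma (rect_volume (snd p))) / scale_D (rect_volume (snd p))" for p \<omega>
  have F: "F (t', h') \<omega> = (\<bar>local_stat cube_kernel (kernel_integral_Y cube_kernel X n (rect_signal \<mu> B)) t' h' \<omega>\<bar>
      - scale_Gamma (rect_volume h')) / scale_D (rect_volume h')" if "h' \<in> bandwidths" "t' \<in> centers h'" for t' h' \<omega>
    unfolding F_def local_stat_rect_signal[OF that B] measure_cbox_Int_cbox by simp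
  have "{\<omega> \<in> space M. ereal \<kappa> < multiscale_stat cube_kernel (kernel_integral_Y cube_kernel X n (rect_signal \<mu> B)) \<omega>}
     = {\<omega> \<in> space M. \<exists>p\<in>scale_space. \<kappa> < F p \<omega>}"
    unfolding multiscale_stat_def less_SUP_iff scale_space_def using F by fastforce
  also have "\<dots> \<in> sets M"
  proof (rule exists_greater_measurable)
    fix p :: "(real ^ 'd) \<times> (real ^ 'd)" assume "p \<in> scale_space"
    then have "X (fst p) (snd p) \<in> borel_measurable M"
      using wiener_integral_facts(1)[OF X_wiener] by (auto simp: scale_space_def)
    then show "F p \<in> borel_measurable M" unfolding F_def[abs_def] by measurable
  next
    fix \<omega> assume "\<omega> \<in> space M"
    then have cX: "continuous_on scale_space (\<lambda>p. X (fst p) (snd p) \<omega>)"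
      using version unfolding continuous_wiener_version_def by (simp add: case_prod_beta')
    have cv: "continuous_on scale_space (\<lambda>p :: (real ^ 'd) \<times> (real ^ 'd). rect_volume (snd p))"
      unfolding rect_volume_def by (intro continuous_intros)
    have v: "0 < rect_volume (snd p)" "rect_volume (snd p) \<le> 1" if "p \<in> scale_space" for p :: "(real ^ 'd) \<times> (real ^ 'd)"
      using that rect_volume_bounds by (auto simp: scale_space_def)
    have G: "continuous_on scale_space (\<lambda>p :: (real ^ 'd) \<times> (real ^ 'd). scale_Gamma (rect_volume (snd p)))"
      unfolding scale_Gamma_def using v by (intro continuous_intros cv) (force+)
    have ln1: "0 < ln (exp a / r)" if "0 < r" "r \<le> 1" "0 < a" for a r :: real
    proof -
      have "ln r \<le> 0" using that by simp
      then have "ln r < a" using that(3) by linarith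
      then show ?thesis using that by (simp add: ln_div)
    qed
    have Dc: "continuous_on scale_space (\<lambda>p :: (real ^ 'd) \<times> (real ^ 'd). scale_D (rect_volume (snd p)))"
    proof -
      have d1: "rect_volume (snd p) \<noteq> 0" "exp (exp 1) / rect_volume (snd p) \<noteq> 0" "exp 1 / rect_volume (snd p) \<noteq> 0"
        if "p \<in> scale_space" for p :: "(real ^ 'd) \<times> (real ^ 'd)"
        using v(1)[OF that] by auto
      have d2: "ln (exp (exp 1) / rect_volume (snd p)) \<noteq> 0" "sqrt (ln (exp 1 / rect_volume (snd p))) \<noteq> 0"
        if "p \<in> scale_space" for p :: "(real ^ 'd) \<times> (real ^ 'd)"
        using ln1[OF v[OF that], of "exp 1"] ln1[OF v[OF that], of 1] by auto
      show ?thesis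
        unfolding scale_D_def by (intro continuous_intros cv ballI; erule d1 d2)
    qed
    have "scale_D (rect_volume (snd p)) \<noteq> 0" if "p \<in> scale_space" for p :: "(real ^ 'd) \<times> (real ^ 'd)"
      using scale_D_bounds(1)[OF v[OF that]] by simp
    moreover have "sqrt (rect_volume (snd p)) \<noteq> 0" if "p \<in> scale_space" for p :: "(real ^ 'd) \<times> (real ^ 'd)"
      using v[OF that] by simp
    ultimately show "continuous_on scale_space (\<lambda>p. F p \<omega>)"
      unfolding F_def by (intro continuous_intros cX cv G Dc ballI) auto
  qed
  finally show ?thesis .
qed

text \<open>The slack \<open>s\<close> is what the signal leaves after the penalty and the
  worst-case threshold, where the factor 4 is the bound on \<open>scale_D\<close>. Failure to reject
  forces \<open>|\<xi> t h| >= s\<close>, which has probability at most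
  \<open>1 / s^2\<close>.\<close>

lemma rejection_prob_ge:
  assumes ht: "h \<in> bandwidths" "t \<in> centers h"
    and B: "B = cbox (t - h) (t + h) \<or> B = box (t - h) (t + h)"
    and s: "s = signal_strength n \<mu> B - scale_Gamma (rect_volume h) - 4 * \<bar>critical_value M cube_kernel X \<alpha>\<bar>" "0 < s"
  shows "1 - 1 / s\<^sup>2 \<le> rejection_prob M cube_kernel X \<alpha> n (rect_signal \<mu> B)"
proof -
  let ?\<kappa> = "critical_value M cube_kernel X \<alpha>" and ?r = "rect_volume h"
  let ?Z = "kernel_integral_Y cube_kernel X n (rect_signal \<mu> B)"
  let ?E = "{\<omega> \<in> space M. ereal ?\<kappa> < multiscale_stat cube_kernel ?Z \<omega>}"
  note r = rect_volume_bounds[OF ht(1)]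
  note [measurable] = \<xi>_measurable[OF ht]
  have E: "?E \<in> sets M" by (rule rejection_event_measurable[OF B])
  have mB: "measure lborel B = ?r"
    using hyperrectangle_measures[OF B, of UNIV] centers_rect(2)[OF ht] by simp
  have sub: "{\<omega>\<in>space M. \<not> s \<le> \<bar>\<xi> t h \<omega>\<bar>} \<subseteq> ?E"
  proof safe
    fix \<omega> assume \<omega>: "\<omega> \<in> space M" "\<not> s \<le> \<bar>\<xi> t h \<omega>\<bar>"
    have "local_stat cube_kernel ?Z t h \<omega> = \<mu> * sqrt (real n * ?r) + \<xi> t h \<omega>"
    proof -
      have rs: "?r / sqrt ?r = sqrt ?r" using r by (simp add: real_div_sqrt)
      have "(sqrt (real n) * \<mu> * ?r + X t h \<omega>) / sqrt ?r = \<mu> * (sqrt (real n) * (?r / sqrt ?r)) + X t h \<omega> / sqrt ?r"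
        by (simp add: add_divide_distrib)
      then show ?thesis
        unfolding local_stat_rect_signal[OF ht B] Int_absorb centers_rect(2)[OF ht] \<xi>_def rs real_sqrt_mult .
    qed
    moreover have "\<bar>\<mu> * sqrt (real n * ?r)\<bar> = signal_strength n \<mu> B"
      using r by (simp add: signal_strength_def mB abs_mult)
    ultimately have "4 * \<bar>?\<kappa>\<bar> < \<bar>local_stat cube_kernel ?Z t h \<omega>\<bar> - scale_Gamma ?r"
      using \<omega>(2) s(1) by linarith
    moreover have "?\<kappa> * scale_D ?r \<le> 4 * \<bar>?\<kappa>\<bar>"
    proof -
      have "?\<kappa> * scale_D ?r \<le> \<bar>?\<kappa>\<bar> * 4"
        using scale_D_bounds[OF r] by (intro mult_mono) auto
      then show ?thesis by simp
    qed
    ultimately have "?\<kappa> < (\<bar>local_stat cube_kernel ?Z t h \<omega>\<bar> - scale_Gamma ?r) / scale_D ?r"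
      using scale_D_bounds(1)[OF r] by (simp add: pos_less_divide_eq)
    then show "ereal ?\<kappa> < multiscale_stat cube_kernel ?Z \<omega>"
      unfolding multiscale_stat_def less_SUP_iff using ht by force
  qed
  have "1 - 1 / s\<^sup>2 \<le> 1 - prob {\<omega>\<in>space M. s \<le> \<bar>\<xi> t h \<omega>\<bar>}"
    using prob_\<xi>_ge[OF ht s(2)] by simp
  also have "\<dots> = prob {\<omega>\<in>space M. \<not> s \<le> \<bar>\<xi> t h \<omega>\<bar>}"
    by (subst prob_neg) auto
  also have "\<dots> \<le> prob ?E" by (rule finite_measure_mono[OF sub E])
  finally show ?thesis by (simp add: rejection_prob_def)
qed

end

lemma hyperrectangleE:
  fixes B :: "(real ^ 'd) set"
  assumes "B \<in> hyperrectangles"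
  obtains h t where "h \<in> bandwidths" "t \<in> centers h" "B = cbox (t - h) (t + h) \<or> B = box (t - h) (t + h)"
    "measure lborel B = rect_volume h"
proof -
  obtain h t where ht: "h \<in> bandwidths" "t \<in> centers h" and B: "B = cbox (t - h) (t + h) \<or> B = box (t - h) (t + h)"
    using assms by (auto simp: hyperrectangles_def)
  have "measure lborel B = rect_volume h"
    using hyperrectangle_measures[OF B, of UNIV] centers_rect(2)[OF ht] by simp
  with ht B show thesis by (rule that)
qed

lemma rect_volume_tendsto_0:
  fixes h :: "nat \<Rightarrow> real ^ 'd"
  assumes "(\<lambda>n. \<Prod>i\<in>UNIV. h n $ i) \<longlonglongrightarrow> 0"
  shows "(\<lambda>n. rect_volume (h n)) \<longlonglongrightarrow> 0"
  using tendsto_mult_left[OF assms, of "2 ^ CARD('d)"] by (simp add: rect_volume_def)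

section \<open>A grid of essentially disjoint translates\<close>

text \<open>A grid of spacing \<open>2 * h $ i\<close> fits the integer part of
  \<open>1 / (2 * h $ i)\<close> translates along axis \<open>i\<close>, and distinct ones meet at
  most in faces. The integer part of a number that is at least 1 is at least half of it, which costs
  a factor 2 per axis and explains \<open>2 ^ CARD('d)\<close>.\<close>

lemma packing_of_rects:
  fixes h :: "real ^ 'd"
  assumes h: "h \<in> bandwidths"
  shows "\<exists>(I :: ('d \<Rightarrow> nat) set) (t :: ('d \<Rightarrow> nat) \<Rightarrow> real ^ 'd).
    finite I \<and> (\<forall>j\<in>I. t j \<in> centers h) \<and>
    (\<forall>i\<in>I. \<forall>j\<in>I. i \<noteq> j \<longrightarrow> measure lborel (cbox (t i - h) (t i + h) \<inter> cbox (t j - h) (t j + h)) = 0) \<and>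
    1 \<le> real (card I) * 2 ^ CARD('d) * rect_volume h"
proof -
  have hi: "0 < h $ i" "h $ i \<le> 1 / 2" for i using h by (auto simp: bandwidths_def)
  define N where "N i = nat \<lfloor>1 / (2 * h $ i)\<rfloor>" for i
  have N: "real (N i) \<le> 1 / (2 * h $ i)" "1 / (4 * h $ i) \<le> real (N i)" for i
  proof -
    have ge: "1 \<le> 1 / (2 * h $ i)" using hi[of i] by (simp add: pos_le_divide_eq)
    then have fl: "1 \<le> \<lfloor>1 / (2 * h $ i)\<rfloor>" by simp
    have r: "real (N i) = of_int \<lfloor>1 / (2 * h $ i)\<rfloor>" unfolding N_def by (rule of_nat_nat) (use fl in linarith)
    show "real (N i) \<le> 1 / (2 * h $ i)" unfolding r by (rule of_int_floor_le)
    have "1 / (2 * h $ i) < real (N i) + 1" unfolding r by (rule real_of_int_floor_add_one_gt)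
    moreover have "1 \<le> real (N i)" unfolding r using fl by simp
    ultimately have "1 / (2 * h $ i) \<le> 2 * real (N i)" by linarith
    then show "1 / (4 * h $ i) \<le> real (N i)" by simp
  qed
  define I where "I = (\<Pi>\<^sub>E i\<in>UNIV. {..<N i})"
  \<comment> \<open>Centres at odd multiples of \<open>h $ i\<close>, so that the first translate
    starts at the face 0 of the cube.\<close>
  define t where "t j = (\<chi> i. h $ i * (2 * real (j i) + 1))" for j :: "'d \<Rightarrow> nat"
  show ?thesis
  proof (intro exI[of _ I] exI[of _ t] conjI ballI impI)
    show "finite I" unfolding I_def by (intro finite_PiE) auto
    show "t j \<in> centers h" if "j \<in> I" for j
    proof -
      have "h $ i \<le> h $ i * (2 * real (j i) + 1) \<and> h $ i * (2 * real (j i) + 1) \<le> 1 - h $ i" for i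
      proof
        show "h $ i \<le> h $ i * (2 * real (j i) + 1)" using hi[of i] by (simp add: distrib_left)
        have "j i < N i" using that by (auto simp: I_def PiE_iff)
        then have "real (j i) + 1 \<le> 1 / (2 * h $ i)" using N(1)[of i] by linarith
        then have "(real (j i) + 1) * (2 * h $ i) \<le> 1" using hi[of i] by (simp add: pos_le_divide_eq)
        then show "h $ i * (2 * real (j i) + 1) \<le> 1 - h $ i" by (simp add: algebra_simps)
      qed
      then show ?thesis by (simp add: centers_def t_def)
    qed
    show "measure lborel (cbox (t i - h) (t i + h) \<inter> cbox (t j - h) (t j + h)) = 0" if ij: "i \<noteq> j" for i j
    proof -
      from ij obtain k where k: "i k \<noteq> j k" by (auto simp: fun_eq_iff)
      have apart: "h $ k * (2 * real a + 1) + h $ k \<le> h $ k * (2 * real b + 1) - h $ k" if "a < b" for a b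
      proof -
        have "h $ k * (2 * real a + 2) \<le> h $ k * (2 * real b)" using that hi[of k] by (intro mult_left_mono) auto
        then show ?thesis by (simp add: algebra_simps)
      qed
      have "min ((t i + h) $ k) ((t j + h) $ k) - max ((t i - h) $ k) ((t j - h) $ k) \<le> 0"
        using k apart[of "i k" "j k"] apart[of "j k" "i k"] by (cases "i k < j k") (auto simp: t_def)
      then show ?thesis
        unfolding measure_cbox_Int_cbox by (intro prod_zero bexI[of _ k]) auto
    qed
    have "1 = (\<Prod>i\<in>UNIV. 1 / (4 * h $ i)) * 2 ^ CARD('d) * rect_volume h"
    proof -
      have "(\<Prod>i\<in>UNIV. 1 / (4 * h $ i)) * 2 ^ CARD('d) * rect_volume h = (\<Prod>i\<in>UNIV. (1 / (4 * h $ i)) * 2 * 2 * h $ i)"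
        unfolding rect_volume_def by (simp only: prod.distrib prod_constant mult.assoc)
      also have "\<dots> = 1"
      proof (rule prod.neutral, rule ballI)
        show "(1 / (4 * h $ i)) * 2 * 2 * h $ i = 1" for i using hi[of i] by (simp add: field_simps)
      qed
      finally show ?thesis ..
    qed
    also have "\<dots> \<le> real (card I) * 2 ^ CARD('d) * rect_volume h"
    proof -
      have "(\<Prod>i\<in>UNIV. 1 / (4 * h $ i)) \<le> (\<Prod>i\<in>UNIV. real (N i))"
        using N(2) hi by (intro prod_mono) (auto simp: less_imp_le)
      also have "\<dots> = real (card I)" by (simp add: I_def card_PiE)
      finally show ?thesis
        using rect_volume_bounds(1)[OF h] by (intro mult_right_mono) auto
    qed
    finally show "1 \<le> real (card I) * 2 ^ CARD('d) * rect_volume h" .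
  qed
qed

section \<open>Bounds on the power of tests\<close>

context multiscale_space
begin

lemma test_facts:
  assumes "is_test \<phi>"
  shows "(\<lambda>\<omega>. \<phi> (\<lambda>s\<in>unit_cube. W s \<omega>)) \<in> borel_measurable M"
    and "0 \<le> \<phi> (\<lambda>s\<in>unit_cube. W s \<omega>)" "\<phi> (\<lambda>s\<in>unit_cube. W s \<omega>) \<le> 1"
    and "integrable M (\<lambda>\<omega>. \<phi> (\<lambda>s\<in>unit_cube. W s \<omega>))"
proof -
  have \<phi>m: "\<phi> \<in> borel_measurable (Pi\<^sub>M unit_cube (\<lambda>_. borel))"
    and \<phi>01: "\<And>y. y \<in> space (Pi\<^sub>M unit_cube (\<lambda>_. borel :: real measure)) \<Longrightarrow> 0 \<le> \<phi> y \<and> \<phi> y \<le> 1"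
    using assms by (auto simp: is_test_def)
  have "(\<lambda>\<omega>. \<lambda>s\<in>unit_cube. W s \<omega>) \<in> measurable M (Pi\<^sub>M unit_cube (\<lambda>_. borel))"
    by (rule measurable_restrict) simp
  from measurable_compose[OF this \<phi>m] show m: "(\<lambda>\<omega>. \<phi> (\<lambda>s\<in>unit_cube. W s \<omega>)) \<in> borel_measurable M" .
  show b: "0 \<le> \<phi> (\<lambda>s\<in>unit_cube. W s \<omega>)" "\<phi> (\<lambda>s\<in>unit_cube. W s \<omega>) \<le> 1" for \<omega>
    using \<phi>01[of "\<lambda>s\<in>unit_cube. W s \<omega>"] by (auto simp: space_PiM)
  show "integrable M (\<lambda>\<omega>. \<phi> (\<lambda>s\<in>unit_cube. W s \<omega>))"
    by (rule integrable_const_bound[where B=1]) (use b m in auto)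
qed

lemma level_test_expectation:
  assumes "level_test M W \<alpha> n \<phi>"
  shows "(LINT \<omega>|M. \<phi> (\<lambda>s\<in>unit_cube. W s \<omega>)) \<le> \<alpha>"
  using assms by (simp add: level_test_def test_expectation_def observation_def set_lebesgue_integral_def)

lemma integrable_tilt_\<xi>:
  assumes "h \<in> bandwidths" "t \<in> centers h"
  shows "integrable M (\<lambda>\<omega>. exp (c * \<xi> t h \<omega> - c\<^sup>2 / 2))" "(LINT \<omega>|M. exp (c * \<xi> t h \<omega> - c\<^sup>2 / 2)) = 1"
  using wiener_tilt(2,3)[OF \<xi>_wiener[OF assms] norm_unit_rect[OF assms], of "\<lambda>_. 0 :: real" c] by auto

text \<open>The error probability under the alternative is the weighted integral of
  \<open>1 - \<Phi>\<close>, and the level condition gives \<open>1 - \<Phi>\<close> null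
  expectation at least \<open>1 - \<alpha>\<close>. Where \<open>|\<xi>| <= K\<close> the weight is
  at least \<open>exp (- C * K - C\<^sup>2 / 2)\<close>; the remaining event costs at most
  \<open>1 / K^2\<close>.\<close>

lemma test_expectation_le_of_bounded_signal:
  assumes ht: "h \<in> bandwidths" "t \<in> centers h"
    and B: "B = cbox (t - h) (t + h) \<or> B = box (t - h) (t + h)"
    and \<phi>: "level_test M W \<alpha> n \<phi>"
    and C: "signal_strength n \<mu> B \<le> C" and K: "0 < K"
  shows "test_expectation M W n (rect_signal \<mu> B) \<phi> \<le> 1 - exp (- C * K - C\<^sup>2 / 2) * (1 - \<alpha> - 1 / K\<^sup>2)"
proof -
  define c where "c = \<mu> * sqrt (real n * rect_volume h)"
  note r = rect_volume_bounds[OF ht(1)]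
  have mB: "measure lborel B = rect_volume h"
    using hyperrectangle_measures[OF B, of UNIV] centers_rect(2)[OF ht] by simp
  have c: "\<bar>c\<bar> \<le> C" using C r by (simp add: signal_strength_def mB c_def abs_mult)
  have it: "is_test \<phi>" using \<phi> by (simp add: level_test_def)
  define \<Phi> where "\<Phi> \<omega> = \<phi> (\<lambda>s\<in>unit_cube. W s \<omega>)" for \<omega>
  define L where "L \<omega> = exp (c * \<xi> t h \<omega> - c\<^sup>2 / 2)" for \<omega>
  define E where "E = {\<omega>\<in>space M. K \<le> \<bar>\<xi> t h \<omega>\<bar>}"
  note [measurable] = \<xi>_measurable[OF ht]
  have \<Phi>m [measurable]: "\<Phi> \<in> borel_measurable M" and \<Phi>01: "\<And>\<omega>. 0 \<le> \<Phi> \<omega>" "\<And>\<omega>. \<Phi> \<omega> \<le> 1" and \<Phi>i: "integrable M \<Phi>"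
    unfolding \<Phi>_def[abs_def] by (rule test_facts[OF it])+
  have Li: "integrable M L" and L1: "(LINT \<omega>|M. L \<omega>) = 1"
    unfolding L_def[abs_def] by (rule integrable_tilt_\<xi>[OF ht])+
  have LPi: "integrable M (\<lambda>\<omega>. L \<omega> * \<Phi> \<omega>)"
    by (rule Bochner_Integration.integrable_bound[OF Li])
       (use \<Phi>01 Li in \<open>auto simp: abs_mult intro!: mult_left_le\<close>)
  have Em: "E \<in> sets M" unfolding E_def by measurable
  have Ei: "integrable M (indicator E :: 'w \<Rightarrow> real)" using Em by (simp add: less_top[symmetric])
  \<comment> \<open>Subtracting the indicator of \<open>E\<close> makes the left side nonpositive on
    \<open>E\<close>, so no lower bound on the weight is required there.\<close>
  have pt: "exp (- C * K - C\<^sup>2 / 2) * (1 - \<Phi> \<omega> - indicator E \<omega>) \<le> L \<omega> - L \<omega> * \<Phi> \<omega>" if "\<omega> \<in> space M" for \<omega>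
  proof (cases "\<omega> \<in> E")
    case True
    have "exp (- C * K - C\<^sup>2 / 2) * (1 - \<Phi> \<omega> - indicator E \<omega>) \<le> 0"
      using True \<Phi>01[of \<omega>] by (intro mult_nonneg_nonpos) auto
    also have "0 \<le> L \<omega> * (1 - \<Phi> \<omega>)" using \<Phi>01[of \<omega>] by (simp add: L_def)
    finally show ?thesis by (simp add: right_diff_distrib)
  next
    case False
    then have "\<bar>\<xi> t h \<omega>\<bar> \<le> K" using that by (auto simp: E_def)
    then have "\<bar>c * \<xi> t h \<omega>\<bar> \<le> C * K" unfolding abs_mult using c K by (intro mult_mono) auto
    moreover have "c\<^sup>2 \<le> C\<^sup>2" using power_mono[OF c, of 2] by simp
    ultimately have "exp (- C * K - C\<^sup>2 / 2) \<le> L \<omega>" unfolding L_def by simp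
    then have "exp (- C * K - C\<^sup>2 / 2) * (1 - \<Phi> \<omega>) \<le> L \<omega> * (1 - \<Phi> \<omega>)"
      using \<Phi>01[of \<omega>] by (intro mult_right_mono) auto
    then show ?thesis using False by (simp add: right_diff_distrib)
  qed
  have "exp (- C * K - C\<^sup>2 / 2) * (1 - (LINT \<omega>|M. \<Phi> \<omega>) - prob E) = (LINT \<omega>|M. exp (- C * K - C\<^sup>2 / 2) * (1 - \<Phi> \<omega> - indicator E \<omega>))"
    using \<Phi>i Ei Em by (simp add: prob_space)
  also have "\<dots> \<le> (LINT \<omega>|M. L \<omega> - L \<omega> * \<Phi> \<omega>)"
    using \<Phi>i Ei Li LPi pt by (intro integral_mono) auto
  also have "\<dots> = 1 - test_expectation M W n (rect_signal \<mu> B) \<phi>"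
  proof -
    have "test_expectation M W n (rect_signal \<mu> B) \<phi> = (LINT \<omega>|M. L \<omega> * \<Phi> \<omega>)"
      unfolding L_def \<Phi>_def by (rule test_expectation_rect_signal[OF ht B it c_def])
    then show ?thesis using Li LPi L1 by simp
  qed
  finally have "exp (- C * K - C\<^sup>2 / 2) * (1 - (LINT \<omega>|M. \<Phi> \<omega>) - prob E) \<le> 1 - test_expectation M W n (rect_signal \<mu> B) \<phi>" .
  moreover have "exp (- C * K - C\<^sup>2 / 2) * (1 - \<alpha> - 1 / K\<^sup>2) \<le> exp (- C * K - C\<^sup>2 / 2) * (1 - (LINT \<omega>|M. \<Phi> \<omega>) - prob E)"
    using level_test_expectation[OF \<phi>] prob_\<xi>_ge[OF ht K] by (intro mult_left_mono) (auto simp: \<Phi>_def E_def)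
  ultimately show ?thesis by linarith
qed

text \<open>The likelihood ratios for disjoint rectangles are independent but have too large a variance;
  truncating each of them at \<open>\<xi> \<le> \<Gamma>\<close> loses mass \<open>o(1)\<close> and makes the variance of their average
  of order \<open>exp (- (\<epsilon> \<Gamma>)\<^sup>2)\<close>. The Chernoff factor \<open>exp ((2 c - \<Gamma>) (\<Gamma> - \<xi>))\<close> bounds the indicator of
  the truncation.\<close>

lemma INF_G_minus_le:
  assumes h: "h \<in> bandwidths" and \<phi>: "level_test M W \<alpha> n \<phi>" and n: "0 < n"
    and \<epsilon>: "0 < \<epsilon>" "\<epsilon> < 1 / 2" and r1: "rect_volume h < 1"
    and x: "x = \<epsilon> * sqrt (2 * ln (1 / rect_volume h))"
  shows "(INF f\<in>G_minus n h \<epsilon>. ereal (test_expectation M W n f \<phi>))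
    \<le> ereal (\<alpha> + 1 / x\<^sup>2 + sqrt (2 ^ CARD('d) * exp (- x\<^sup>2)))"
proof -
  define r where "r = rect_volume h"
  define \<Gamma> where "\<Gamma> = sqrt (2 * ln (1 / r))"
  define c where "c = (1 - \<epsilon>) * \<Gamma>"
  define \<mu> where "\<mu> = c / sqrt (real n * r)"
  have r: "0 < r" "r < 1" using rect_volume_bounds[OF h] r1 by (auto simp: r_def)
  have lnr: "0 < ln (1 / r)" using r by simp
  have \<Gamma>: "0 < \<Gamma>" "\<Gamma>\<^sup>2 = 2 * ln (1 / r)" unfolding \<Gamma>_def using lnr by auto
  have er: "exp (- \<Gamma>\<^sup>2 / 2) = r" unfolding \<Gamma>(2) using r by (simp add: ln_div)
  \<comment> \<open>Here \<open>\<epsilon> < 1 / 2\<close> enters: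
    \<open>2 * c - \<Gamma> >= 0\<close> gives the Chernoff factor its sign.\<close>
  have c: "0 < c" "\<Gamma> \<le> 2 * c" unfolding c_def using \<Gamma>(1) \<epsilon> by (auto simp: algebra_simps)
  have xc: "\<Gamma> - c = x" "0 < x" unfolding c_def x using \<Gamma>(1) \<epsilon> by (auto simp: \<Gamma>_def r_def algebra_simps)
  have \<mu>: "\<mu> * sqrt (real n * r) = c" "\<mu> \<noteq> 0" unfolding \<mu>_def using n r c by auto
  obtain I :: "('d \<Rightarrow> nat) set" and t where I: "finite I" and tt: "\<forall>j\<in>I. t j \<in> centers h"
    and dd: "\<forall>i\<in>I. \<forall>j\<in>I. i \<noteq> j \<longrightarrow> measure lborel (cbox (t i - h) (t i + h) \<inter> cbox (t j - h) (t j + h)) = 0"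
    and cardI: "1 \<le> real (card I) * 2 ^ CARD('d) * r"
    using packing_of_rects[OF h] unfolding r_def by blast
  note t = tt[rule_format] and disj = dd[rule_format]
  define m where "m = real (card I)"
  have m: "0 < m" using cardI by (cases "card I = 0") (auto simp: m_def)
  have it: "is_test \<phi>" using \<phi> by (simp add: level_test_def)
  define \<Phi> where "\<Phi> \<omega> = \<phi> (\<lambda>s\<in>unit_cube. W s \<omega>)" for \<omega>
  have \<Phi>m [measurable]: "\<Phi> \<in> borel_measurable M" and \<Phi>01: "\<And>\<omega>. 0 \<le> \<Phi> \<omega>" "\<And>\<omega>. \<Phi> \<omega> \<le> 1" and \<Phi>i: "integrable M \<Phi>"
    unfolding \<Phi>_def[abs_def] by (rule test_facts[OF it])+
  have \<Phi>\<alpha>: "(LINT \<omega>|M. \<Phi> \<omega>) \<le> \<alpha>" unfolding \<Phi>_def by (rule level_test_expectation[OF \<phi>])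
  have \<Phi>0: "0 \<le> (LINT \<omega>|M. \<Phi> \<omega>)" using \<Phi>01 by (intro Bochner_Integration.integral_nonneg) auto
  define l where "l y = exp (c * y - c\<^sup>2 / 2) * indicator {..\<Gamma>} y" for y :: real
  have lm [measurable]: "l \<in> borel_measurable borel" unfolding l_def by measurable
  have l0: "0 \<le> l y" for y by (simp add: l_def)
  have lb: "l y \<le> exp (c * \<Gamma>)" for y
  proof (cases "y \<le> \<Gamma>")
    case True
    then have "c * y \<le> c * \<Gamma>" using c by simp
    then have "c * y - c\<^sup>2 / 2 \<le> c * \<Gamma>" using zero_le_power2[of c] by linarith
    then show ?thesis using True by (simp add: l_def)
  qed (simp add: l_def)
  define T where "T j \<omega> = l (\<xi> (t j) h \<omega>)" for j \<omega>
  define L where "L j \<omega> = exp (c * \<xi> (t j) h \<omega> - c\<^sup>2 / 2)" for j \<omega>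
  have \<xi>m [measurable]: "\<xi> (t j) h \<in> borel_measurable M" if "j \<in> I" for j
    by (rule \<xi>_measurable[OF h t[OF that]])
  have Tm: "T j \<in> borel_measurable M" if "j \<in> I" for j
    unfolding T_def using measurable_compose[OF \<xi>m[OF that] lm] .
  have Tbd: "0 \<le> T j \<omega>" "T j \<omega> \<le> exp (c * \<Gamma>)" for j \<omega> unfolding T_def using l0 lb by auto
  have Ti: "integrable M (T j)" if "j \<in> I" for j
    by (rule integrable_const_bound[where B="exp (c * \<Gamma>)"]) (use Tbd Tm[OF that] in auto)
  have TTi: "integrable M (\<lambda>\<omega>. T i \<omega> * T j \<omega>)" if "i \<in> I" "j \<in> I" for i j
    by (rule integrable_const_bound[where B="exp (c * \<Gamma>) * exp (c * \<Gamma>)"])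
       (use Tbd Tm that in \<open>auto simp: abs_mult intro!: mult_mono borel_measurable_times\<close>)
  have Li: "integrable M (L j)" and L1: "(LINT \<omega>|M. L j \<omega>) = 1" if "j \<in> I" for j
    unfolding L_def[abs_def] by (rule integrable_tilt_\<xi>[OF h t[OF that]])+
  have TL: "T j \<omega> \<le> L j \<omega>" for j \<omega>
    unfolding T_def L_def l_def by (auto simp: indicator_def)
  \<comment> \<open>The mass kept by truncation; it is the same for all rectangles because every
    \<open>\<xi> (t j) h\<close> is standard normal.\<close>
  define a where "a = (LINT y|std_normal_distribution. l y)"
  have Ta: "(LINT \<omega>|M. T j \<omega>) = a" if "j \<in> I" for j
  proof -
    have "a = (LINT y|distr M borel (\<xi> (t j) h). l y)"
      unfolding a_def distr_wiener_integral_std_normal[OF \<xi>_wiener[OF h t[OF that]] norm_unit_rect[OF h t[OF that]]] ..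
    also have "\<dots> = (LINT \<omega>|M. T j \<omega>)"
      unfolding T_def by (rule integral_distr[OF \<xi>m[OF that] lm])
    finally show ?thesis ..
  qed
  obtain j0 where j0: "j0 \<in> I" using m I by (auto simp: m_def card_gt_0_iff)
  have a_le: "a \<le> 1"
    using integral_mono[OF Ti[OF j0] Li[OF j0] TL] unfolding Ta[OF j0] L1[OF j0] .
  \<comment> \<open>Under the weight, \<open>\<xi>\<close> becomes \<open>\<xi> + c\<close>.
    Exceeding the cut then requires \<open>\<xi> > \<Gamma> - c = x\<close>, which Chebyshev's
    inequality bounds.\<close>
  have a_ge: "1 - 1 / x\<^sup>2 \<le> a"
  proof -
    note ht = h t[OF j0]
    have "a = (LINT \<omega>|M. exp (c * \<xi> (t j0) h \<omega> - c\<^sup>2 / 2) *\<^sub>R (indicator {..\<Gamma>} (\<xi> (t j0) h \<omega>) :: real))"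
      unfolding Ta[OF j0, symmetric] T_def l_def by simp
    also have "\<dots> = (LINT \<omega>|M. indicator {..\<Gamma>} (\<xi> (t j0) h \<omega> + c))"
      by (rule wiener_tilt(1)[OF \<xi>_wiener[OF ht] norm_unit_rect[OF ht]]) simp
    finally have a: "a = (LINT \<omega>|M. indicator {..\<Gamma>} (\<xi> (t j0) h \<omega> + c))" .
    have "1 - 1 / x\<^sup>2 \<le> 1 - prob {\<omega>\<in>space M. x \<le> \<bar>\<xi> (t j0) h \<omega>\<bar>}"
      using prob_\<xi>_ge[OF ht xc(2)] by simp
    also have "\<dots> = (LINT \<omega>|M. 1 - indicator {\<omega>\<in>space M. x \<le> \<bar>\<xi> (t j0) h \<omega>\<bar>} \<omega>)"
      using \<xi>m[OF j0] by (subst Bochner_Integration.integral_diff) (auto simp: prob_space less_top[symmetric])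
    also have "\<dots> \<le> (LINT \<omega>|M. indicator {..\<Gamma>} (\<xi> (t j0) h \<omega> + c))"
    proof (rule integral_mono)
      show "integrable M (\<lambda>\<omega>. 1 - indicator {\<omega>\<in>space M. x \<le> \<bar>\<xi> (t j0) h \<omega>\<bar>} \<omega> :: real)"
        using \<xi>m[OF j0] by (auto simp: less_top[symmetric])
      show "integrable M (\<lambda>\<omega>. indicator {..\<Gamma>} (\<xi> (t j0) h \<omega> + c) :: real)"
        using \<xi>m[OF j0] by (intro integrable_const_bound[where B=1]) auto
      show "1 - indicator {\<omega>\<in>space M. x \<le> \<bar>\<xi> (t j0) h \<omega>\<bar>} \<omega> \<le> (indicator {..\<Gamma>} (\<xi> (t j0) h \<omega> + c) :: real)"
        if "\<omega> \<in> space M" for \<omega>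
        using that xc(1) by (auto simp: indicator_def)
    qed
    finally show ?thesis unfolding a .
  qed
  \<comment> \<open>Since \<open>exp (\<Gamma>\<^sup>2 / 2) = 1 / r\<close>, this is
    \<open>exp (- x\<^sup>2) / r\<close>: the truncated second moment is smaller than the order of
    the number of rectangles by the factor \<open>exp (- x\<^sup>2)\<close>.\<close>
  define q where "q = exp (\<Gamma>\<^sup>2 / 2 - x\<^sup>2)"
  have sq: "(LINT \<omega>|M. T j \<omega> * T j \<omega>) \<le> q" if "j \<in> I" for j
  proof -
    \<comment> \<open>The comparison is with the weight tilted by \<open>\<Gamma>\<close> instead of
      \<open>2 * c\<close>; that weight has mean 1, so integration leaves \<open>q\<close>.\<close>
    have "T j \<omega> * T j \<omega> \<le> q * exp (\<Gamma> * \<xi> (t j) h \<omega> - \<Gamma>\<^sup>2 / 2)" for \<omega>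
    proof (cases "\<xi> (t j) h \<omega> \<le> \<Gamma>")
      case True
      define y where "y = \<xi> (t j) h \<omega>"
      have "0 \<le> (2 * c - \<Gamma>) * (\<Gamma> - y)" using True c by (simp add: y_def)
      moreover have "\<Gamma>\<^sup>2 / 2 - x\<^sup>2 + (\<Gamma> * y - \<Gamma>\<^sup>2 / 2) - ((c * y - c\<^sup>2 / 2) + (c * y - c\<^sup>2 / 2)) = (2 * c - \<Gamma>) * (\<Gamma> - y)"
        unfolding xc(1)[symmetric] by (simp add: power2_eq_square algebra_simps)
      ultimately have "(c * y - c\<^sup>2 / 2) + (c * y - c\<^sup>2 / 2) \<le> \<Gamma>\<^sup>2 / 2 - x\<^sup>2 + (\<Gamma> * y - \<Gamma>\<^sup>2 / 2)" by linarith
      then show ?thesis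
        using True unfolding T_def l_def q_def y_def[symmetric] by (simp add: exp_add[symmetric])
    qed (simp add: T_def l_def q_def)
    then have "(LINT \<omega>|M. T j \<omega> * T j \<omega>) \<le> (LINT \<omega>|M. q * exp (\<Gamma> * \<xi> (t j) h \<omega> - \<Gamma>\<^sup>2 / 2))"
      using TTi[OF that that] integrable_tilt_\<xi>(1)[OF h t[OF that]] by (intro integral_mono) auto
    also have "\<dots> = q" using integrable_tilt_\<xi>(2)[OF h t[OF that], of \<Gamma>] by simp
    finally show ?thesis .
  qed
  have cross: "(LINT \<omega>|M. T i \<omega> * T j \<omega>) = a\<^sup>2" if ij: "i \<in> I" "j \<in> I" "i \<noteq> j" for i j
  proof -
    have "(LINT x|cube_measure. unit_rect (t i) h x * unit_rect (t j) h x) = 0"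
      unfolding inner_unit_rect[OF h t[OF ij(2)] t[OF ij(1)]] disj[OF ij] by simp
    then have "indep_var borel (\<xi> (t i) h) borel (\<xi> (t j) h)"
      by (rule orthogonal_wiener_integrals_indep[OF \<xi>_wiener[OF h t[OF ij(1)]] \<xi>_wiener[OF h t[OF ij(2)]]])
    then have "indep_var borel (l \<circ> \<xi> (t i) h) borel (l \<circ> \<xi> (t j) h)"
      by (rule indep_var_compose[OF _ lm lm])
    moreover have "l \<circ> \<xi> (t k) h = T k" for k by (simp add: T_def fun_eq_iff)
    ultimately have "indep_var borel (T i) borel (T j)" by simp
    from indep_var_lebesgue_integral[OF this Ti[OF ij(1)] Ti[OF ij(2)]]
    show ?thesis unfolding Ta[OF ij(1)] Ta[OF ij(2)] by (simp add: power2_eq_square)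
  qed
  define S where "S \<omega> = (\<Sum>j\<in>I. T j \<omega> - a)" for \<omega>
  have Sm: "S \<in> borel_measurable M" unfolding S_def using Tm by (intro borel_measurable_sum borel_measurable_diff) auto
  note S2 = uncorrelated_sum_second_moment[of I T a q, OF I Ti TTi Ta cross sq, folded S_def m_def]
  note Sabs = expectation_abs_le_sqrt[OF Sm S2(1)]
  have Sle: "(LINT \<omega>|M. \<bar>S \<omega>\<bar>) \<le> m * sqrt (2 ^ CARD('d) * exp (- x\<^sup>2))"
  proof -
    have "(LINT \<omega>|M. (S \<omega>)\<^sup>2) \<le> m * q" by (rule S2(2))
    \<comment> \<open>The packing bound enters as a factor that is at least 1, producing
      \<open>m\<^sup>2\<close>, which cancels when the sum is averaged.\<close>
    also have "\<dots> \<le> m * q * (m * 2 ^ CARD('d) * r)"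
      using cardI m by (simp add: m_def[symmetric] q_def)
    also have "\<dots> = m\<^sup>2 * (2 ^ CARD('d) * (q * r))" by (simp add: power2_eq_square)
    also have "q * r = exp (- x\<^sup>2)" unfolding q_def er[symmetric] exp_add[symmetric] by simp
    finally have "sqrt (LINT \<omega>|M. (S \<omega>)\<^sup>2) \<le> sqrt (m\<^sup>2 * (2 ^ CARD('d) * exp (- x\<^sup>2)))" by simp
    also have "\<dots> = m * sqrt (2 ^ CARD('d) * exp (- x\<^sup>2))" using m by (simp add: real_sqrt_mult)
    finally show ?thesis using Sabs(2) by linarith
  qed
  define E where "E j = test_expectation M W n (rect_signal \<mu> (cbox (t j - h) (t j + h))) \<phi>" for j
  have \<Phi>prod: "integrable M (\<lambda>\<omega>. Z \<omega> * \<Phi> \<omega>)" if "integrable M Z" for Z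
    by (rule Bochner_Integration.integrable_bound[OF that])
       (use \<Phi>01 that in \<open>auto simp: abs_mult intro!: mult_left_le\<close>)
  \<comment> \<open>Because the test is at most 1, replacing the likelihood ratio by its truncation
    costs at most the lost mass \<open>1 - a\<close>.\<close>
  have Ej: "E j \<le> (LINT \<omega>|M. T j \<omega> * \<Phi> \<omega>) + (1 - a)" if "j \<in> I" for j
  proof -
    have "E j = (LINT \<omega>|M. L j \<omega> * \<Phi> \<omega>)"
      unfolding E_def L_def \<Phi>_def
      by (rule test_expectation_rect_signal[OF h t[OF that] _ it]) (use \<mu> in \<open>auto simp: r_def\<close>)
    also have "\<dots> \<le> (LINT \<omega>|M. T j \<omega> * \<Phi> \<omega> + (L j \<omega> - T j \<omega>))"
    proof (rule integral_mono)
      show "integrable M (\<lambda>\<omega>. T j \<omega> * \<Phi> \<omega> + (L j \<omega> - T j \<omega>))"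
        using \<Phi>prod[OF Ti[OF that]] Ti[OF that] Li[OF that] by simp
      have "(L j \<omega> - T j \<omega>) * \<Phi> \<omega> \<le> L j \<omega> - T j \<omega>" for \<omega>
        using TL[of j \<omega>] \<Phi>01[of \<omega>] by (intro mult_left_le) auto
      then show "L j \<omega> * \<Phi> \<omega> \<le> T j \<omega> * \<Phi> \<omega> + (L j \<omega> - T j \<omega>)" for \<omega>
        unfolding left_diff_distrib by (smt (verit))
    qed (rule \<Phi>prod[OF Li[OF that]])
    also have "\<dots> = (LINT \<omega>|M. T j \<omega> * \<Phi> \<omega>) + (1 - a)"
      using \<Phi>prod[OF Ti[OF that]] Ti[OF that] Li[OF that] Ta[OF that] L1[OF that] by simp
    finally show ?thesis .
  qed
  have "(\<Sum>j\<in>I. LINT \<omega>|M. T j \<omega> * \<Phi> \<omega>) = (LINT \<omega>|M. (\<Sum>j\<in>I. T j \<omega> * \<Phi> \<omega>))"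
    using \<Phi>prod[OF Ti] by (simp add: Bochner_Integration.integral_sum)
  also have "\<dots> \<le> (LINT \<omega>|M. \<bar>S \<omega>\<bar> + m * a * \<Phi> \<omega>)"
  proof (rule integral_mono)
    show "integrable M (\<lambda>\<omega>. \<Sum>j\<in>I. T j \<omega> * \<Phi> \<omega>)" using \<Phi>prod[OF Ti] by (intro Bochner_Integration.integrable_sum)
    show "integrable M (\<lambda>\<omega>. \<bar>S \<omega>\<bar> + m * a * \<Phi> \<omega>)" using Sabs(1) \<Phi>i by simp
    show "(\<Sum>j\<in>I. T j \<omega> * \<Phi> \<omega>) \<le> \<bar>S \<omega>\<bar> + m * a * \<Phi> \<omega>" for \<omega>
    proof -
      \<comment> \<open>Centring: the fluctuation \<open>S\<close> is controlled in L1, while the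
        constant part \<open>m * a\<close> sees only the null expectation of the test.\<close>
      have "(\<Sum>j\<in>I. T j \<omega> * \<Phi> \<omega>) = S \<omega> * \<Phi> \<omega> + m * a * \<Phi> \<omega>"
        unfolding S_def m_def sum_distrib_right[symmetric] sum_subtractf by (simp add: algebra_simps)
      moreover have "S \<omega> * \<Phi> \<omega> \<le> \<bar>S \<omega>\<bar> * 1"
        using \<Phi>01[of \<omega>] by (intro mult_mono) auto
      ultimately show ?thesis by linarith
    qed
  qed
  also have "\<dots> = (LINT \<omega>|M. \<bar>S \<omega>\<bar>) + m * (a * (LINT \<omega>|M. \<Phi> \<omega>))"
    using Sabs(1) \<Phi>i by simp
  also have "\<dots> \<le> m * sqrt (2 ^ CARD('d) * exp (- x\<^sup>2)) + m * \<alpha>"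
  proof -
    have "a * (LINT \<omega>|M. \<Phi> \<omega>) \<le> 1 * (LINT \<omega>|M. \<Phi> \<omega>)" using a_le \<Phi>0 by (intro mult_right_mono)
    then have "m * (a * (LINT \<omega>|M. \<Phi> \<omega>)) \<le> m * \<alpha>" using \<Phi>\<alpha> m by (intro mult_left_mono) auto
    with Sle show ?thesis by linarith
  qed
  finally have sumT: "(\<Sum>j\<in>I. LINT \<omega>|M. T j \<omega> * \<Phi> \<omega>) \<le> m * sqrt (2 ^ CARD('d) * exp (- x\<^sup>2)) + m * \<alpha>" .
  define b where "b = \<alpha> + 1 / x\<^sup>2 + sqrt (2 ^ CARD('d) * exp (- x\<^sup>2))"
  have "(\<Sum>j\<in>I. E j) \<le> (\<Sum>j\<in>I. (LINT \<omega>|M. T j \<omega> * \<Phi> \<omega>) + (1 - a))"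
    by (rule sum_mono[OF Ej])
  also have "\<dots> = (\<Sum>j\<in>I. LINT \<omega>|M. T j \<omega> * \<Phi> \<omega>) + m * (1 - a)"
    by (simp add: sum.distrib m_def)
  also have "\<dots> \<le> m * b"
  proof -
    have "m * (1 - a) \<le> m * (1 / x\<^sup>2)" using a_ge m by (intro mult_left_mono) auto
    then show ?thesis using sumT unfolding b_def by (simp add: distrib_left)
  qed
  finally have sumE: "(\<Sum>j\<in>I. E j) \<le> m * b" .
  \<comment> \<open>The infimum over the class is bounded through one member whose power does not
    exceed the average over the packing.\<close>
  have "\<exists>j\<in>I. E j \<le> b"
  proof (rule ccontr)
    assume "\<not> ?thesis"
    then have "(\<Sum>j\<in>I. b) < (\<Sum>j\<in>I. E j)"
      using I j0 by (intro sum_strict_mono) auto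
    with sumE show False by (simp add: m_def)
  qed
  then obtain j where j: "j \<in> I" "E j \<le> b" by blast
  have "rect_signal \<mu> (cbox (t j - h) (t j + h)) \<in> G_minus n h \<epsilon>"
  proof -
    have "cbox (t j - h) (t j + h) \<in> closed_rects h" using t[OF j(1)] by (auto simp: closed_rects_def)
    moreover have "measure lborel (cbox (t j - h) (t j + h)) = r" using centers_rect(2)[OF h t[OF j(1)]] by (simp add: r_def)
    moreover have "\<bar>\<mu>\<bar> * sqrt (real n * r) = c"
    proof -
      have "0 < \<mu>" unfolding \<mu>_def using c n r by simp
      then show ?thesis using \<mu>(1) by simp
    qed
    ultimately show ?thesis unfolding G_minus_def signal_strength_def using \<mu>(2)
      by (intro CollectI exI[of _ \<mu>] exI[of _ "cbox (t j - h) (t j + h)"]) (simp add: c_def \<Gamma>_def)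
  qed
  then have "(INF f\<in>G_minus n h \<epsilon>. ereal (test_expectation M W n f \<phi>)) \<le> ereal (E j)"
    unfolding E_def by (rule INF_lower)
  also have "\<dots> \<le> ereal b" using j(2) by simp
  finally show ?thesis unfolding b_def .
qed

section \<open>Passage to the limit in the sample size\<close>

lemma limsup_power_bounded_signal:
  assumes \<alpha>: "\<alpha> < 1" and \<phi>: "\<And>n. level_test M W \<alpha> n (\<phi> n)" and B: "\<And>n. B n \<in> hyperrectangles"
    and lim: "limsup (\<lambda>n. ereal (signal_strength n (\<mu> n) (B n))) < \<infinity>"
  shows "limsup (\<lambda>n. ereal (test_expectation M W n (rect_signal (\<mu> n) (B n)) (\<phi> n))) < 1"
proof -
  obtain N :: nat where "limsup (\<lambda>n. ereal (signal_strength n (\<mu> n) (B n))) < ereal (real N)"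
    using lim less_PInf_Ex_of_nat by auto
  then have ev: "eventually (\<lambda>n. ereal (signal_strength n (\<mu> n) (B n)) < ereal (real N)) sequentially"
    by (rule Limsup_lessD)
  \<comment> \<open>Chosen so that the discarded event costs at most half of
    \<open>1 - \<alpha>\<close>, which leaves a fixed positive gap \<open>\<delta>\<close> below
    power 1.\<close>
  define K where "K = sqrt (2 / (1 - \<alpha>))"
  have K: "0 < K" "1 / K\<^sup>2 = (1 - \<alpha>) / 2" unfolding K_def using \<alpha> by auto
  define \<delta> where "\<delta> = exp (- real N * K - (real N)\<^sup>2 / 2) * (1 - \<alpha> - 1 / K\<^sup>2)"
  have \<delta>: "0 < \<delta>" unfolding \<delta>_def K(2) using \<alpha> by (intro mult_pos_pos) auto
  have "eventually (\<lambda>n. ereal (test_expectation M W n (rect_signal (\<mu> n) (B n)) (\<phi> n)) \<le> ereal (1 - \<delta>)) sequentially"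
    using ev
  proof eventually_elim
    case (elim n)
    obtain h t where ht: "h \<in> bandwidths" "t \<in> centers h" "B n = cbox (t - h) (t + h) \<or> B n = box (t - h) (t + h)"
      using B by (rule hyperrectangleE)
    from elim have "signal_strength n (\<mu> n) (B n) \<le> real N" by simp
    from test_expectation_le_of_bounded_signal[OF ht \<phi> this K(1)] show ?case by (simp add: \<delta>_def)
  qed
  then have "limsup (\<lambda>n. ereal (test_expectation M W n (rect_signal (\<mu> n) (B n)) (\<phi> n))) \<le> ereal (1 - \<delta>)"
    by (rule Limsup_bounded)
  also have "\<dots> < 1" using \<delta> by simp
  finally show ?thesis .
qed

lemma rejection_prob_tendsto_1:
  assumes B: "\<And>n. B n \<in> hyperrectangles"
    and low: "0 < liminf (\<lambda>n. ereal (measure lborel (B n)))"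
    and lim: "filterlim (\<lambda>n. signal_strength n (\<mu> n) (B n)) at_top sequentially"
  shows "(\<lambda>n. rejection_prob M cube_kernel X \<alpha> n (rect_signal (\<mu> n) (B n))) \<longlonglongrightarrow> 1"
proof -
  obtain b where b0: "0 < ereal b" and bl: "ereal b < liminf (\<lambda>n. ereal (measure lborel (B n)))"
    using ereal_dense2[OF low] by blast
  from b0 have b: "0 < b" by simp
  note evb = less_LiminfD[OF bl]
  \<comment> \<open>\<open>scale_Gamma\<close> decreases in the volume, so the eventual lower bound
    \<open>b\<close> on the volumes replaces all penalties by one constant.\<close>
  define s where "s n = signal_strength n (\<mu> n) (B n) - (scale_Gamma b + 4 * \<bar>critical_value M cube_kernel X \<alpha>\<bar>)" for n
  have s: "filterlim s at_top sequentially"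
    unfolding s_def[abs_def] diff_conv_add_uminus
    using filterlim_tendsto_add_at_top[OF tendsto_const lim, of "- (scale_Gamma b + 4 * \<bar>critical_value M cube_kernel X \<alpha>\<bar>)"]
    by (simp add: add.commute)
  have evs: "eventually (\<lambda>n. 0 < s n) sequentially"
    using s by (simp add: filterlim_at_top_dense)
  have "eventually (\<lambda>n. 1 - 1 / (s n)\<^sup>2 \<le> rejection_prob M cube_kernel X \<alpha> n (rect_signal (\<mu> n) (B n))) sequentially"
    using evb evs
  proof eventually_elim
    case (elim n)
    obtain h t where ht: "h \<in> bandwidths" "t \<in> centers h" "B n = cbox (t - h) (t + h) \<or> B n = box (t - h) (t + h)"
      and m: "measure lborel (B n) = rect_volume h"
      using B by (rule hyperrectangleE)
    have "b < rect_volume h" using elim m by simp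
    then have "scale_Gamma (rect_volume h) \<le> scale_Gamma b"
      unfolding scale_Gamma_def using b by (intro real_sqrt_le_mono mult_left_mono) (auto simp: ln_div)
    then have ss: "s n \<le> signal_strength n (\<mu> n) (B n) - scale_Gamma (rect_volume h) - 4 * \<bar>critical_value M cube_kernel X \<alpha>\<bar>" (is "_ \<le> ?s")
      unfolding s_def by linarith
    then have "1 / ?s\<^sup>2 \<le> 1 / (s n)\<^sup>2"
      using elim by (intro divide_left_mono power_mono mult_pos_pos zero_less_power) auto
    moreover have "1 - 1 / ?s\<^sup>2 \<le> rejection_prob M cube_kernel X \<alpha> n (rect_signal (\<mu> n) (B n))"
      by (rule rejection_prob_ge[OF ht refl]) (use ss elim in linarith)
    ultimately show ?case by linarith
  qed
  then show ?thesis
    by (rule tendsto_sandwich[OF _ _ one_minus_inverse_square_tendsto[OF s] tendsto_const])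
       (simp add: rejection_prob_def)
qed

text \<open>The error terms of the finite-sample bound depend on \<open>n\<close> only through
  \<open>x n\<close>, which tends to infinity; its side conditions hold for all large
  \<open>n\<close>.\<close>

lemma limsup_INF_G_minus_le:
  fixes h :: "nat \<Rightarrow> real ^ 'd"
  assumes h: "\<And>n. h n \<in> bandwidths" and h0: "(\<lambda>n. \<Prod>i\<in>UNIV. h n $ i) \<longlonglongrightarrow> 0"
    and \<epsilon>: "\<And>n. 0 < \<epsilon> n" "\<epsilon> \<longlonglongrightarrow> 0"
    and lim: "filterlim (\<lambda>n. \<epsilon> n * sqrt (2 * ln (1 / rect_volume (h n)))) at_top sequentially"
    and \<phi>: "\<And>n. level_test M W \<alpha> n (\<phi> n)"
  shows "limsup (\<lambda>n. INF f\<in>G_minus n (h n) (\<epsilon> n). ereal (test_expectation M W n f (\<phi> n))) \<le> ereal \<alpha>"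
proof -
  define x where "x n = \<epsilon> n * sqrt (2 * ln (1 / rect_volume (h n)))" for n
  define D :: real where "D = 2 ^ CARD('d)"
  have "eventually (\<lambda>n. \<epsilon> n < 1 / 2) sequentially" using \<epsilon>(2) by (rule order_tendstoD) simp
  moreover have "eventually (\<lambda>n. rect_volume (h n) < 1) sequentially"
    using rect_volume_tendsto_0[OF h0] by (rule order_tendstoD) simp
  ultimately have "eventually (\<lambda>n. (INF f\<in>G_minus n (h n) (\<epsilon> n). ereal (test_expectation M W n f (\<phi> n)))
      \<le> ereal (\<alpha> + (1 / (x n)\<^sup>2 + sqrt (D * exp (- (x n)\<^sup>2))))) sequentially"
    using eventually_gt_at_top[of 0]
  proof eventually_elim
    case (elim n)
    from INF_G_minus_le[OF h \<phi> elim(3) \<epsilon>(1) elim(1,2) x_def]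
    show ?case by (simp add: D_def add.assoc)
  qed
  then have "limsup (\<lambda>n. INF f\<in>G_minus n (h n) (\<epsilon> n). ereal (test_expectation M W n f (\<phi> n)))
      \<le> limsup (\<lambda>n. ereal (\<alpha> + (1 / (x n)\<^sup>2 + sqrt (D * exp (- (x n)\<^sup>2)))))"
    by (rule Limsup_mono)
  also have "\<dots> = ereal (\<alpha> + 0)"
  proof (rule lim_imp_Limsup)
    have "0 < D" by (simp add: D_def)
    then have "((\<lambda>y. 1 / y\<^sup>2 + sqrt (D * exp (- y\<^sup>2))) \<longlongrightarrow> 0) at_top" by real_asymp
    from filterlim_compose[OF this lim[folded x_def]]
    show "(\<lambda>n. ereal (\<alpha> + (1 / (x n)\<^sup>2 + sqrt (D * exp (- (x n)\<^sup>2))))) \<longlonglongrightarrow> ereal (\<alpha> + 0)"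
      by (intro tendsto_ereal tendsto_add tendsto_const)
  qed simp
  finally show ?thesis by simp
qed

lemma INF_G_plus_tendsto_1:
  fixes h :: "nat \<Rightarrow> real ^ 'd"
  assumes h: "\<And>n. h n \<in> bandwidths"
    and lim: "filterlim (\<lambda>n. \<epsilon> n * sqrt (2 * ln (1 / rect_volume (h n)))) at_top sequentially"
  shows "(\<lambda>n. INF f\<in>G_plus n (h n) (\<epsilon> n). ereal (rejection_prob M cube_kernel X \<alpha> n f)) \<longlonglongrightarrow> 1"
proof -
  define s where "s n = \<epsilon> n * sqrt (2 * ln (1 / rect_volume (h n))) - 4 * \<bar>critical_value M cube_kernel X \<alpha>\<bar>" for n
  have s: "filterlim s at_top sequentially"
    unfolding s_def[abs_def] diff_conv_add_uminus
    using filterlim_tendsto_add_at_top[OF tendsto_const lim, of "- (4 * \<bar>critical_value M cube_kernel X \<alpha>\<bar>)"]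
    by (simp add: add.commute)
  have evs: "eventually (\<lambda>n. 0 < s n) sequentially"
    using s by (simp add: filterlim_at_top_dense)
  have lower: "eventually (\<lambda>n. ereal (1 - 1 / (s n)\<^sup>2) \<le> (INF f\<in>G_plus n (h n) (\<epsilon> n). ereal (rejection_prob M cube_kernel X \<alpha> n f))) sequentially"
    using evs
  proof eventually_elim
    case (elim n)
    show ?case
    proof (rule INF_greatest)
      fix f assume "f \<in> G_plus n (h n) (\<epsilon> n)"
      then obtain \<mu> B where f: "f = rect_signal \<mu> B" and B: "B \<in> closed_rects (h n)"
        and st: "(1 + \<epsilon> n) * sqrt (2 * ln (1 / measure lborel B)) \<le> signal_strength n \<mu> B"
        unfolding G_plus_def by blast
      obtain t where t: "t \<in> centers (h n)" and Bt: "B = cbox (t - h n) (t + h n) \<or> B = box (t - h n) (t + h n)"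
        using B unfolding closed_rects_def by blast
      have mB: "measure lborel B = rect_volume (h n)" by (rule measure_closed_rects[OF h B])
      \<comment> \<open>The penalty cancels the leading part of the required strength, \<open>(1 +
        \<epsilon>) * \<Gamma> - \<Gamma> = \<epsilon> * \<Gamma>\<close>, uniformly over the
        class.\<close>
      have ss: "s n \<le> signal_strength n \<mu> B - scale_Gamma (rect_volume (h n)) - 4 * \<bar>critical_value M cube_kernel X \<alpha>\<bar>" (is "_ \<le> ?s")
        using st unfolding s_def mB scale_Gamma_def by (simp add: distrib_right)
      then have "1 / ?s\<^sup>2 \<le> 1 / (s n)\<^sup>2"
        using elim by (intro divide_left_mono power_mono mult_pos_pos zero_less_power) auto
      moreover have "1 - 1 / ?s\<^sup>2 \<le> rejection_prob M cube_kernel X \<alpha> n (rect_signal \<mu> B)"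
        by (rule rejection_prob_ge[OF h t Bt refl]) (use ss elim in linarith)
      ultimately show "ereal (1 - 1 / (s n)\<^sup>2) \<le> ereal (rejection_prob M cube_kernel X \<alpha> n f)"
        unfolding f by simp
    qed
  qed
  \<comment> \<open>An infimum over an empty class would be infinite, so a member must be exhibited.
    This takes \<open>n > 0\<close>, since at \<open>n = 0\<close> every signal strength is
    0.\<close>
  have upper: "eventually (\<lambda>n. (INF f\<in>G_plus n (h n) (\<epsilon> n). ereal (rejection_prob M cube_kernel X \<alpha> n f)) \<le> ereal 1) sequentially"
    using eventually_gt_at_top[of 0]
  proof eventually_elim
    case (elim n)
    define r where "r = rect_volume (h n)"
    define B where "B = cbox (h n - h n) (h n + h n)"
    \<comment> \<open>The added 1 keeps the amplitude nonzero even if the required strength is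
      0.\<close>
    define v where "v = \<bar>(1 + \<epsilon> n) * sqrt (2 * ln (1 / r))\<bar> + 1"
    have c: "h n \<in> centers (h n)" using h[of n] by (auto simp: centers_def bandwidths_def algebra_simps)
    then have B: "B \<in> closed_rects (h n)" unfolding closed_rects_def B_def by blast
    have mB: "measure lborel B = r" unfolding r_def by (rule measure_closed_rects[OF h B])
    have r: "0 < r" unfolding r_def by (rule rect_volume_bounds(1)[OF h])
    with elim have nr: "0 < real n * r" by simp
    have v: "0 < v" "(1 + \<epsilon> n) * sqrt (2 * ln (1 / r)) \<le> v" unfolding v_def by linarith+
    have "signal_strength n (v / sqrt (real n * r)) B = v"
      unfolding signal_strength_def mB using elim r v(1) by simp
    with v nr r elim B have "rect_signal (v / sqrt (real n * r)) B \<in> G_plus n (h n) (\<epsilon> n)"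
      unfolding G_plus_def
      by (intro CollectI exI[of _ "v / sqrt (real n * r)"] exI[of _ B]) (auto simp: mB)
    then have "(INF f\<in>G_plus n (h n) (\<epsilon> n). ereal (rejection_prob M cube_kernel X \<alpha> n f))
        \<le> ereal (rejection_prob M cube_kernel X \<alpha> n (rect_signal (v / sqrt (real n * r)) B))"
      by (rule INF_lower)
    also have "\<dots> \<le> ereal 1" by (simp add: rejection_prob_def)
    finally show ?case .
  qed
  have "(\<lambda>n. ereal (1 - 1 / (s n)\<^sup>2)) \<longlonglongrightarrow> ereal 1"
    by (intro tendsto_ereal one_minus_inverse_square_tendsto s)
  from tendsto_sandwich[OF lower upper this tendsto_const] show ?thesis by (simp add: one_ereal_def)
qed

end

theorem theorem3p2:
  fixes M :: "'w measure"
    and W :: "real ^ 'd \<Rightarrow> 'w \<Rightarrow> real"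
    and X :: "real ^ 'd \<Rightarrow> real ^ 'd \<Rightarrow> 'w \<Rightarrow> real"
    and \<alpha> :: real
  assumes "brownian_sheet M W"
    and "continuous_wiener_version M W cube_kernel X"
    and "0 < \<alpha>" "\<alpha> < 1"
  shows
    "(\<forall>\<phi> \<mu> B.
        (\<forall>n. level_test M W \<alpha> n (\<phi> n)) \<and>
        (\<forall>n. \<mu> n \<noteq> 0 \<and> B n \<in> hyperrectangles) \<and>
        liminf (\<lambda>n. ereal (measure lborel (B n))) > 0 \<and>
        limsup (\<lambda>n. ereal (signal_strength n (\<mu> n) (B n))) < \<infinity> \<longrightarrow>
        limsup (\<lambda>n. ereal (test_expectation M W n (rect_signal (\<mu> n) (B n)) (\<phi> n))) < 1) \<and>
     (\<forall>\<mu> B.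
        (\<forall>n. \<mu> n \<noteq> 0 \<and> B n \<in> hyperrectangles) \<and>
        liminf (\<lambda>n. ereal (measure lborel (B n))) > 0 \<and>
        filterlim (\<lambda>n. signal_strength n (\<mu> n) (B n)) at_top sequentially \<longrightarrow>
        (\<lambda>n. rejection_prob M cube_kernel X \<alpha> n (rect_signal (\<mu> n) (B n))) \<longlonglongrightarrow> 1) \<and>
     (\<forall>(h :: nat \<Rightarrow> real ^ 'd) \<epsilon>.
        (\<forall>n. h n \<in> bandwidths) \<and>
        (\<lambda>n. \<Prod>i\<in>UNIV. h n $ i) \<longlonglongrightarrow> 0 \<and>
        (\<forall>n. 0 < \<epsilon> n) \<and> \<epsilon> \<longlonglongrightarrow> 0 \<and>
        filterlim (\<lambda>n. \<epsilon> n * sqrt (2 * ln (1 / rect_volume (h n)))) at_top sequentially \<longrightarrow>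
        (\<forall>\<phi>. (\<forall>n. level_test M W \<alpha> n (\<phi> n)) \<longrightarrow>
           limsup (\<lambda>n. INF f\<in>G_minus n (h n) (\<epsilon> n). ereal (test_expectation M W n f (\<phi> n)))
             \<le> ereal \<alpha>) \<and>
        (\<lambda>n. INF f\<in>G_plus n (h n) (\<epsilon> n). ereal (rejection_prob M cube_kernel X \<alpha> n f))
          \<longlonglongrightarrow> 1)"
proof -
  interpret prob_space M using assms(1) by (simp add: brownian_sheet_def)
  interpret multiscale_space M W X by unfold_locales (fact assms)+
  show ?thesis
  proof (intro conjI allI impI)
    fix \<phi> \<mu> and B :: "nat \<Rightarrow> (real ^ 'd) set"
    assume "(\<forall>n. level_test M W \<alpha> n (\<phi> n)) \<and> (\<forall>n. \<mu> n \<noteq> 0 \<and> B n \<in> hyperrectangles) \<and>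
      liminf (\<lambda>n. ereal (measure lborel (B n))) > 0 \<and>
      limsup (\<lambda>n. ereal (signal_strength n (\<mu> n) (B n))) < \<infinity>"
    then show "limsup (\<lambda>n. ereal (test_expectation M W n (rect_signal (\<mu> n) (B n)) (\<phi> n))) < 1"
      by (intro limsup_power_bounded_signal[OF assms(4)]) auto
  next
    fix \<mu> and B :: "nat \<Rightarrow> (real ^ 'd) set"
    assume "(\<forall>n. \<mu> n \<noteq> 0 \<and> B n \<in> hyperrectangles) \<and> liminf (\<lambda>n. ereal (measure lborel (B n))) > 0 \<and>
      filterlim (\<lambda>n. signal_strength n (\<mu> n) (B n)) at_top sequentially"
    then show "(\<lambda>n. rejection_prob M cube_kernel X \<alpha> n (rect_signal (\<mu> n) (B n))) \<longlonglongrightarrow> 1"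
      by (intro rejection_prob_tendsto_1) auto
  next
    fix h :: "nat \<Rightarrow> real ^ 'd" and \<epsilon> \<phi>
    assume "(\<forall>n. h n \<in> bandwidths) \<and> (\<lambda>n. \<Prod>i\<in>UNIV. h n $ i) \<longlonglongrightarrow> 0 \<and>
        (\<forall>n. 0 < \<epsilon> n) \<and> \<epsilon> \<longlonglongrightarrow> 0 \<and>
        filterlim (\<lambda>n. \<epsilon> n * sqrt (2 * ln (1 / rect_volume (h n)))) at_top sequentially"
      "\<forall>n. level_test M W \<alpha> n (\<phi> n)"
    then show "limsup (\<lambda>n. INF f\<in>G_minus n (h n) (\<epsilon> n). ereal (test_expectation M W n f (\<phi> n))) \<le> ereal \<alpha>"
      by (intro limsup_INF_G_minus_le) auto
  next
    fix h :: "nat \<Rightarrow> real ^ 'd" and \<epsilon>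
    assume "(\<forall>n. h n \<in> bandwidths) \<and> (\<lambda>n. \<Prod>i\<in>UNIV. h n $ i) \<longlonglongrightarrow> 0 \<and>
        (\<forall>n. 0 < \<epsilon> n) \<and> \<epsilon> \<longlonglongrightarrow> 0 \<and>
        filterlim (\<lambda>n. \<epsilon> n * sqrt (2 * ln (1 / rect_volume (h n)))) at_top sequentially"
    then show "(\<lambda>n. INF f\<in>G_plus n (h n) (\<epsilon> n). ereal (rejection_prob M cube_kernel X \<alpha> n f)) \<longlonglongrightarrow> 1"
      by (intro INF_G_plus_tendsto_1) auto
  qed
qed

end
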